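(* Let $\Omega \subset \mathbb{R}^n$ ($n \ge 1$) be open and connected with $\mathbf{0} \in \Omega$, and let $\Sigma = \{x \in \Omega : x_1 = 0\}$, $\Omega_L = \{x \in \Omega : x_1 < 0\}$, $\Omega_R = \{x \in \Omega : x_1 > 0\}$. Let $f^L : \Omega_L \cup \Sigma \to \mathbb{R}^n$ and $f^R : \Omega_R \cup \Sigma \to \mathbb{R}^n$ be $C^1$ (up to and including $\Sigma$), and suppose that $f^L(\mathbf{0}) = \mathbf{0}$, so that $$f^L(x) = A x + o(\|x\|), \qquad f^R(x) = c + O(\|x\|) \qquad (x \to \mathbf{0}),$$ where $A = D f^L(\mathbf{0}) \in \mathbb{R}^{n \times n}$ and $c = f^R(\mathbf{0}) \in \mathbb{R}^n$. Suppose that the first component of $c$ satisfies $c_1 < 0$. Consider the Filippov system on $\Omega$ $$\dot{x} = f(x) = \begin{cases} f^L(x), & x_1 < 0, \\ f^R(x), & x_1 > 0, \end{cases}$$ and the Filippov system on $\mathbb{R}^n$ $$\dot{x} = F(x) = \begin{cases} A x, & x_1 < 0, \\ c, & x_1 > 0. \end{cases}$$ Then $\mathbf{0}$ is an exponentially stable equilibrium of $\dot{x} = f(x)$ if and only if it is an exponentially stable equilibrium of $\dot{x} = F(x)$.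
   Context: $\|\cdot\|$ is a norm on $\mathbb{R}^n$, $\mathbf{0}$ is the origin, $x_1$ denotes the first component of $x$, and $B_\delta(x) = \{y \in \mathbb{R}^n : \|x-y\| < \delta\}$. Let $\Omega \subset \mathbb{R}^n$ be open and connected, let $\Sigma \subset \Omega$ have zero Lebesgue measure, and let $f : \Omega \setminus \Sigma \to \mathbb{R}^n$ be measurable and bounded on bounded subsets of $\Omega \setminus \Sigma$ (a standing assumption for all systems considered). Define the set-valued function $$\mathcal{F}(x) = \bigcap_{\delta > 0} \mathrm{co}\left[ f(B_\delta(x) \setminus \Sigma) \right],$$ where $\mathrm{co}[U]$ is the smallest closed convex set containing $U$. (For a two-piece system with pieces $f^L$, $f^R$ continuous up to $\Sigma = \{x \in \Omega : x_1 = 0\}$, this is $\{f^L(x)\}$ if $x_1<0$, $\{f^R(x)\}$ if $x_1>0$, and $\{(1-\lambda) f^L(x) + \lambda f^R(x) : 0 \le \lambda \le 1\}$ if $x_1=0$.) An absolutely continuous function $\phi : [a,b] \to \Omega$ is a Filippov solution to $\dot{x} = f(x)$ if $\dot\phi(t) \in \mathcal{F}(\phi(t))$ for almost all $t \in [a,b]$; on an unbounded interval, a Filippov solution is a function whose restriction to each compact subinterval is a Filippov solution. A point $x^* \in \Omega$ is an equilibrium if the constant function $\phi(t) = x^*$ is a Filippov solution for all $t \in \mathbb{R}$. An equilibrium $x^*$ is exponentially stable if there exist $\alpha \ge 1$, $\beta > 0$ and $\delta > 0$ such that every Filippov solution $\phi(t)$ with $\phi(0) \in B_\delta(x^* )$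 has $\|\phi(t) - x^*\| \le \alpha e^{-\beta t} \|\phi(0) - x^*\|$ for all $t \ge 0$. (Here solutions are understood to be maximally extended forward in time, and the requirement includes that they are defined for all $t \ge 0$.) *)

theory Defs
  imports "HOL-Analysis.Analysis"
begin

definition is_norm :: "('a::real_vector \<Rightarrow> real) \<Rightarrow> bool" where
  "is_norm N \<longleftrightarrow>
     (\<forall>x. 0 \<le> N x) \<and> (\<forall>x. N x = 0 \<longleftrightarrow> x = 0) \<and>
     (\<forall>r x. N (r *\<^sub>R x) = \<bar>r\<bar> * N x) \<and> (\<forall>x y. N (x + y) \<le> N x + N y)"

definition norm_ball :: "('a::real_vector \<Rightarrow> real) \<Rightarrow> 'a \<Rightarrow> real \<Rightarrow> 'a set" where
  "norm_ball N x \<delta> = {y. N (x - y) < \<delta>}"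

text \<open>Continuous differentiability of a map on a set \<open>S\<close> that need not be open, with derivatives
  relative to \<open>S\<close>. When \<open>S\<close> is the part of an open set in a closed half-space, this is
  continuous differentiability up to and including the boundary, and the derivatives are unique.\<close>

definition C1_on :: "'a::real_normed_vector set \<Rightarrow> ('a \<Rightarrow> 'b::real_normed_vector) \<Rightarrow> bool" where
  "C1_on S g \<longleftrightarrow>
     (\<exists>g' :: 'a \<Rightarrow> 'a \<Rightarrow>\<^sub>L 'b.
        (\<forall>x\<in>S. (g has_derivative blinfun_apply (g' x)) (at x within S)) \<and> continuous_on S g')"

text \<open>A function \<open>f\<close> on \<open>\<Omega> - \<Sigma>\<close> is represented by a total function whose values
  elsewhere are never used. Boundedness of sets does not depend on the choice of norm.\<close>

definition filippov_system ::
    "'a::euclidean_space set \<Rightarrow> 'a set \<Rightarrow> ('a \<Rightarrow> 'a) \<Rightarrow> bool" where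
  "filippov_system \<Omega> \<Sigma> f \<longleftrightarrow>
     open \<Omega> \<and> connected \<Omega> \<and> \<Sigma> \<subseteq> \<Omega> \<and> \<Sigma> \<in> null_sets lebesgue \<and>
     f \<in> borel_measurable (lebesgue_on (\<Omega> - \<Sigma>)) \<and>
     (\<forall>U. U \<subseteq> \<Omega> - \<Sigma> \<and> bounded U \<longrightarrow> bounded (f ` U))"

definition closed_convex_hull :: "'a::euclidean_space set \<Rightarrow> 'a set" where
  "closed_convex_hull U = (\<lambda>S. closed S \<and> convex S) hull U"

definition filippov_map ::
    "('a::euclidean_space \<Rightarrow> real) \<Rightarrow> 'a set \<Rightarrow> 'a set \<Rightarrow> ('a \<Rightarrow> 'a) \<Rightarrow> 'a \<Rightarrow> 'a set" where
  "filippov_map N \<Omega> \<Sigma> f x =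
     (\<Inter>\<delta>\<in>{0<..}. closed_convex_hull (f ` (norm_ball N x \<delta> \<inter> (\<Omega> - \<Sigma>))))"

definition abs_continuous_on :: "real \<Rightarrow> real \<Rightarrow> (real \<Rightarrow> 'a::metric_space) \<Rightarrow> bool" where
  "abs_continuous_on a b \<phi> \<longleftrightarrow>
     (\<forall>\<epsilon>>0. \<exists>\<delta>>0. \<forall>(m::nat) (u::nat \<Rightarrow> real) v.
        (\<forall>j<m. a \<le> u j \<and> u j \<le> v j \<and> v j \<le> b) \<longrightarrow>
        disjoint_family_on (\<lambda>j. {u j<..<v j}) {..<m} \<longrightarrow>
        (\<Sum>j<m. v j - u j) < \<delta> \<longrightarrow>
        (\<Sum>j<m. dist (\<phi> (u j)) (\<phi> (v j))) < \<epsilon>)"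

definition filippov_solution_compact ::
    "('a::euclidean_space \<Rightarrow> real) \<Rightarrow> 'a set \<Rightarrow> 'a set \<Rightarrow> ('a \<Rightarrow> 'a) \<Rightarrow>
     real \<Rightarrow> real \<Rightarrow> (real \<Rightarrow> 'a) \<Rightarrow> bool" where
  "filippov_solution_compact N \<Omega> \<Sigma> f a b \<phi> \<longleftrightarrow>
     \<phi> ` {a..b} \<subseteq> \<Omega> \<and> abs_continuous_on a b \<phi> \<and>
     (AE t in lebesgue_on {a..b}.
        \<exists>w. (\<phi> has_vector_derivative w) (at t within {a..b}) \<and> w \<in> filippov_map N \<Omega> \<Sigma> f (\<phi> t))"

definition filippov_solution ::
    "('a::euclidean_space \<Rightarrow> real) \<Rightarrow> 'a set \<Rightarrow> 'a set \<Rightarrow> ('a \<Rightarrow> 'a) \<Rightarrow>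
     real set \<Rightarrow> (real \<Rightarrow> 'a) \<Rightarrow> bool" where
  "filippov_solution N \<Omega> \<Sigma> f I \<phi> \<longleftrightarrow>
     is_interval I \<and>
     (\<forall>a b. a \<le> b \<and> {a..b} \<subseteq> I \<longrightarrow> filippov_solution_compact N \<Omega> \<Sigma> f a b \<phi>)"

definition filippov_equilibrium ::
    "('a::euclidean_space \<Rightarrow> real) \<Rightarrow> 'a set \<Rightarrow> 'a set \<Rightarrow> ('a \<Rightarrow> 'a) \<Rightarrow> 'a \<Rightarrow> bool" where
  "filippov_equilibrium N \<Omega> \<Sigma> f x \<longleftrightarrow> x \<in> \<Omega> \<and> filippov_solution N \<Omega> \<Sigma> f UNIV (\<lambda>t. x)"

definition forward_solution ::
    "('a::euclidean_space \<Rightarrow> real) \<Rightarrow> 'a set \<Rightarrow> 'a set \<Rightarrow> ('a \<Rightarrow> 'a) \<Rightarrow>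
     real set \<Rightarrow> (real \<Rightarrow> 'a) \<Rightarrow> bool" where
  "forward_solution N \<Omega> \<Sigma> f I \<phi> \<longleftrightarrow>
     0 \<in> I \<and> I \<subseteq> {0..} \<and> filippov_solution N \<Omega> \<Sigma> f I \<phi>"

text \<open>The domain \<open>I\<close> may be \<open>[0,T]\<close>, \<open>[0,T)\<close> or \<open>[0,\<infinity>)\<close>. Solutions through a given point
  need not be unique, so maximality is relative to extensions of the given solution.\<close>

definition maximal_forward_solution ::
    "('a::euclidean_space \<Rightarrow> real) \<Rightarrow> 'a set \<Rightarrow> 'a set \<Rightarrow> ('a \<Rightarrow> 'a) \<Rightarrow>
     real set \<Rightarrow> (real \<Rightarrow> 'a) \<Rightarrow> bool" where
  "maximal_forward_solution N \<Omega> \<Sigma> f I \<phi> \<longleftrightarrow>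
     forward_solution N \<Omega> \<Sigma> f I \<phi> \<and>
     (\<forall>J \<psi>. forward_solution N \<Omega> \<Sigma> f J \<psi> \<and> I \<subseteq> J \<and> (\<forall>t\<in>I. \<psi> t = \<phi> t) \<longrightarrow> J = I)"

definition exp_stable_equilibrium ::
    "('a::euclidean_space \<Rightarrow> real) \<Rightarrow> 'a set \<Rightarrow> 'a set \<Rightarrow> ('a \<Rightarrow> 'a) \<Rightarrow> 'a \<Rightarrow> bool" where
  "exp_stable_equilibrium N \<Omega> \<Sigma> f x \<longleftrightarrow>
     filippov_equilibrium N \<Omega> \<Sigma> f x \<and>
     (\<exists>\<alpha>\<ge>1. \<exists>\<beta>>0. \<exists>\<delta>>0. \<forall>I \<phi>.
        maximal_forward_solution N \<Omega> \<Sigma> f I \<phi> \<and> \<phi> 0 \<in> norm_ball N x \<delta> \<longrightarrow>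
        I = {0..} \<and> (\<forall>t\<ge>0. N (\<phi> t - x) \<le> \<alpha> * exp (- \<beta> * t) * N (\<phi> 0 - x)))"

text \<open>The switching set is the hyperplane on which the \<open>k\<close>-th component vanishes. The value
  given there is immaterial, because Filippov's construction discards the switching set.\<close>

definition two_piece ::
    "'n::finite \<Rightarrow> (real^'n \<Rightarrow> real^'n) \<Rightarrow> (real^'n \<Rightarrow> real^'n) \<Rightarrow> real^'n \<Rightarrow> real^'n" where
  "two_piece k gL gR x = (if x $ k < 0 then gL x else gR x)"

end

theory Submission
  imports Defs "HOL-Complex_Analysis.Great_Picard"
begin

text \<open>Close to the origin both systems obey the same law up to small errors: every Filippov velocity is
\<open>A x + l c + e\<close>, where the weight \<open>l \<in> [0,1]\<close> vanishes for \<open>x\<^sub>k < 0\<close>, equals \<open>1\<close> for \<open>x\<^sub>k > 0\<close>, and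
\<open>norm e \<le> (\<epsilon> + C l) norm x\<close> (\<open>crossing_velocity\<close>). The idea is to show that this law alone fixes the
solutions up to an error of smaller order than the initial value, over any bounded time.

The term \<open>l c\<close> is large and discontinuous, but it is harmless for two reasons. As a function of
\<open>x\<close>, the weight is monotone in \<open>x\<^sub>k\<close>, and \<open>c\<^sub>k < 0\<close>; so in a quadratic form for which the
pairing of \<open>x\<close> with \<open>c\<close> is \<open>c\<^sub>k x\<^sub>k\<close> it can only decrease the difference of two solutions. And it is
rarely active: since \<open>l\<close> pushes \<open>x\<^sub>k\<close> down at a rate of about \<open>- c\<^sub>k\<close>, the time integral of \<open>l\<close> is
bounded by a multiple of the initial value \<open>norm x\<^sub>0\<close>, and the integral of \<open>C l norm x\<close> is of second
order. A Gronwall estimate then gives, for solutions of the two systems from a common initial value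
\<open>x\<^sub>0\<close>, a distance of at most \<open>\<eta> norm x\<^sub>0\<close> on \<open>[0,T]\<close> as soon as \<open>x\<^sub>0\<close> is small (\<open>solutions_compare\<close>).

Suppose that one system is exponentially stable, and choose \<open>T\<close> so that its solutions have
shrunk to a quarter at time \<open>T\<close>. Taking \<open>\<eta> = 1/4\<close>, the solutions of the other system have shrunk to
a half, and iterating over intervals of length \<open>T\<close> gives exponential decay for as long as they
exist (\<open>halving_imp_exponential_decay\<close>). The comparison solution of the stable system comes from
Zorn's lemma: a maximal solution exists through every point, and stability says that it is global.

It remains to see that a maximal solution of the other system cannot end while it is small.
It is Lipschitz, so it extends to the right end of its interval, and from there it can be continued
by a local existence theorem (\<open>local_existence\<close>), obtained from Euler polygons. The limit of the
polygons has difference quotients in the convex hulls of nearby velocities. This determines its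
derivative where \<open>x\<^sub>k \<noteq> 0\<close>. Almost everywhere on \<open>x\<^sub>k = 0\<close> the derivative of \<open>x\<^sub>k\<close> is zero, by Lebesgue
density, and only one convex combination of the two one-sided velocities has this property: the
sliding velocity.

The argument is symmetric in the two systems, which gives both implications of the theorem.\<close>

section \<open>Absolutely continuous functions\<close>

lemma abs_continuous_onE:
  assumes "abs_continuous_on a b \<phi>" "\<epsilon> > 0"
  obtains \<delta> where "\<delta> > 0"
    "\<And>(m::nat) p q. (\<And>j. j < m \<Longrightarrow> a \<le> p j \<and> p j \<le> q j \<and> q j \<le> b) \<Longrightarrow>
        disjoint_family_on (\<lambda>j. {p j<..<q j}) {..<m} \<Longrightarrow> (\<Sum>j<m. q j - p j) < \<delta> \<Longrightarrow>
        (\<Sum>j<m. dist (\<phi> (p j)) (\<phi> (q j))) < \<epsilon>"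
proof -
  obtain \<delta> where \<delta>: "\<delta> > 0" and *: "\<forall>(m::nat) p q. (\<forall>j<m. a \<le> p j \<and> p j \<le> q j \<and> q j \<le> b) \<longrightarrow>
        disjoint_family_on (\<lambda>j. {p j<..<q j}) {..<m} \<longrightarrow> (\<Sum>j<m. q j - p j) < \<delta> \<longrightarrow>
        (\<Sum>j<m. dist (\<phi> (p j)) (\<phi> (q j))) < \<epsilon>"
    using assms(1)[unfolded abs_continuous_on_def, rule_format, OF assms(2)] by (elim exE conjE) (rule that)
  show ?thesis
    by (rule that[OF \<delta>]) (use * in simp)
qed

text \<open>Cousin's lemma for a gauge adapted to the two kinds of points. Over a small interval
tagged outside \<open>E\<close> the derivative controls the increment; the intervals tagged in \<open>E\<close> lie in an open
set of small measure, so absolute continuity makes their total increment small.\<close>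

lemma AC_nonincreasing:
  fixes u :: "real \<Rightarrow> real"
  assumes "a \<le> b" and AC: "abs_continuous_on a b u" and E: "negligible E"
    and der: "\<And>t. t \<in> {a..b} - E \<Longrightarrow> \<exists>D\<le>0. (u has_real_derivative D) (at t within {a..b})"
  shows "u b \<le> u a"
proof (rule field_le_epsilon)
  fix e0 :: real assume "e0 > 0"
  define e where "e = e0 / (1 + (b - a))"
  have e: "e > 0" using \<open>e0 > 0\<close> \<open>a \<le> b\<close> by (simp add: e_def add_pos_nonneg)
  obtain \<delta> where \<delta>: "\<delta> > 0"
    and AC\<delta>: "\<And>(m::nat) p q. (\<And>j. j < m \<Longrightarrow> a \<le> p j \<and> p j \<le> q j \<and> q j \<le> b) \<Longrightarrow>
        disjoint_family_on (\<lambda>j. {p j<..<q j}) {..<m} \<Longrightarrow> (\<Sum>j<m. q j - p j) < \<delta> \<Longrightarrow>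
        (\<Sum>j<m. dist (u (p j)) (u (q j))) < e"
    by (fact abs_continuous_onE[OF AC e])
  obtain U where U: "open U" "E \<subseteq> U" "U \<in> lmeasurable" "measure lebesgue U < \<delta>"
  proof -
    have "E \<in> sets lebesgue" using E by (simp add: negligible_imp_sets)
    then obtain T where T: "open T" "E \<subseteq> T" "T - E \<in> lmeasurable" "emeasure lebesgue (T - E) < ennreal \<delta>"
      using sets_lebesgue_outer_open[OF _ \<delta>] by blast
    have eq: "T = (T - E) \<union> E" using T by auto
    have "T \<in> lmeasurable" using T(3) E eq by (metis fmeasurable.Un negligible_imp_measurable)
    moreover have "measure lebesgue T = measure lebesgue (T - E)"
      by (metis E T(3) fmeasurableD measure_Un_null_set negligible_iff_null_sets eq)
    moreover have "measure lebesgue (T - E) < \<delta>"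
      using T(3,4) \<delta> by (metis emeasure_eq_measure2 ennreal_less_iff measure_nonneg)
    ultimately show ?thesis using that T by metis
  qed
  \<comment> \<open>The straddle lemma: the tag \<open>t\<close> lies between the end points \<open>y\<close> and \<open>z\<close>.\<close>
  have "\<exists>d>0. \<forall>y\<in>{a..b}. \<forall>z\<in>{a..b}. dist t y < d \<and> dist t z < d \<and> y \<le> t \<and> t \<le> z
           \<longrightarrow> u z - u y \<le> e * (z - y)" if t: "t \<in> {a..b} - E" for t
  proof -
    obtain D where D: "D \<le> 0" "(u has_real_derivative D) (at t within {a..b})" using der[OF t] by auto
    then have "(u has_derivative (\<lambda>h. D * h)) (at t within {a..b})"
      by (simp add: has_field_derivative_def)
    then obtain d where d: "d > 0"
      and dd: "\<And>y. y \<in> {a..b} \<Longrightarrow> norm (y - t) < d \<Longrightarrow> norm (u y - u t - D * (y - t)) \<le> e * norm (y - t)"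
      unfolding has_derivative_within_alt using e by blast
    show ?thesis
    proof (intro exI conjI ballI impI)
      fix y z assume yz: "y \<in> {a..b}" "z \<in> {a..b}" "dist t y < d \<and> dist t z < d \<and> y \<le> t \<and> t \<le> z"
      have "\<bar>u y - u t - D * (y - t)\<bar> \<le> e * (t - y)" "\<bar>u z - u t - D * (z - t)\<bar> \<le> e * (z - t)"
        using dd[of y] dd[of z] yz by (auto simp: dist_real_def)
      moreover have "D * (z - y) \<le> 0" using D yz by (simp add: mult_nonpos_nonneg)
      ultimately show "u z - u y \<le> e * (z - y)" by (auto simp: algebra_simps abs_le_iff)
    qed (use d in auto)
  qed
  then obtain d where d: "\<And>t. t \<in> {a..b} - E \<Longrightarrow> d t > 0"
    and dd: "\<And>t y z. \<lbrakk>t \<in> {a..b} - E; y \<in> {a..b}; z \<in> {a..b}; dist t y < d t; dist t z < d t; y \<le> t; t \<le> z\<rbrakk>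
            \<Longrightarrow> u z - u y \<le> e * (z - y)"
    by metis
  define g where "g t = (if t \<in> {a..b} - E then ball t (d t) else if t \<in> E then U else UNIV)" for t
  have "gauge g" unfolding gauge_def g_def using d U by auto
  then obtain p where p: "p tagged_division_of {a..b}" "g fine p"
    using fine_division_exists_real by blast
  have fin: "finite p" using p by blast
  define pE where "pE = {xK \<in> p. fst xK \<in> E}"
  have K: "\<exists>l r. K = {l..r} \<and> a \<le> l \<and> l \<le> x \<and> x \<le> r \<and> r \<le> b \<and> Inf K = l \<and> Sup K = r" if "(x, K) \<in> p" for x K
  proof -
    have "x \<in> K" "K \<subseteq> {a..b}" "\<exists>l r. K = cbox l r"
      using tagged_division_ofD(2-4)[OF p(1) that] by auto
    then obtain l r where K: "K = {l..r}" by auto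
    then have "l \<le> x" "x \<le> r" using \<open>x \<in> K\<close> by auto
    moreover from this have "l \<in> K" "r \<in> K" using K by auto
    ultimately show ?thesis using K \<open>K \<subseteq> {a..b}\<close> by (intro exI[of _ l] exI[of _ r]) auto
  qed
  have good: "(\<Sum>(x,K)\<in>p - pE. u (Sup K) - u (Inf K)) \<le> (\<Sum>(x,K)\<in>p - pE. e * (Sup K - Inf K))"
  proof (rule sum_mono, clarify)
    fix x K assume xK: "(x, K) \<in> p" "(x, K) \<notin> pE"
    obtain l r where lr: "K = {l..r}" "a \<le> l" "l \<le> x" "x \<le> r" "r \<le> b" "Inf K = l" "Sup K = r"
      using K[OF xK(1)] by blast
    have x: "x \<in> {a..b} - E" using xK lr by (auto simp: pE_def)
    have "K \<subseteq> ball x (d x)" using p(2) xK(1) x unfolding fine_def g_def by fastforce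
    moreover have "l \<in> K" "r \<in> K" using lr by auto
    ultimately have "dist x l < d x" "dist x r < d x" by auto
    then show "u (Sup K) - u (Inf K) \<le> e * (Sup K - Inf K)"
      using dd[OF x, of l r] lr by auto
  qed
  have "(\<Sum>(x,K)\<in>p - pE. e * (Sup K - Inf K)) \<le> (\<Sum>(x,K)\<in>p. e * (Sup K - Inf K))"
  proof (rule sum_mono2[OF fin], simp)
    fix xK assume "xK \<in> p - (p - pE)"
    then show "0 \<le> (case xK of (x, K) \<Rightarrow> e * (Sup K - Inf K))"
      using K[of "fst xK" "snd xK"] e by (auto simp: split_beta)
  qed
  also have "\<dots> = e * (b - a)"
    using additive_tagged_division_1[OF \<open>a \<le> b\<close> p(1), of "\<lambda>x. e * x"]
    by (simp add: right_diff_distrib)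
  finally have good2: "(\<Sum>(x,K)\<in>p - pE. u (Sup K) - u (Inf K)) \<le> e * (b - a)" using good by linarith
  have bad: "(\<Sum>(x,K)\<in>pE. u (Sup K) - u (Inf K)) \<le> e"
  proof -
    have finE: "finite pE" using fin by (simp add: pE_def)
    obtain h where h: "bij_betw h {0..<card pE} pE" using ex_bij_betw_nat_finite[OF finE] by blast
    let ?m = "card pE"
    have h': "bij_betw h {..<?m} pE" using h by (simp add: lessThan_atLeast0)
    define P where "P j = Inf (snd (h j))" for j
    define Q where "Q j = Sup (snd (h j))" for j
    have hin: "(fst (h j), snd (h j)) \<in> p" "fst (h j) \<in> E" if "j < ?m" for j
      using bij_betwE[OF h'] that by (auto simp: pE_def)
    have PQ: "snd (h j) = {P j..Q j}" "a \<le> P j" "P j \<le> Q j" "Q j \<le> b" if "j < ?m" for j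
      using K[OF hin(1)[OF that]] by (auto simp: P_def Q_def)
    have disj: "disjoint_family_on (\<lambda>j. {P j<..<Q j}) {..<?m}"
      unfolding disjoint_family_on_def
    proof (intro ballI impI)
      fix i j assume ij: "i \<in> {..<?m}" "j \<in> {..<?m}" "i \<noteq> j"
      then have "h i \<noteq> h j" using h' by (metis bij_betw_def inj_onD)
      then have "interior (snd (h i)) \<inter> interior (snd (h j)) = {}"
        using tagged_division_ofD(5)[OF p(1) hin(1) hin(1), of i j] ij by (metis lessThan_iff prod.collapse)
      then show "{P i<..<Q i} \<inter> {P j<..<Q j} = {}"
        using PQ(1) ij by simp
    qed
    have sub: "{P j<..<Q j} \<subseteq> U" if "j < ?m" for j
    proof -
      have "snd (h j) \<subseteq> g (fst (h j))" using p(2) hin(1)[OF that] unfolding fine_def by (metis (mono_tags, lifting) case_prodD)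
      also have "\<dots> \<subseteq> U" using hin[OF that] by (auto simp: g_def)
      finally show ?thesis using PQ(1)[OF that] by auto
    qed
    have "(\<Sum>j<?m. Q j - P j) = (\<Sum>j<?m. measure lebesgue {P j<..<Q j})"
      using PQ by (intro sum.cong) auto
    also have "\<dots> = measure lebesgue (\<Union>j<?m. {P j<..<Q j})"
      proof (rule measure_finite_Union[symmetric])
      show "emeasure lebesgue {P j<..<Q j} \<noteq> \<infinity>" for j
        using fmeasurableD2[OF lmeasurable_box[of "P j" "Q j"]] by simp
    qed (auto simp: disj)
    also have "\<dots> \<le> measure lebesgue U"
      by (rule measure_mono_fmeasurable) (use sub U in auto)
    also have "\<dots> < \<delta>" by (rule U)
    finally have "(\<Sum>j<?m. dist (u (P j)) (u (Q j))) < e"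
      by (intro AC\<delta> disj) (use PQ in auto)
    moreover have "(\<Sum>(x,K)\<in>pE. u (Sup K) - u (Inf K)) = (\<Sum>j<?m. u (Q j) - u (P j))"
      unfolding sum.reindex_bij_betw[OF h', symmetric] by (simp add: P_def Q_def split_beta)
    moreover have "(\<Sum>j<?m. u (Q j) - u (P j)) \<le> (\<Sum>j<?m. dist (u (P j)) (u (Q j)))"
      by (intro sum_mono) (auto simp: dist_real_def)
    ultimately show ?thesis by linarith
  qed
  have "u b - u a = (\<Sum>(x,K)\<in>p. u (Sup K) - u (Inf K))"
    by (rule additive_tagged_division_1[OF \<open>a \<le> b\<close> p(1), symmetric])
  also have "\<dots> = (\<Sum>(x,K)\<in>p - pE. u (Sup K) - u (Inf K)) + (\<Sum>(x,K)\<in>pE. u (Sup K) - u (Inf K))"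
    by (rule sum.subset_diff[OF _ fin]) (auto simp: pE_def)
  also have "\<dots> \<le> e * (1 + (b - a))" using good2 bad by (simp add: algebra_simps)
  also have "\<dots> = e0" using \<open>a \<le> b\<close> by (simp add: e_def)
  finally show "u b \<le> u a + e0" by simp
qed

text \<open>Sums, products and smooth functions of absolutely continuous functions on a compact interval all have
increments dominated in this way.\<close>

lemma AC_dominated:
  fixes \<phi> :: "real \<Rightarrow> 'a::metric_space" and \<psi> :: "real \<Rightarrow> 'b::metric_space" and u :: "real \<Rightarrow> 'c::metric_space"
  assumes \<phi>: "abs_continuous_on a b \<phi>" and \<psi>: "abs_continuous_on a b \<psi>" and L: "L \<ge> 0"
    and dom: "\<And>s t. \<lbrakk>a \<le> s; s \<le> t; t \<le> b\<rbrakk> \<Longrightarrow>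
         dist (u s) (u t) \<le> L * (dist (\<phi> s) (\<phi> t) + dist (\<psi> s) (\<psi> t) + (t - s))"
  shows "abs_continuous_on a b u"
  unfolding abs_continuous_on_def
proof (intro allI impI)
  fix \<epsilon> :: real assume "\<epsilon> > 0"
  define e where "e = \<epsilon> / (3 * (L + 1))"
  have e: "e > 0" using \<open>\<epsilon> > 0\<close> L by (simp add: e_def)
  obtain d1 where d1: "d1 > 0" and 1: "\<And>(m::nat) p q. (\<And>j. j < m \<Longrightarrow> a \<le> p j \<and> p j \<le> q j \<and> q j \<le> b) \<Longrightarrow>
        disjoint_family_on (\<lambda>j. {p j<..<q j}) {..<m} \<Longrightarrow> (\<Sum>j<m. q j - p j) < d1 \<Longrightarrow>
        (\<Sum>j<m. dist (\<phi> (p j)) (\<phi> (q j))) < e"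
    by (fact abs_continuous_onE[OF \<phi> e])
  obtain d2 where d2: "d2 > 0" and 2: "\<And>(m::nat) p q. (\<And>j. j < m \<Longrightarrow> a \<le> p j \<and> p j \<le> q j \<and> q j \<le> b) \<Longrightarrow>
        disjoint_family_on (\<lambda>j. {p j<..<q j}) {..<m} \<Longrightarrow> (\<Sum>j<m. q j - p j) < d2 \<Longrightarrow>
        (\<Sum>j<m. dist (\<psi> (p j)) (\<psi> (q j))) < e"
    by (fact abs_continuous_onE[OF \<psi> e])
  show "\<exists>\<delta>>0. \<forall>(m::nat) p q. (\<forall>j<m. a \<le> p j \<and> p j \<le> q j \<and> q j \<le> b) \<longrightarrow>
        disjoint_family_on (\<lambda>j. {p j<..<q j}) {..<m} \<longrightarrow> (\<Sum>j<m. q j - p j) < \<delta> \<longrightarrow>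
        (\<Sum>j<m. dist (u (p j)) (u (q j))) < \<epsilon>"
  proof (intro exI[of _ "min e (min d1 d2)"] conjI allI impI)
    fix m :: nat and p q assume pq: "\<forall>j<m. a \<le> p j \<and> p j \<le> q j \<and> q j \<le> b"
      "disjoint_family_on (\<lambda>j. {p j<..<q j}) {..<m}" "(\<Sum>j<m. q j - p j) < min e (min d1 d2)"
    have "(\<Sum>j<m. dist (u (p j)) (u (q j)))
        \<le> (\<Sum>j<m. L * (dist (\<phi> (p j)) (\<phi> (q j)) + dist (\<psi> (p j)) (\<psi> (q j)) + (q j - p j)))"
      using pq(1) by (intro sum_mono dom) auto
    also have "\<dots> = L * ((\<Sum>j<m. dist (\<phi> (p j)) (\<phi> (q j))) + (\<Sum>j<m. dist (\<psi> (p j)) (\<psi> (q j))) + (\<Sum>j<m. q j - p j))"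
      by (simp only: sum_distrib_left[symmetric] sum.distrib)
    also have "\<dots> \<le> L * (e + e + e)"
      using 1[of m p q] 2[of m p q] pq by (intro mult_left_mono L) auto
    also have "\<dots> < (L + 1) * (3 * e)" using e by (simp add: algebra_simps)
    also have "\<dots> = \<epsilon>" using L by (simp add: e_def field_simps)
    finally show "(\<Sum>j<m. dist (u (p j)) (u (q j))) < \<epsilon>" .
  qed (use e d1 d2 in auto)
qed

lemma AC_imp_continuous_on:
  assumes "abs_continuous_on a b \<phi>"
  shows "continuous_on {a..b} \<phi>"
proof -
  have "\<exists>d>0. \<forall>x\<in>{a..b}. \<forall>y\<in>{a..b}. dist y x < d \<longrightarrow> dist (\<phi> y) (\<phi> x) < e" if e: "e > 0" for e
  proof -
    obtain d where d: "d > 0" and 1: "\<And>(m::nat) p q. (\<And>j. j < m \<Longrightarrow> a \<le> p j \<and> p j \<le> q j \<and> q j \<le> b) \<Longrightarrow>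
        disjoint_family_on (\<lambda>j. {p j<..<q j}) {..<m} \<Longrightarrow> (\<Sum>j<m. q j - p j) < d \<Longrightarrow>
        (\<Sum>j<m. dist (\<phi> (p j)) (\<phi> (q j))) < e"
      by (fact abs_continuous_onE[OF assms e])
    show ?thesis
    proof (intro exI conjI ballI impI)
      fix x y assume "x \<in> {a..b}" "y \<in> {a..b}" "dist y x < d"
      then show "dist (\<phi> y) (\<phi> x) < e"
        using 1[of 1 "\<lambda>_. min x y" "\<lambda>_. max x y"]
        by (cases "x \<le> y") (auto simp: disjoint_family_on_def dist_real_def dist_commute min_def max_def)
    qed (use d in auto)
  qed
  then show ?thesis
    by (intro uniformly_continuous_imp_continuous) (auto simp: uniformly_continuous_on_def)
qed

text \<open>Monotone reparametrisations that do not stretch time: restrictions, translations, and stopping the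
clock at the point where two solutions are joined.\<close>

lemma AC_compose:
  assumes AC: "abs_continuous_on a b \<phi>"
    and g: "\<And>s t. \<lbrakk>c \<le> s; s \<le> t; t \<le> d\<rbrakk> \<Longrightarrow> a \<le> g s \<and> g s \<le> g t \<and> g t \<le> b \<and> g t - g s \<le> t - s"
  shows "abs_continuous_on c d (\<lambda>t. \<phi> (g t))"
  unfolding abs_continuous_on_def
proof (intro allI impI)
  fix \<epsilon> :: real assume "\<epsilon> > 0"
  obtain e where e: "e > 0" and small: "\<And>(m::nat) p q. (\<And>j. j < m \<Longrightarrow> a \<le> p j \<and> p j \<le> q j \<and> q j \<le> b) \<Longrightarrow>
        disjoint_family_on (\<lambda>j. {p j<..<q j}) {..<m} \<Longrightarrow> (\<Sum>j<m. q j - p j) < e \<Longrightarrow>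
        (\<Sum>j<m. dist (\<phi> (p j)) (\<phi> (q j))) < \<epsilon>"
    by (fact abs_continuous_onE[OF AC \<open>\<epsilon> > 0\<close>])
  show "\<exists>\<delta>>0. \<forall>(m::nat) p q. (\<forall>j<m. c \<le> p j \<and> p j \<le> q j \<and> q j \<le> d) \<longrightarrow>
        disjoint_family_on (\<lambda>j. {p j<..<q j}) {..<m} \<longrightarrow> (\<Sum>j<m. q j - p j) < \<delta> \<longrightarrow>
        (\<Sum>j<m. dist (\<phi> (g (p j))) (\<phi> (g (q j)))) < \<epsilon>"
  proof (intro exI[of _ e] conjI allI impI e small)
    fix m :: nat and p q assume pq: "\<forall>j<m. c \<le> p j \<and> p j \<le> q j \<and> q j \<le> d"
      "disjoint_family_on (\<lambda>j. {p j<..<q j}) {..<m}" "(\<Sum>j<m. q j - p j) < e"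
    show "a \<le> g (p j)" "g (p j) \<le> g (q j)" "g (q j) \<le> b" if "j < m" for j
      using g[of "p j" "q j"] pq(1) that by auto
    have "(\<Sum>j<m. g (q j) - g (p j)) \<le> (\<Sum>j<m. q j - p j)"
      by (intro sum_mono) (use g pq(1) in auto)
    then show "(\<Sum>j<m. g (q j) - g (p j)) < e" using pq(3) by linarith
    show "disjoint_family_on (\<lambda>j. {g (p j)<..<g (q j)}) {..<m}"
      unfolding disjoint_family_on_def
    proof (intro ballI impI equals0I)
      fix i j y assume ij: "i \<in> {..<m}" "j \<in> {..<m}" "i \<noteq> j"
        and y: "y \<in> {g (p i)<..<g (q i)} \<inter> {g (p j)<..<g (q j)}"
      have ends: "c \<le> p i" "p i \<le> q i" "q i \<le> d" "c \<le> p j" "p j \<le> q j" "q j \<le> d" using pq(1) ij by auto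
      have "p i \<noteq> q i" "p j \<noteq> q j" using y by auto
      have "q i \<le> p j \<or> q j \<le> p i"
      proof (rule ccontr)
        assume "\<not> ?thesis"
        then have "(max (p i) (p j) + min (q i) (q j)) / 2 \<in> {p i<..<q i} \<inter> {p j<..<q j}"
          using ends \<open>p i \<noteq> q i\<close> \<open>p j \<noteq> q j\<close> by (auto simp: max_def min_def)
        then show False using pq(2) ij unfolding disjoint_family_on_def by blast
      qed
      then show False using g[of "q i" "p j"] g[of "q j" "p i"] ends y by auto
    qed
  qed
qed

lemma AC_subinterval:
  assumes "abs_continuous_on a b \<phi>" "a \<le> a'" "b' \<le> b"
  shows "abs_continuous_on a' b' \<phi>"
  by (rule AC_compose[OF assms(1), of a' b' "\<lambda>t. t"]) (use assms(2,3) in auto)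

lemma AC_concat:
  assumes \<phi>: "abs_continuous_on a b \<phi>" and \<psi>: "abs_continuous_on b c \<psi>" and "\<phi> b = \<psi> b" "a \<le> b" "b \<le> c"
  shows "abs_continuous_on a c (\<lambda>t. if t \<le> b then \<phi> t else \<psi> t)"
proof -
  have ext1: "abs_continuous_on a c (\<lambda>t. \<phi> (min t b))"
    by (rule AC_compose[OF \<phi>]) (use \<open>a \<le> b\<close> in auto)
  have ext2: "abs_continuous_on a c (\<lambda>t. \<psi> (max t b))"
    by (rule AC_compose[OF \<psi>]) (use \<open>b \<le> c\<close> in auto)
  show ?thesis
  proof (rule AC_dominated[OF ext1 ext2, of 1])
    fix s t assume "a \<le> s" "s \<le> t" "t \<le> c"
    consider "t \<le> b" | "b < s" | "s \<le> b" "b < t" by linarith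
    then show "dist (if s \<le> b then \<phi> s else \<psi> s) (if t \<le> b then \<phi> t else \<psi> t)
      \<le> 1 * (dist (\<phi> (min s b)) (\<phi> (min t b)) + dist (\<psi> (max s b)) (\<psi> (max t b)) + (t - s))"
    proof cases
      case 3
      then show ?thesis using dist_triangle[of "\<phi> s" "\<psi> t" "\<phi> b"] \<open>\<phi> b = \<psi> b\<close> by (auto simp: min_def max_def)
    qed (use \<open>s \<le> t\<close> in \<open>auto simp: min_def max_def\<close>)
  qed simp
qed

lemma lipschitz_imp_AC:
  assumes "L-lipschitz_on {a..b} \<phi>"
  shows "abs_continuous_on a b \<phi>"
proof -
  have "abs_continuous_on a b (\<lambda>_. 0::real)"
    unfolding abs_continuous_on_def by (auto intro: exI[of _ 1])
  from this this show ?thesis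
  proof (rule AC_dominated[OF _ _ lipschitz_on_nonneg[OF assms]])
    fix s t assume "a \<le> s" "s \<le> t" "t \<le> b"
    then show "dist (\<phi> s) (\<phi> t) \<le> L * (dist (0::real) 0 + dist (0::real) 0 + (t - s))"
      using lipschitz_onD[OF assms, of s t] by (simp add: dist_real_def)
  qed
qed

lemma AC_const: "abs_continuous_on a b (\<lambda>_. x)"
  unfolding abs_continuous_on_def by (auto intro: exI[of _ 1])

text \<open>Gronwall's inequality, by monotonicity of \<open>exp (- K (t - a)) u(t) - q (t - a)\<close>.\<close>

lemma AC_gronwall:
  fixes u :: "real \<Rightarrow> real"
  assumes "a \<le> b" and AC: "abs_continuous_on a b u" and E: "negligible E" and "K \<ge> 0" "q \<ge> 0"
    and der: "\<And>t. t \<in> {a..b} - E \<Longrightarrow> \<exists>D\<le>K * u t + q. (u has_real_derivative D) (at t within {a..b})"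
  shows "u b \<le> exp (K * (b - a)) * (u a + q * (b - a))"
proof -
  define z where "z t = exp (- K * (t - a)) * u t - q * (t - a)" for t
  obtain B where B: "\<And>t. t \<in> {a..b} \<Longrightarrow> \<bar>u t\<bar> \<le> B" "B \<ge> 0"
  proof -
    have "bounded (u ` {a..b})"
      using AC_imp_continuous_on[OF AC] compact_continuous_image compact_imp_bounded by blast
    then obtain B where "\<And>t. t \<in> {a..b} \<Longrightarrow> \<bar>u t\<bar> \<le> B" unfolding bounded_iff by fastforce
    then show ?thesis using that[of "max B 0"] by fastforce
  qed
  have AC': "abs_continuous_on a b z"
  proof (rule AC_dominated[OF AC AC_const[of a b "0::real"], of "1 + B * K + q"])
    fix s t assume st: "a \<le> s" "s \<le> t" "t \<le> b"
    have e1: "\<bar>exp (- K * (s - a)) - exp (- K * (t - a))\<bar> \<le> K * (t - s)"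
    proof -
      have "exp (- K * (t - a)) = exp (- K * (s - a)) * exp (- K * (t - s))"
        by (simp add: exp_add[symmetric] algebra_simps)
      then have *: "exp (- K * (s - a)) - exp (- K * (t - a)) = exp (- K * (s - a)) * (1 - exp (- K * (t - s)))"
        by (simp add: algebra_simps)
      have "0 \<le> 1 - exp (- K * (t - s))" using st \<open>K \<ge> 0\<close> by simp
      moreover have "1 - exp (- K * (t - s)) \<le> K * (t - s)"
        using exp_ge_add_one_self[of "- K * (t - s)"] by simp
      moreover have "exp (- K * (s - a)) \<le> 1" "0 \<le> exp (- K * (s - a))" using st \<open>K \<ge> 0\<close> by auto
      ultimately show ?thesis unfolding *
        by (metis abs_mult abs_of_nonneg mult_left_le_one_le order_trans)
    qed
    have "z s - z t = exp (- K * (s - a)) * (u s - u t) + (exp (- K * (s - a)) - exp (- K * (t - a))) * u t + q * (t - s)"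
      by (simp add: z_def algebra_simps)
    then have "\<bar>z s - z t\<bar> \<le> \<bar>exp (- K * (s - a)) * (u s - u t)\<bar> + \<bar>(exp (- K * (s - a)) - exp (- K * (t - a))) * u t\<bar> + \<bar>q * (t - s)\<bar>"
      by linarith
    also have "\<dots> \<le> 1 * \<bar>u s - u t\<bar> + (K * (t - s)) * B + q * (t - s)"
      unfolding abs_mult using st \<open>K \<ge> 0\<close> \<open>q \<ge> 0\<close> e1 B by (intro add_mono mult_mono) auto
    also have "\<dots> \<le> (1 + B * K + q) * (\<bar>u s - u t\<bar> + (t - s))"
    proof -
      have "0 \<le> (B * K + q) * \<bar>u s - u t\<bar>" using B \<open>K \<ge> 0\<close> \<open>q \<ge> 0\<close> by simp
      then show ?thesis using st by (simp add: algebra_simps)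
    qed
    finally show "dist (z s) (z t) \<le> (1 + B * K + q) * (dist (u s) (u t) + dist 0 (0::real) + (t - s))"
      by (simp add: dist_real_def)
  qed (use B \<open>K \<ge> 0\<close> \<open>q \<ge> 0\<close> in auto)
  have "z b \<le> z a"
  proof (rule AC_nonincreasing[OF \<open>a \<le> b\<close> AC' E])
    fix t assume t: "t \<in> {a..b} - E"
    obtain D where D: "D \<le> K * u t + q" "(u has_real_derivative D) (at t within {a..b})" using der[OF t] by auto
    have "(z has_real_derivative (exp (- K * (t - a)) * (D - K * u t) - q)) (at t within {a..b})"
      unfolding z_def by (rule derivative_eq_intros D refl)+ (simp add: algebra_simps)
    moreover have "exp (- K * (t - a)) * (D - K * u t) \<le> 1 * q"
    proof -
      have "exp (- K * (t - a)) * (D - K * u t) \<le> exp (- K * (t - a)) * q"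
        using D(1) by (intro mult_left_mono) auto
      also have "\<dots> \<le> 1 * q" using t \<open>K \<ge> 0\<close> \<open>q \<ge> 0\<close> by (intro mult_right_mono) auto
      finally show ?thesis .
    qed
    ultimately show "\<exists>D\<le>0. (z has_real_derivative D) (at t within {a..b})"
      by (intro exI[of _ "exp (- K * (t - a)) * (D - K * u t) - q"]) auto
  qed
  then have "exp (- K * (b - a)) * u b \<le> u a + q * (b - a)" by (simp add: z_def)
  then have "exp (K * (b - a)) * (exp (- K * (b - a)) * u b) \<le> exp (K * (b - a)) * (u a + q * (b - a))"
    by (intro mult_left_mono) auto
  then show ?thesis by (simp add: mult.assoc[symmetric] exp_add[symmetric])
qed

text \<open>The scalar monotonicity result, applied to the component of \<open>\<phi>\<close> along its own total increment.\<close>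

lemma AC_velocity_bound:
  fixes \<phi> :: "real \<Rightarrow> 'a::real_inner"
  assumes ab: "a \<le> b" and AC: "abs_continuous_on a b \<phi>" and E: "negligible E"
    and der: "\<And>t. t \<in> {a..b} - E \<Longrightarrow> \<exists>w. (\<phi> has_vector_derivative w) (at t within {a..b}) \<and> norm w \<le> M"
  shows "norm (\<phi> b - \<phi> a) \<le> M * (b - a)"
proof (cases "\<phi> b = \<phi> a \<or> a = b")
  case True
  moreover have "0 \<le> M" if "a < b"
  proof -
    have "\<not> negligible {a..b}" using that by (simp add: negligible_interval(1)[of a b, simplified])
    then have "\<not> {a..b} \<subseteq> E" using E negligible_subset by blast
    then obtain t where "t \<in> {a..b} - E" by blast
    then show ?thesis using der norm_ge_zero order_trans by blast
  qed
  ultimately show ?thesis using ab by (cases "a < b") auto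
next
  case False
  define v where "v = \<phi> b - \<phi> a"
  let ?u = "\<lambda>t. inner (\<phi> t) v - norm v * M * t"
  have "?u b \<le> ?u a"
  proof (rule AC_nonincreasing[OF ab _ E])
    show "abs_continuous_on a b ?u"
    proof (rule AC_dominated[OF AC AC, of "norm v + \<bar>norm v * M\<bar>"])
      fix s t :: real assume st: "s \<le> t"
      have "?u s - ?u t = inner (\<phi> s - \<phi> t) v + norm v * M * (t - s)" by (simp add: inner_diff_left algebra_simps)
      then have "\<bar>?u s - ?u t\<bar> \<le> \<bar>inner (\<phi> s - \<phi> t) v\<bar> + \<bar>norm v * M\<bar> * (t - s)"
        using st by (metis abs_mult abs_of_nonneg abs_triangle_ineq diff_ge_0_iff_ge)
      also have "\<dots> \<le> norm v * dist (\<phi> s) (\<phi> t) + \<bar>norm v * M\<bar> * (t - s)"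
        using Cauchy_Schwarz_ineq2[of "\<phi> s - \<phi> t" v] by (simp add: dist_norm mult.commute)
      also have "\<dots> \<le> (norm v + \<bar>norm v * M\<bar>) * (dist (\<phi> s) (\<phi> t) + (t - s))"
      proof -
        have "0 \<le> norm v * (t - s)" "0 \<le> \<bar>norm v * M\<bar> * dist (\<phi> s) (\<phi> t)" using st by auto
        then show ?thesis by (simp only: distrib_left distrib_right)
      qed
      also have "\<dots> \<le> (norm v + \<bar>norm v * M\<bar>) * (dist (\<phi> s) (\<phi> t) + dist (\<phi> s) (\<phi> t) + (t - s))"
        by (intro mult_left_mono) auto
      finally show "dist (?u s) (?u t) \<le> (norm v + \<bar>norm v * M\<bar>) * (dist (\<phi> s) (\<phi> t) + dist (\<phi> s) (\<phi> t) + (t - s))"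
        by (simp add: dist_real_def)
    qed simp
    fix t assume "t \<in> {a..b} - E"
    then obtain w where w: "(\<phi> has_vector_derivative w) (at t within {a..b})" "norm w \<le> M" using der by blast
    have "((\<lambda>t. inner (\<phi> t) v) has_real_derivative inner w v) (at t within {a..b})"
      using bounded_linear.has_vector_derivative[OF bounded_linear_inner_left w(1)]
      by (simp add: has_real_derivative_iff_has_vector_derivative)
    then have "(?u has_real_derivative (inner w v - norm v * M)) (at t within {a..b})"
      by (auto intro!: derivative_eq_intros)
    moreover have "inner w v \<le> norm v * M"
      using norm_cauchy_schwarz[of w v] mult_right_mono[OF w(2), of "norm v"] by (simp add: mult.commute)
    ultimately show "\<exists>D\<le>0. (?u has_real_derivative D) (at t within {a..b})"
      by (intro exI[of _ "inner w v - norm v * M"]) auto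
  qed
  then have "inner v v \<le> norm v * (M * (b - a))" by (simp add: v_def inner_diff_left algebra_simps)
  then have "norm v * norm v \<le> norm v * (M * (b - a))" by (simp add: power2_norm_eq_inner[symmetric] power2_eq_square)
  then show ?thesis using False by (simp add: v_def)
qed

section \<open>Restricting, gluing and maximally extending Filippov solutions\<close>

lemma AE_lebesgue_on_iff_negligible:
  fixes S :: "'a::euclidean_space set"
  assumes "S \<in> sets lebesgue"
  shows "(AE t in lebesgue_on S. P t) \<longleftrightarrow> (\<exists>E. negligible E \<and> (\<forall>t\<in>S - E. P t))"
proof -
  have "(AE t in lebesgue_on S. P t) \<longleftrightarrow> (AE t in lebesgue. t \<in> S \<longrightarrow> P t)"
    by (rule AE_restrict_space_iff) (use assms in auto)
  also have "\<dots> \<longleftrightarrow> (\<exists>E. negligible E \<and> (\<forall>t\<in>S - E. P t))"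
    unfolding eventually_ae_filter negligible_iff_null_sets by auto
  finally show ?thesis .
qed

lemma solution_compact_iff:
  "filippov_solution_compact N \<Omega> \<Sigma> f a b \<phi> \<longleftrightarrow> \<phi> ` {a..b} \<subseteq> \<Omega> \<and> abs_continuous_on a b \<phi> \<and>
     (\<exists>E. negligible E \<and> (\<forall>t\<in>{a..b} - E. \<exists>w. (\<phi> has_vector_derivative w) (at t within {a..b}) \<and>
        w \<in> filippov_map N \<Omega> \<Sigma> f (\<phi> t)))"
  unfolding filippov_solution_compact_def by (subst AE_lebesgue_on_iff_negligible) auto

lemma solution_compact_cong:
  assumes "filippov_solution_compact N \<Omega> \<Sigma> f a b \<phi>" and eq: "\<And>t. t \<in> {a..b} \<Longrightarrow> \<psi> t = \<phi> t"
  shows "filippov_solution_compact N \<Omega> \<Sigma> f a b \<psi>"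
proof -
  from assms(1) obtain E where E: "\<phi> ` {a..b} \<subseteq> \<Omega>" "abs_continuous_on a b \<phi>" "negligible E"
    "\<And>t. t\<in>{a..b} - E \<Longrightarrow> \<exists>w. (\<phi> has_vector_derivative w) (at t within {a..b}) \<and>
        w \<in> filippov_map N \<Omega> \<Sigma> f (\<phi> t)"
    unfolding solution_compact_iff by blast
  have "abs_continuous_on a b \<psi>"
    by (rule AC_dominated[OF E(2) E(2), of 1]) (use eq in auto)
  moreover have "\<exists>w. (\<psi> has_vector_derivative w) (at t within {a..b}) \<and>
        w \<in> filippov_map N \<Omega> \<Sigma> f (\<psi> t)" if t: "t \<in> {a..b} - E" for t
  proof -
    obtain w where "(\<phi> has_vector_derivative w) (at t within {a..b})" "w \<in> filippov_map N \<Omega> \<Sigma> f (\<phi> t)"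
      using E(4)[OF t] by blast
    then show ?thesis
      using has_vector_derivative_transform[of t "{a..b}" \<psi> \<phi> w] eq t by auto
  qed
  moreover have "\<psi> ` {a..b} \<subseteq> \<Omega>" using E(1) eq by auto
  ultimately show ?thesis unfolding solution_compact_iff using E(3) by blast
qed

lemma solution_compact_subinterval:
  assumes "filippov_solution_compact N \<Omega> \<Sigma> f a b \<phi>" "a \<le> a'" "b' \<le> b"
  shows "filippov_solution_compact N \<Omega> \<Sigma> f a' b' \<phi>"
proof -
  from assms(1) obtain E where E: "\<phi> ` {a..b} \<subseteq> \<Omega>" "abs_continuous_on a b \<phi>" "negligible E"
    "\<And>t. t\<in>{a..b} - E \<Longrightarrow> \<exists>w. (\<phi> has_vector_derivative w) (at t within {a..b}) \<and>
        w \<in> filippov_map N \<Omega> \<Sigma> f (\<phi> t)"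
    unfolding solution_compact_iff by blast
  have sub: "{a'..b'} \<subseteq> {a..b}" using assms by auto
  have "\<exists>w. (\<phi> has_vector_derivative w) (at t within {a'..b'}) \<and> w \<in> filippov_map N \<Omega> \<Sigma> f (\<phi> t)"
    if "t \<in> {a'..b'} - E" for t
    using E(4)[of t] that sub has_vector_derivative_within_subset[OF _ sub] by blast
  then show ?thesis
    unfolding solution_compact_iff using E AC_subinterval[OF E(2) assms(2,3)] sub by blast
qed

lemma solution_compact_shift:
  assumes "filippov_solution_compact N \<Omega> \<Sigma> f (a + s) (b + s) \<phi>"
  shows "filippov_solution_compact N \<Omega> \<Sigma> f a b (\<lambda>t. \<phi> (t + s))"
proof -
  from assms(1) obtain E where E: "\<phi> ` {a + s..b + s} \<subseteq> \<Omega>" "abs_continuous_on (a + s) (b + s) \<phi>" "negligible E"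
    "\<And>t. t\<in>{a + s..b + s} - E \<Longrightarrow> \<exists>w. (\<phi> has_vector_derivative w) (at t within {a + s..b + s}) \<and>
        w \<in> filippov_map N \<Omega> \<Sigma> f (\<phi> t)"
    unfolding solution_compact_iff by blast
  have "\<exists>w. ((\<lambda>t. \<phi> (t + s)) has_vector_derivative w) (at t within {a..b}) \<and> w \<in> filippov_map N \<Omega> \<Sigma> f (\<phi> (t + s))"
    if t: "t \<in> {a..b} - (+) (- s) ` E" for t
  proof -
    have "t + s \<notin> E"
    proof
      assume "t + s \<in> E"
      then have "- s + (t + s) \<in> (+) (- s) ` E" by (rule imageI)
      then show False using t by simp
    qed
    then obtain w where w: "(\<phi> has_vector_derivative w) (at (t + s) within {a + s..b + s})"
       "w \<in> filippov_map N \<Omega> \<Sigma> f (\<phi> (t + s))"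
      using E(4)[of "t + s"] t by auto
    have "((\<lambda>t. t + s) has_vector_derivative 1) (at t within {a..b})"
      by (auto intro!: derivative_eq_intros)
    moreover have "(\<lambda>t. t + s) ` {a..b} = {a + s..b + s}" by (simp add: image_add_atLeastAtMost')
    ultimately have "(\<phi> \<circ> (\<lambda>t. t + s) has_vector_derivative 1 *\<^sub>R w) (at t within {a..b})"
      using w(1) by (intro vector_diff_chain_within) auto
    then show ?thesis using w(2) by (auto simp: o_def)
  qed
  moreover have "negligible ((+) (- s) ` E)" using E(3) by (rule negligible_translation)
  moreover have "(\<lambda>t. \<phi> (t + s)) ` {a..b} \<subseteq> \<Omega>" using E(1) by auto
  moreover have "abs_continuous_on a b (\<lambda>t. \<phi> (t + s))" by (rule AC_compose[OF E(2)]) auto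
  ultimately show ?thesis
    unfolding solution_compact_iff by blast
qed

lemma solution_compact_concat:
  assumes \<phi>: "filippov_solution_compact N \<Omega> \<Sigma> f a b \<phi>" and \<psi>: "filippov_solution_compact N \<Omega> \<Sigma> f b c \<psi>"
    and "\<phi> b = \<psi> b" "a \<le> b" "b \<le> c"
  shows "filippov_solution_compact N \<Omega> \<Sigma> f a c (\<lambda>t. if t \<le> b then \<phi> t else \<psi> t)"
proof -
  let ?h = "\<lambda>t. if t \<le> b then \<phi> t else \<psi> t"
  from \<phi> obtain E where E: "\<phi> ` {a..b} \<subseteq> \<Omega>" "abs_continuous_on a b \<phi>" "negligible E"
    "\<And>t. t\<in>{a..b} - E \<Longrightarrow> \<exists>w. (\<phi> has_vector_derivative w) (at t within {a..b}) \<and>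
        w \<in> filippov_map N \<Omega> \<Sigma> f (\<phi> t)"
    unfolding solution_compact_iff by blast
  from \<psi> obtain E' where E': "\<psi> ` {b..c} \<subseteq> \<Omega>" "abs_continuous_on b c \<psi>" "negligible E'"
    "\<And>t. t\<in>{b..c} - E' \<Longrightarrow> \<exists>w. (\<psi> has_vector_derivative w) (at t within {b..c}) \<and>
        w \<in> filippov_map N \<Omega> \<Sigma> f (\<psi> t)"
    unfolding solution_compact_iff by blast
  have "\<exists>w. (?h has_vector_derivative w) (at t within {a..c}) \<and> w \<in> filippov_map N \<Omega> \<Sigma> f (?h t)"
    if t: "t \<in> {a..c} - (E \<union> E' \<union> {b})" for t
  proof (cases "t < b")
    case True
    then obtain w where w: "(\<phi> has_vector_derivative w) (at t within {a..b})" "w \<in> filippov_map N \<Omega> \<Sigma> f (\<phi> t)"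
      using E(4)[of t] t by auto
    have "at t within {a..b} = at t within {a..c}"
      by (rule at_within_nhd[of t "{..<b}"]) (use True \<open>b \<le> c\<close> in auto)
    then have "(\<phi> has_vector_derivative w) (at t within {a..c})" using w by simp
    then have "(?h has_vector_derivative w) (at t within {a..c})"
      by (rule has_vector_derivative_transform_within[where d = "b - t"])
         (use True t in \<open>auto simp: dist_real_def\<close>)
    then show ?thesis using w(2) True by auto
  next
    case False
    then have b: "b < t" using t by auto
    then obtain w where w: "(\<psi> has_vector_derivative w) (at t within {b..c})" "w \<in> filippov_map N \<Omega> \<Sigma> f (\<psi> t)"
      using E'(4)[of t] t by auto
    have "at t within {b..c} = at t within {a..c}"
      by (rule at_within_nhd[of t "{b<..}"]) (use b \<open>a \<le> b\<close> in auto)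
    then have "(\<psi> has_vector_derivative w) (at t within {a..c})" using w by simp
    then have "(?h has_vector_derivative w) (at t within {a..c})"
      by (rule has_vector_derivative_transform_within[where d = "t - b"])
         (use b t in \<open>auto simp: dist_real_def\<close>)
    then show ?thesis using w(2) b by auto
  qed
  moreover have "negligible (E \<union> E' \<union> {b})" using E(3) E'(3) by simp
  moreover have "?h ` {a..c} \<subseteq> \<Omega>" using E(1) E'(1) by auto
  ultimately show ?thesis
    unfolding solution_compact_iff using AC_concat[OF E(2) E'(2) assms(3-5)] by blast
qed

lemma solution_compact_singleton: "x \<in> \<Omega> \<Longrightarrow> filippov_solution_compact N \<Omega> \<Sigma> f a a (\<lambda>_. x)"
  unfolding solution_compact_iff
  by (intro conjI exI[of _ "{a}"]) (simp_all add: AC_const)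

lemma is_interval_Icc_subset:
  fixes I :: "real set"
  assumes "is_interval I" "a \<in> I" "b \<in> I"
  shows "{a..b} \<subseteq> I"
proof
  fix t assume "t \<in> {a..b}"
  then show "t \<in> I"
    using mem_is_interval_1_I[OF assms, of t] by simp
qed

lemma forward_solutionI:
  assumes "is_interval I" "0 \<in> I" "I \<subseteq> {0..}"
    and "\<And>T. T \<in> I \<Longrightarrow> filippov_solution_compact N \<Omega> \<Sigma> f 0 T \<phi>"
  shows "forward_solution N \<Omega> \<Sigma> f I \<phi>"
  unfolding forward_solution_def filippov_solution_def
proof (intro conjI allI impI assms)
  fix a b assume ab: "a \<le> b \<and> {a..b} \<subseteq> I"
  then have "a \<in> I" "b \<in> I" by auto
  then show "filippov_solution_compact N \<Omega> \<Sigma> f a b \<phi>"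
    using solution_compact_subinterval[OF assms(4)[of b], of a b] assms(3) by auto
qed

lemma forward_solution_compactD:
  assumes "forward_solution N \<Omega> \<Sigma> f I \<phi>" "T \<in> I" "0 \<le> a"
  shows "filippov_solution_compact N \<Omega> \<Sigma> f a T \<phi>"
proof -
  have I: "is_interval I" "0 \<in> I" "T \<ge> 0"
    and sol: "\<And>a b. a \<le> b \<Longrightarrow> {a..b} \<subseteq> I \<Longrightarrow> filippov_solution_compact N \<Omega> \<Sigma> f a b \<phi>"
    using assms unfolding forward_solution_def filippov_solution_def by auto
  have "{0..T} \<subseteq> I" using I assms(2) is_interval_Icc_subset by blast
  then show ?thesis
    using solution_compact_subinterval[OF sol[OF \<open>T \<ge> 0\<close>], of a T] assms(3) by auto
qed

lemma forward_solution_Icc: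
  assumes "filippov_solution_compact N \<Omega> \<Sigma> f 0 T \<phi>" "T \<ge> 0"
  shows "forward_solution N \<Omega> \<Sigma> f {0..T} \<phi>"
proof (rule forward_solutionI)
  fix T' assume "T' \<in> {0..T}"
  then show "filippov_solution_compact N \<Omega> \<Sigma> f 0 T' \<phi>"
    by (intro solution_compact_subinterval[OF assms(1)]) auto
qed (use assms(2) in \<open>auto simp: is_interval_cc\<close>)

lemma constant_solution:
  assumes "x \<in> \<Omega>" "0 \<in> filippov_map N \<Omega> \<Sigma> f x"
  shows "filippov_equilibrium N \<Omega> \<Sigma> f x"
  unfolding filippov_equilibrium_def filippov_solution_def solution_compact_iff
proof (intro conjI allI impI exI[of _ "{}"] ballI exI[of _ "0"])
  fix a b t :: real
  show "((\<lambda>t. x) has_vector_derivative 0) (at t within {a..b})" by simp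
qed (use assms in \<open>auto simp: AC_const\<close>)

text \<open>Zorn's lemma for graphs of forward solutions, starting from the constant on \<open>{0}\<close>. The maximal
solution may live on \<open>{0}\<close> alone; in a stable system, however, the definition of stability
makes it global. This is how solutions of the stable system are obtained.\<close>

lemma maximal_forward_solution_exists:
  assumes x: "x \<in> \<Omega>"
  obtains I \<phi> where "maximal_forward_solution N \<Omega> \<Sigma> f I \<phi>" "\<phi> 0 = x"
proof -
  \<comment> \<open>Graphs order solutions by extension, whatever their values outside their domains are.\<close>
  define gr where "gr I \<phi> = (\<lambda>t. (t, \<phi> t)) ` I" for I :: "real set" and \<phi> :: "real \<Rightarrow> 'a"
  define \<A> where "\<A> = {gr I \<phi> |I \<phi>. forward_solution N \<Omega> \<Sigma> f I \<phi> \<and> \<phi> 0 = x}"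
  have gr_sub: "gr I \<phi> \<subseteq> gr J \<psi> \<longleftrightarrow> I \<subseteq> J \<and> (\<forall>t\<in>I. \<psi> t = \<phi> t)" for I J \<phi> \<psi>
    unfolding gr_def by auto
  have base: "gr {0} (\<lambda>_. x) \<in> \<A>"
  proof -
    have "forward_solution N \<Omega> \<Sigma> f {0} (\<lambda>_. x)"
      using forward_solution_Icc[OF solution_compact_singleton[OF x]] by simp
    then show ?thesis unfolding \<A>_def by blast
  qed
  have "\<exists>M\<in>\<A>. \<forall>X\<in>\<A>. M \<subseteq> X \<longrightarrow> X = M"
  proof (rule subset_Zorn)
    fix C assume C: "subset.chain \<A> C"
    show "\<exists>U\<in>\<A>. \<forall>X\<in>C. X \<subseteq> U"
    proof (cases "C = {}")
      case True
      then show ?thesis using base by auto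
    next
      case False
      have CA: "X \<in> \<A>" if "X \<in> C" for X using C that by (auto simp: subset.chain_def)
      have lin: "X \<subseteq> Y \<or> Y \<subseteq> X" if "X \<in> C" "Y \<in> C" for X Y
        using C that by (auto simp: subset.chain_def)
      define I where "I = fst ` \<Union>C"
      define \<phi> where "\<phi> t = (SOME y. (t, y) \<in> \<Union>C)" for t
      have uniq: "y = z" if yz: "(t, y) \<in> \<Union>C" "(t, z) \<in> \<Union>C" for t y z
      proof -
        obtain X Y where XY: "X \<in> C" "Y \<in> C" "(t, y) \<in> X" "(t, z) \<in> Y" using yz by blast
        then obtain Z where "Z \<in> C" "(t, y) \<in> Z" "(t, z) \<in> Z" using lin[of X Y] by blast
        then show ?thesis using CA[of Z] unfolding \<A>_def gr_def by auto
      qed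
      have \<phi>: "\<phi> t = y" if "(t, y) \<in> \<Union>C" for t y
        unfolding \<phi>_def using that uniq by (intro some_equality) blast+
      have mem: "J \<subseteq> I \<and> (\<forall>t\<in>J. \<phi> t = \<psi> t)" if "gr J \<psi> \<in> C" for J \<psi>
      proof (intro conjI ballI subsetI)
        fix t assume "t \<in> J"
        then have *: "(t, \<psi> t) \<in> \<Union>C" using that by (auto simp: gr_def)
        show "\<phi> t = \<psi> t" by (rule \<phi>[OF *])
        show "t \<in> I" unfolding I_def using * by (metis fst_conv imageI)
      qed
      have piece: "\<exists>J \<psi>. gr J \<psi> \<in> C \<and> t \<in> J \<and> forward_solution N \<Omega> \<Sigma> f J \<psi> \<and> \<psi> 0 = x" if "t \<in> I" for t
      proof -
        from \<open>t \<in> I\<close> obtain p where "p \<in> \<Union>C" "fst p = t"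
          unfolding I_def by (metis imageE)
        then obtain X where X: "X \<in> C" "p \<in> X" by blast
        then obtain J \<psi> where J: "X = gr J \<psi>" "forward_solution N \<Omega> \<Sigma> f J \<psi>" "\<psi> 0 = x"
          using CA[of X] unfolding \<A>_def by blast
        have "t \<in> J" using X(2) \<open>fst p = t\<close> unfolding J(1) gr_def by (auto)
        then show ?thesis using X J by blast
      qed
      have sol: "filippov_solution_compact N \<Omega> \<Sigma> f 0 T \<phi> \<and> {0..T} \<subseteq> I \<and> 0 \<le> T \<and> \<phi> 0 = x" if T: "T \<in> I" for T
      proof -
        obtain J \<psi> where J: "gr J \<psi> \<in> C" "T \<in> J" "forward_solution N \<Omega> \<Sigma> f J \<psi>" "\<psi> 0 = x"
          using piece[OF T] by blast
        have J0: "is_interval J" "0 \<in> J" "J \<subseteq> {0..}"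
          using J(3) by (auto simp: forward_solution_def filippov_solution_def)
        then have sub: "{0..T} \<subseteq> J"
          using J(2) is_interval_Icc_subset by blast
        have eq: "\<phi> t = \<psi> t" if "t \<in> J" for t using mem[OF J(1)] that by blast
        have "filippov_solution_compact N \<Omega> \<Sigma> f 0 T \<phi>"
          by (rule solution_compact_cong[OF forward_solution_compactD[OF J(3,2) order_refl]])
             (use eq sub in auto)
        then show ?thesis using mem[OF J(1)] sub J J0 eq by auto
      qed
      have "I \<noteq> {}"
      proof -
        obtain X where "X \<in> C" using False by blast
        then obtain J \<psi> where J: "gr J \<psi> \<in> C" "forward_solution N \<Omega> \<Sigma> f J \<psi>"
          using CA[OF \<open>X \<in> C\<close>] \<open>X \<in> C\<close> unfolding \<A>_def by blast
        then have "0 \<in> J" by (simp add: forward_solution_def)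
        then show ?thesis using mem[OF J(1)] by blast
      qed
      then obtain T where "T \<in> I" by blast
      then have "0 \<in> I" "\<phi> 0 = x" using sol[of T] by auto
      moreover have "is_interval I" unfolding is_interval_1
      proof (intro ballI allI impI)
        fix a b t assume "a \<in> I" "b \<in> I" "a \<le> t \<and> t \<le> b"
        then show "t \<in> I" using sol[of a] sol[of b] by auto
      qed
      ultimately have "forward_solution N \<Omega> \<Sigma> f I \<phi>"
        by (intro forward_solutionI) (use sol in auto)
      then have "gr I \<phi> \<in> \<A>" using \<open>\<phi> 0 = x\<close> by (auto simp: \<A>_def)
      moreover have "X \<subseteq> gr I \<phi>" if XC: "X \<in> C" for X
      proof -
        obtain J \<psi> where "X = gr J \<psi>" using CA[OF XC] by (auto simp: \<A>_def)
        then show ?thesis using mem[of J \<psi>] XC unfolding gr_def by auto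
      qed
      ultimately show ?thesis by blast
    qed
  qed
  then obtain X where X: "X \<in> \<A>" "\<forall>Y\<in>\<A>. X \<subseteq> Y \<longrightarrow> Y = X" by blast
  obtain I \<phi> where XI: "X = gr I \<phi>" and M: "forward_solution N \<Omega> \<Sigma> f I \<phi>" "\<phi> 0 = x"
    using X(1) unfolding \<A>_def by blast
  have max: "Y = gr I \<phi>" if "Y \<in> \<A>" "gr I \<phi> \<subseteq> Y" for Y
    using X(2) that unfolding XI by blast
  have "J = I" if J: "forward_solution N \<Omega> \<Sigma> f J \<psi>" "I \<subseteq> J" "\<forall>t\<in>I. \<psi> t = \<phi> t" for J \<psi>
  proof -
    have "0 \<in> I" using M(1) by (simp add: forward_solution_def)
    then have "\<psi> 0 = x" using J(3) M(2) by simp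
    then have "gr J \<psi> \<in> \<A>" using J(1) unfolding \<A>_def by blast
    then have "gr J \<psi> = gr I \<phi>" by (rule max) (use J(2,3) gr_sub in blast)
    then have "fst ` gr J \<psi> = fst ` gr I \<phi>" by simp
    then show "J = I" by (simp add: gr_def image_image)
  qed
  then have "maximal_forward_solution N \<Omega> \<Sigma> f I \<phi>"
    unfolding maximal_forward_solution_def using M(1) by blast
  then show ?thesis using that M(2) by blast
qed

text \<open>A Lipschitz solution has a limit at the open end of its interval. The closed set \<open>K\<close> keeps that limit
inside the domain.\<close>

lemma solution_half_open_closure:
  assumes sol: "\<And>T. 0 \<le> T \<Longrightarrow> T < s \<Longrightarrow> filippov_solution_compact N \<Omega> \<Sigma> f 0 T \<phi>"
    and s: "s > 0" and lip: "L-lipschitz_on {0..<s} \<phi>" and K: "\<phi> ` {0..<s} \<subseteq> K" "closed K" "K \<subseteq> \<Omega>"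
  obtains \<psi> where "filippov_solution_compact N \<Omega> \<Sigma> f 0 s \<psi>" "\<And>t. t \<in> {0..<s} \<Longrightarrow> \<psi> t = \<phi> t"
proof -
  have "uniformly_continuous_on {0..<s} \<phi>" using lip by (rule lipschitz_on_uniformly_continuous)
  then obtain \<psi> where \<psi>: "uniformly_continuous_on (closure {0..<s}) \<psi>" "\<And>t. t \<in> {0..<s} \<Longrightarrow> \<phi> t = \<psi> t"
    using uniformly_continuous_on_extension_on_closure[of "{0..<s}" \<phi>] by metis
  have cl: "closure {0..<s} = {0..s}" using s by simp
  have cont: "continuous_on (closure {0..<s}) \<psi>" using \<psi>(1) by (rule uniformly_continuous_imp_continuous)
  have "L-lipschitz_on {0..<s} \<psi>" using lip \<psi>(2) lipschitz_on_transform by (simp add: lipschitz_on_def)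
  then have "L-lipschitz_on {0..s} \<psi>" using lipschitz_on_closure[OF _ cont] cl by simp
  then have AC: "abs_continuous_on 0 s \<psi>" by (rule lipschitz_imp_AC)
  have "\<psi> ` closure {0..<s} \<subseteq> K"
    by (rule image_closure_subset[OF cont K(2)]) (use K(1) \<psi>(2) in force)
  then have im: "\<psi> ` {0..s} \<subseteq> \<Omega>" using K(3) cl by auto
  have "\<exists>E. negligible E \<and> (\<forall>t\<in>{0..T} - E. \<exists>w. (\<psi> has_vector_derivative w) (at t within {0..T}) \<and>
        w \<in> filippov_map N \<Omega> \<Sigma> f (\<psi> t))" if "0 \<le> T" "T < s" for T
    using solution_compact_cong[OF sol[OF that], of \<psi>] \<psi>(2) that unfolding solution_compact_iff by auto
  then obtain E where E: "\<And>T. 0 \<le> T \<Longrightarrow> T < s \<Longrightarrow> negligible (E T)"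
    "\<And>T t. 0 \<le> T \<Longrightarrow> T < s \<Longrightarrow> t\<in>{0..T} - E T \<Longrightarrow> \<exists>w. (\<psi> has_vector_derivative w) (at t within {0..T}) \<and>
        w \<in> filippov_map N \<Omega> \<Sigma> f (\<psi> t)" by metis
  define T where "T n = s - s / real (n + 2)" for n
  have T: "0 \<le> T n" "T n < s" for n using s by (auto simp: T_def field_simps)
  define E' where "E' = (\<Union>n. E (T n)) \<union> {s}"
  have "negligible E'" unfolding E'_def
    by (intro negligible_Un negligible_countable_Union) (use E(1)[OF T] in auto)
  moreover have "\<exists>w. (\<psi> has_vector_derivative w) (at t within {0..s}) \<and> w \<in> filippov_map N \<Omega> \<Sigma> f (\<psi> t)"
    if t: "t \<in> {0..s} - E'" for t
  proof -
    have "t < s" using t by (auto simp: E'_def)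
    have "(\<lambda>n. s - s / real (n + 2)) \<longlonglongrightarrow> s - 0"
      by (intro tendsto_intros LIMSEQ_ignore_initial_segment lim_const_over_n)
    then have "eventually (\<lambda>n. t < T n) sequentially"
      unfolding T_def by (rule order_tendstoD) (use \<open>t < s\<close> in simp)
    then obtain n where n: "t < T n" by (auto simp: eventually_sequentially)
    obtain w where w: "(\<psi> has_vector_derivative w) (at t within {0..T n})" "w \<in> filippov_map N \<Omega> \<Sigma> f (\<psi> t)"
      using E(2)[OF T, of t n] t n unfolding E'_def by auto
    have "at t within {0..T n} = at t within {0..s}"
      by (rule at_within_nhd[of t "{..<T n}"]) (use n T[of n] in auto)
    then show ?thesis using w by auto
  qed
  ultimately have "filippov_solution_compact N \<Omega> \<Sigma> f 0 s \<psi>"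
    unfolding solution_compact_iff using AC im by blast
  then show ?thesis using that \<psi>(2) by simp
qed

section \<open>Velocities near the equilibrium and an adapted quadratic form\<close>

text \<open>Here \<open>l\<close> is the share of the right-hand field in a Filippov velocity. The left-hand field is known up to
\<open>o(norm x)\<close> and the right-hand field only up to \<open>O(norm x)\<close>, so the larger error is charged to \<open>l\<close>; what
makes it affordable is that \<open>l\<close> has a small time integral along solutions.\<close>

definition crossing_velocity :: "real^'n^'n \<Rightarrow> real^'n \<Rightarrow> 'n \<Rightarrow> real \<Rightarrow> real \<Rightarrow> real^'n \<Rightarrow> real^'n \<Rightarrow> bool" where
  "crossing_velocity A c k \<epsilon> C x w \<longleftrightarrow>
     (\<exists>l e. 0 \<le> l \<and> l \<le> 1 \<and> (x $ k < 0 \<longrightarrow> l = 0) \<and> (x $ k > 0 \<longrightarrow> l = 1) \<and>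
        w = A *v x + l *\<^sub>R c + e \<and> norm e \<le> (\<epsilon> + C * l) * norm x)"

text \<open>The constant \<open>C\<close> does not depend on \<open>\<epsilon>\<close>: the comparison first fixes its bounds in terms of \<open>C\<close> and then
chooses \<open>\<epsilon>\<close>.\<close>

definition crossing_estimate :: "real^'n^'n \<Rightarrow> real^'n \<Rightarrow> 'n \<Rightarrow> (real^'n \<Rightarrow> (real^'n) set) \<Rightarrow> bool" where
  "crossing_estimate A c k G \<longleftrightarrow> (\<exists>C\<ge>0. \<forall>\<epsilon>>0. \<exists>\<rho>>0. \<forall>x. norm x < \<rho> \<longrightarrow>
     (\<forall>w\<in>G x. crossing_velocity A c k \<epsilon> C x w))"

text \<open>The inner product of the projections along \<open>c\<close> to the hyperplane \<open>x\<^sub>k = 0\<close>, completed by the product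
of the \<open>k\<close>-th coordinates. The projection annihilates \<open>c\<close>, so \<open>c\<close> pairs with \<open>x\<close> only through \<open>x\<^sub>k\<close>.\<close>

definition proj_form :: "'n::finite \<Rightarrow> real^'n \<Rightarrow> real^'n \<Rightarrow> real^'n \<Rightarrow> real" where
  "proj_form k c x y = inner (x - (x $ k / c $ k) *\<^sub>R c) (y - (y $ k / c $ k) *\<^sub>R c) + x $ k * y $ k"

lemma bounded_bilinear_proj_form:
  fixes c :: "real^'n"
  shows "bounded_bilinear (proj_form k c)"
proof -
  have lin: "bounded_linear (\<lambda>x::real^'n. x - (x $ k / c $ k) *\<^sub>R c)"
    unfolding divide_inverse
    by (intro bounded_linear_sub bounded_linear_ident bounded_linear_scaleR_const
        bounded_linear_mult_const bounded_linear_vec_nth)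
  have lin': "bounded_linear (\<lambda>x::real^'n. x $ k)" by (rule bounded_linear_vec_nth)
  interpret L: bounded_linear "\<lambda>x::real^'n. x - (x $ k / c $ k) *\<^sub>R c" by (rule lin)
  obtain K where K: "K > 0" "\<And>x::real^'n. norm (x - (x $ k / c $ k) *\<^sub>R c) \<le> norm x * K"
    using L.pos_bounded by blast
  show ?thesis
  proof
    fix x y z :: "real^'n" and r :: real
    have add: "x + y - ((x + y) $ k / c $ k) *\<^sub>R c = (x - (x $ k / c $ k) *\<^sub>R c) + (y - (y $ k / c $ k) *\<^sub>R c)" for x y :: "real^'n"
      by (rule L.add)
    have scale: "(r *\<^sub>R x) - ((r *\<^sub>R x) $ k / c $ k) *\<^sub>R c = r *\<^sub>R (x - (x $ k / c $ k) *\<^sub>R c)" for x :: "real^'n"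
      by (rule L.scaleR)
    show "proj_form k c (x + y) z = proj_form k c x z + proj_form k c y z"
      unfolding proj_form_def add by (simp add: inner_add_left algebra_simps add_divide_distrib)
    show "proj_form k c x (y + z) = proj_form k c x y + proj_form k c x z"
      unfolding proj_form_def add by (simp add: inner_add_right algebra_simps add_divide_distrib)
    show "proj_form k c (r *\<^sub>R x) y = r *\<^sub>R proj_form k c x y"
      unfolding proj_form_def scale by (simp add: algebra_simps)
    show "proj_form k c x (r *\<^sub>R y) = r *\<^sub>R proj_form k c x y"
      unfolding proj_form_def scale by (simp add: algebra_simps)
    show "\<exists>K. \<forall>x y. norm (proj_form k c x y) \<le> norm x * norm y * K"
    proof (intro exI allI)
      fix x y :: "real^'n"
      have "\<bar>proj_form k c x y\<bar> \<le> \<bar>inner (x - (x $ k / c $ k) *\<^sub>R c) (y - (y $ k / c $ k) *\<^sub>R c)\<bar> + \<bar>x $ k * y $ k\<bar>"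
        unfolding proj_form_def by linarith
      also have "\<dots> \<le> (norm x * K) * (norm y * K) + norm x * norm y"
        unfolding abs_mult
        by (intro add_mono mult_mono order_trans[OF Cauchy_Schwarz_ineq2] component_le_norm_cart K)
           (use K(1) in auto)
      finally show "norm (proj_form k c x y) \<le> norm x * norm y * (K * K + 1)"
        by (simp add: algebra_simps)
    qed
  qed
qed

lemma proj_form_sym: "proj_form k c x y = proj_form k c y x"
  unfolding proj_form_def by (simp add: inner_commute mult.commute)

text \<open>With \<open>c\<^sub>k < 0\<close> this is the dissipativity of the discontinuous term: \<open>l\<close> is monotone in \<open>x\<^sub>k\<close>, so \<open>l c\<close> pairs
nonpositively with \<open>x\<close>, and likewise for differences.\<close>

lemma proj_form_direction: "c $ k \<noteq> 0 \<Longrightarrow> proj_form k c x c = c $ k * x $ k"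
  unfolding proj_form_def by simp

lemma proj_form_coercive:
  fixes c :: "real^'n"
  assumes "c $ k \<noteq> 0"
  obtains M where "M > 0" "\<And>x. (norm x)\<^sup>2 \<le> M * proj_form k c x x"
proof
  let ?q = "norm c / \<bar>c $ k\<bar>"
  show "2 * (1 + ?q\<^sup>2) > 0" by (smt (verit) zero_le_power2)
  fix x :: "real^'n"
  let ?P = "x - (x $ k / c $ k) *\<^sub>R c"
  have "norm x = norm (?P + (x $ k / c $ k) *\<^sub>R c)" by simp
  also have "\<dots> \<le> norm ?P + norm ((x $ k / c $ k) *\<^sub>R c)" by (rule norm_triangle_ineq)
  also have "norm ((x $ k / c $ k) *\<^sub>R c) = \<bar>x $ k\<bar> * ?q" by simp
  finally have "norm x \<le> norm ?P + \<bar>x $ k\<bar> * ?q" .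
  then have "(norm x)\<^sup>2 \<le> (norm ?P + \<bar>x $ k\<bar> * ?q)\<^sup>2" by (intro power_mono) auto
  also have "\<dots> \<le> 2 * (norm ?P)\<^sup>2 + 2 * (\<bar>x $ k\<bar> * ?q)\<^sup>2"
  proof -
    have "(p + q)\<^sup>2 \<le> 2 * p\<^sup>2 + 2 * q\<^sup>2" for p q :: real
      using zero_le_power2[of "p - q"] unfolding power2_sum power2_diff by simp
    then show ?thesis by blast
  qed
  also have "\<dots> = 2 * (norm ?P)\<^sup>2 + 2 * ?q\<^sup>2 * (x $ k)\<^sup>2" by (simp add: power_mult_distrib power_divide)
  also have "\<dots> \<le> 2 * (1 + ?q\<^sup>2) * ((norm ?P)\<^sup>2 + (x $ k)\<^sup>2)"
  proof -
    have "0 \<le> ?q\<^sup>2 * (norm ?P)\<^sup>2" "0 \<le> (x $ k)\<^sup>2" by simp_all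
    moreover have "2 * (1 + ?q\<^sup>2) * ((norm ?P)\<^sup>2 + (x $ k)\<^sup>2)
        = 2 * (norm ?P)\<^sup>2 + 2 * ?q\<^sup>2 * (x $ k)\<^sup>2 + 2 * (?q\<^sup>2 * (norm ?P)\<^sup>2) + 2 * (x $ k)\<^sup>2"
      by (simp add: algebra_simps)
    ultimately show ?thesis by linarith
  qed
  also have "\<dots> = 2 * (1 + ?q\<^sup>2) * proj_form k c x x"
    unfolding proj_form_def power2_norm_eq_inner power2_eq_square[of "x $ k"] by (rule refl)
  finally show "(norm x)\<^sup>2 \<le> 2 * (1 + ?q\<^sup>2) * proj_form k c x x" .
qed

lemma matrix_bound:
  fixes A :: "real^'n^'n"
  obtains a where "a > 0" "\<And>x. norm (A *v x) \<le> a * norm x"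
proof -
  have "bounded_linear ((*v) A)" by (simp add: linear_linear)
  then show ?thesis using bounded_linear.pos_bounded that by (metis mult.commute)
qed

lemma AC_bilinear:
  fixes \<phi> :: "real \<Rightarrow> 'a::real_normed_vector" and B :: "'a \<Rightarrow> 'a \<Rightarrow> real"
  assumes B: "bounded_bilinear B" and AC: "abs_continuous_on a b \<phi>"
  shows "abs_continuous_on a b (\<lambda>t. B (\<phi> t) (\<phi> t))"
proof -
  interpret bounded_bilinear B by (rule B)
  obtain K where K: "K > 0" "\<And>x y. norm (B x y) \<le> norm x * norm y * K" using pos_bounded by blast
  have "bounded (\<phi> ` {a..b})"
    using AC_imp_continuous_on[OF AC] compact_continuous_image compact_imp_bounded by blast
  then obtain R where "R > 0" "\<forall>y\<in>\<phi> ` {a..b}. norm y \<le> R"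
    unfolding bounded_pos by blast
  then have R: "\<And>t. t \<in> {a..b} \<Longrightarrow> norm (\<phi> t) \<le> R" "R > 0" by blast+
  show ?thesis
  proof (rule AC_dominated[OF AC AC, of "2 * R * K"])
    fix s t assume st: "a \<le> s" "s \<le> t" "t \<le> b"
    have "B (\<phi> s) (\<phi> s) - B (\<phi> t) (\<phi> t) = B (\<phi> s) (\<phi> s - \<phi> t) + B (\<phi> s - \<phi> t) (\<phi> t)"
      by (simp add: diff_left diff_right)
    then have "\<bar>B (\<phi> s) (\<phi> s) - B (\<phi> t) (\<phi> t)\<bar> \<le> norm (\<phi> s) * norm (\<phi> s - \<phi> t) * K + norm (\<phi> s - \<phi> t) * norm (\<phi> t) * K"
      using K(2)[of "\<phi> s" "\<phi> s - \<phi> t"] K(2)[of "\<phi> s - \<phi> t" "\<phi> t"] by (simp add: abs_le_iff)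
    also have "\<dots> \<le> R * norm (\<phi> s - \<phi> t) * K + norm (\<phi> s - \<phi> t) * R * K"
      using R st K by (intro add_mono mult_mono mult_left_mono mult_right_mono) auto
    also have "\<dots> = 2 * R * K * dist (\<phi> s) (\<phi> t)" by (simp add: dist_norm)
    also have "\<dots> \<le> 2 * R * K * (dist (\<phi> s) (\<phi> t) + dist (\<phi> s) (\<phi> t) + (t - s))"
      using st R K by (intro mult_left_mono) auto
    finally show "dist (B (\<phi> s) (\<phi> s)) (B (\<phi> t) (\<phi> t)) \<le> 2 * R * K * (dist (\<phi> s) (\<phi> t) + dist (\<phi> s) (\<phi> t) + (t - s))"
      by (simp add: dist_real_def)
  qed (use R K in auto)
qed

lemma proj_form_has_derivative:
  assumes "(\<phi> has_vector_derivative w) (at t within S)"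
  shows "((\<lambda>t. proj_form k c (\<phi> t) (\<phi> t)) has_real_derivative 2 * proj_form k c (\<phi> t) w) (at t within S)"
proof -
  have "((\<lambda>t. proj_form k c (\<phi> t) (\<phi> t)) has_vector_derivative
      proj_form k c (\<phi> t) w + proj_form k c w (\<phi> t)) (at t within S)"
    by (rule bounded_bilinear.has_vector_derivative[OF bounded_bilinear_proj_form assms assms])
  then show ?thesis
    by (simp add: has_real_derivative_iff_has_vector_derivative proj_form_sym[of k c w])
qed

section \<open>Comparison of solutions with the same initial value\<close>

text \<open>The velocity is of the size of \<open>c\<close> and not of \<open>x\<close>, but the term \<open>l c\<close> contributes \<open>l c\<^sub>k x\<^sub>k \<le> 0\<close> to
the derivative of the quadratic form, and all other terms are \<open>O((norm x)\<^sup>2)\<close>.\<close>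

lemma estimate_apriori:
  assumes ce: "crossing_estimate A c k (filippov_map N \<Omega> \<Sigma> f)" and c: "c $ k < 0"
  obtains \<rho> D K where "\<rho> > 0" "D > 0" "K > 0"
    "\<And>\<phi> T. 0 \<le> T \<Longrightarrow> filippov_solution_compact N \<Omega> \<Sigma> f 0 T \<phi> \<Longrightarrow> (\<And>t. 0 \<le> t \<Longrightarrow> t < T \<Longrightarrow> norm (\<phi> t) < \<rho>) \<Longrightarrow>
       (norm (\<phi> T))\<^sup>2 \<le> D * exp (K * T) * (norm (\<phi> 0))\<^sup>2"
proof -
  obtain C \<rho> where C: "C \<ge> 0" and \<rho>: "\<rho> > 0"
    and est: "\<And>x w. norm x < \<rho> \<Longrightarrow> w \<in> filippov_map N \<Omega> \<Sigma> f x \<Longrightarrow> crossing_velocity A c k 1 C x w"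
    using ce zero_less_one unfolding crossing_estimate_def by blast
  interpret B: bounded_bilinear "proj_form k c" by (rule bounded_bilinear_proj_form)
  obtain b where b: "b > 0" "\<And>x y. norm (proj_form k c x y) \<le> norm x * norm y * b"
    using B.pos_bounded by blast
  obtain M where M: "M > 0" "\<And>x. (norm x)\<^sup>2 \<le> M * proj_form k c x x"
    using proj_form_coercive[of c k] c by auto
  obtain a where a: "a > 0" "\<And>x. norm (A *v x) \<le> a * norm x" using matrix_bound[of A] by blast
  define K where "K = 2 * b * (a + 1 + C) * M"
  have K: "K > 0" using a b C M by (simp add: K_def add_pos_nonneg)
  show ?thesis
  proof (rule that[of \<rho> "M * b" K])
    fix \<phi> T assume T: "0 \<le> T" and sol: "filippov_solution_compact N \<Omega> \<Sigma> f 0 T \<phi>"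
      and small: "\<And>t. 0 \<le> t \<Longrightarrow> t < T \<Longrightarrow> norm (\<phi> t) < \<rho>"
    let ?V = "\<lambda>t. proj_form k c (\<phi> t) (\<phi> t)"
    from sol obtain E where E: "abs_continuous_on 0 T \<phi>" "negligible E"
      "\<And>t. t\<in>{0..T} - E \<Longrightarrow> \<exists>w. (\<phi> has_vector_derivative w) (at t within {0..T}) \<and>
          w \<in> filippov_map N \<Omega> \<Sigma> f (\<phi> t)"
      unfolding solution_compact_iff by blast
    have "?V T \<le> exp (K * (T - 0)) * (?V 0 + 0 * (T - 0))"
    proof (rule AC_gronwall[OF T AC_bilinear[OF bounded_bilinear_proj_form E(1)]])
      show "negligible (E \<union> {T})" using E(2) by simp
      fix t assume t: "t \<in> {0..T} - (E \<union> {T})"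
      then obtain w where w: "(\<phi> has_vector_derivative w) (at t within {0..T})" "w \<in> filippov_map N \<Omega> \<Sigma> f (\<phi> t)"
        using E(3)[of t] by auto
      have "norm (\<phi> t) < \<rho>" using small t by auto
      then obtain l e where le: "0 \<le> l" "l \<le> 1" "\<phi> t $ k < 0 \<longrightarrow> l = 0" "\<phi> t $ k > 0 \<longrightarrow> l = 1"
        and weq: "w = A *v \<phi> t + l *\<^sub>R c + e" and e: "norm e \<le> (1 + C * l) * norm (\<phi> t)"
        using est[OF _ w(2)] unfolding crossing_velocity_def by blast
      have "l * (\<phi> t $ k) \<ge> 0" using le by (cases "\<phi> t $ k" "0::real" rule: linorder_cases) auto
      then have neg: "l * (c $ k * (\<phi> t $ k)) \<le> 0"
        using mult_nonneg_nonpos[of "l * (\<phi> t $ k)" "c $ k"] c by (simp add: ac_simps)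
      have e': "norm e \<le> (1 + C) * norm (\<phi> t)"
        using e le C by (smt (verit) mult_left_le mult_right_mono norm_ge_zero)
      have "proj_form k c (\<phi> t) w = proj_form k c (\<phi> t) (A *v \<phi> t) + l * (c $ k * (\<phi> t $ k)) + proj_form k c (\<phi> t) e"
        unfolding weq using c by (simp add: B.add_right B.scaleR_right proj_form_direction)
      also have "\<dots> \<le> norm (\<phi> t) * norm (A *v \<phi> t) * b + 0 + norm (\<phi> t) * norm e * b"
        using b(2)[of "\<phi> t" "A *v \<phi> t"] b(2)[of "\<phi> t" e] neg by (intro add_mono) (auto simp: abs_le_iff)
      also have "\<dots> \<le> norm (\<phi> t) * (a * norm (\<phi> t)) * b + 0 + norm (\<phi> t) * ((1 + C) * norm (\<phi> t)) * b"
        using b(1) by (intro add_mono mult_right_mono mult_left_mono a e') auto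
      also have "\<dots> = b * (a + 1 + C) * (norm (\<phi> t))\<^sup>2" by (simp add: algebra_simps power2_eq_square)
      also have "\<dots> \<le> b * (a + 1 + C) * (M * ?V t)"
        using a b C by (intro mult_left_mono M) auto
      finally have "2 * proj_form k c (\<phi> t) w \<le> K * ?V t + 0" by (simp add: K_def)
      then show "\<exists>D\<le>K * ?V t + 0. (?V has_real_derivative D) (at t within {0..T})"
        using proj_form_has_derivative[OF w(1)] by blast
    qed (use K in auto)
    then have "?V T \<le> exp (K * T) * ?V 0" by simp
    also have "\<dots> \<le> exp (K * T) * (norm (\<phi> 0) * norm (\<phi> 0) * b)"
      using b(2)[of "\<phi> 0" "\<phi> 0"] by (intro mult_left_mono) auto
    finally have "M * ?V T \<le> M * (exp (K * T) * (norm (\<phi> 0) * norm (\<phi> 0) * b))"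
      using M(1) by (intro mult_left_mono) auto
    then show "(norm (\<phi> T))\<^sup>2 \<le> M * b * exp (K * T) * (norm (\<phi> 0))\<^sup>2"
      using M(2)[of "\<phi> T"] by (simp add: power2_eq_square ac_simps)
  qed (use \<rho> M b K in auto)
qed

text \<open>The a priori estimate holds while the solution is in a ball; from a small enough initial value it
keeps the solution away from the boundary of that ball, so there is no first time of exit.\<close>

lemma solutions_stay_close:
  assumes ce: "crossing_estimate A c k (filippov_map N \<Omega> \<Sigma> f)" and c: "c $ k < 0" and T: "T \<ge> 0"
  obtains R r where "R \<ge> 1" "r > 0"
    "\<And>\<phi> S t. S \<le> T \<Longrightarrow> filippov_solution_compact N \<Omega> \<Sigma> f 0 S \<phi> \<Longrightarrow> norm (\<phi> 0) < r \<Longrightarrow>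
       0 \<le> t \<Longrightarrow> t \<le> S \<Longrightarrow> norm (\<phi> t) \<le> R * norm (\<phi> 0)"
proof -
  obtain \<rho> D K where pos: "\<rho> > 0" "D > 0" "K > 0"
    and ap: "\<And>\<phi> T. 0 \<le> T \<Longrightarrow> filippov_solution_compact N \<Omega> \<Sigma> f 0 T \<phi> \<Longrightarrow> (\<And>t. 0 \<le> t \<Longrightarrow> t < T \<Longrightarrow> norm (\<phi> t) < \<rho>) \<Longrightarrow>
       (norm (\<phi> T))\<^sup>2 \<le> D * exp (K * T) * (norm (\<phi> 0))\<^sup>2"
    by (fact estimate_apriori[OF ce c])
  define R where "R = 1 + D * exp (K * T)"
  have R: "R \<ge> 1" using pos by (simp add: R_def)
  have R2: "norm (\<phi> t) \<le> R * norm (\<phi> 0)"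
    if "0 \<le> t" "t \<le> T" "filippov_solution_compact N \<Omega> \<Sigma> f 0 t \<phi>" "\<And>s. 0 \<le> s \<Longrightarrow> s < t \<Longrightarrow> norm (\<phi> s) < \<rho>" for t \<phi>
  proof (rule power2_le_imp_le)
    have "(norm (\<phi> t))\<^sup>2 \<le> D * exp (K * t) * (norm (\<phi> 0))\<^sup>2" using that by (intro ap) auto
    also have "\<dots> \<le> R\<^sup>2 * (norm (\<phi> 0))\<^sup>2"
    proof (rule mult_right_mono)
      have "D * exp (K * t) \<le> R" using that pos by (simp add: R_def add_increasing)
      also have "R \<le> R\<^sup>2" using R by (simp add: power2_eq_square)
      finally show "D * exp (K * t) \<le> R\<^sup>2" .
    qed simp
    finally show "(norm (\<phi> t))\<^sup>2 \<le> (R * norm (\<phi> 0))\<^sup>2" by (simp add: power_mult_distrib)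
  qed (use R in auto)
  show ?thesis
  proof (rule that[of R "\<rho> / R"])
    fix \<phi> S t assume S: "S \<le> T" and sol: "filippov_solution_compact N \<Omega> \<Sigma> f 0 S \<phi>" and init: "norm (\<phi> 0) < \<rho> / R"
      and t: "0 \<le> t" "t \<le> S"
    have init': "R * norm (\<phi> 0) < \<rho>" using init R by (simp add: field_simps)
    have sol': "filippov_solution_compact N \<Omega> \<Sigma> f 0 s \<phi>" if "s \<le> S" for s
      using solution_compact_subinterval[OF sol] that by auto
    have small: "norm (\<phi> s) < \<rho>" if s: "0 \<le> s" "s \<le> S" for s
    proof (rule ccontr)
      assume "\<not> norm (\<phi> s) < \<rho>"
      define Z where "Z = {t \<in> {0..S}. norm (\<phi> t) \<ge> \<rho>}"
      have "continuous_on {0..S} \<phi>"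
        using sol AC_imp_continuous_on unfolding solution_compact_iff by blast
      then have "closed Z" unfolding Z_def
        by (intro continuous_on_closed_Collect_le continuous_intros) auto
      moreover have "bounded Z" by (rule bounded_subset[of "{0..S}"]) (auto simp: Z_def)
      ultimately have "compact Z" by (simp add: compact_eq_bounded_closed)
      moreover have "Z \<noteq> {}" using s \<open>\<not> norm (\<phi> s) < \<rho>\<close> by (auto simp: Z_def)
      ultimately obtain t0 where t0: "t0 \<in> Z" "\<And>t. t \<in> Z \<Longrightarrow> t0 \<le> t"
        using compact_attains_inf by metis
      have "norm (\<phi> t0) \<le> R * norm (\<phi> 0)"
        using t0 S by (intro R2 sol') (force simp: Z_def)+
      then show False using t0(1) init' by (auto simp: Z_def)
    qed
    show "norm (\<phi> t) \<le> R * norm (\<phi> 0)"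
      using t S by (intro R2 sol' small) auto
  qed (use R pos in auto)
qed

text \<open>Write \<open>d = \<phi> - \<psi>\<close> and \<open>X = norm (\<phi> 0)\<close>. In the adapted quadratic form \<open>V\<close> the terms \<open>l\<^sub>1 c\<close> and \<open>l\<^sub>2 c\<close> are
dissipative, which leaves \<open>V' \<le> K V + O(X\<^sup>2) (\<epsilon> + l\<^sub>1 + l\<^sub>2)\<close>. The \<open>k\<close>-th component of the law of motion
bounds \<open>l\<^sub>1\<close> and \<open>l\<^sub>2\<close> by multiples of \<open>O(X) - \<phi>\<^sub>k'\<close> and \<open>O(X) - \<psi>\<^sub>k'\<close>, so the weights are absorbed by adding a
multiple of \<open>X\<^sup>2 (\<phi>\<^sub>k + \<psi>\<^sub>k) = O(X\<^sup>3)\<close> to \<open>V\<close>. Gronwall's inequality gives \<open>V \<le> X\<^sup>2 (P \<epsilon> + Q X)\<close>.\<close>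

lemma solutions_compare:
  assumes ce1: "crossing_estimate A c k (filippov_map N \<Omega>1 \<Sigma>1 f1)"
    and ce2: "crossing_estimate A c k (filippov_map N \<Omega>2 \<Sigma>2 f2)"
    and c: "c $ k < 0" and T: "T \<ge> 0" and \<eta>: "\<eta> > 0"
  obtains r where "r > 0"
    "\<And>\<phi> \<psi> S. 0 \<le> S \<Longrightarrow> S \<le> T \<Longrightarrow> filippov_solution_compact N \<Omega>1 \<Sigma>1 f1 0 S \<phi> \<Longrightarrow>
       filippov_solution_compact N \<Omega>2 \<Sigma>2 f2 0 S \<psi> \<Longrightarrow> \<phi> 0 = \<psi> 0 \<Longrightarrow> norm (\<phi> 0) < r \<Longrightarrow>
       norm (\<phi> S - \<psi> S) \<le> \<eta> * norm (\<phi> 0)"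
proof -
  let ?G1 = "filippov_map N \<Omega>1 \<Sigma>1 f1" and ?G2 = "filippov_map N \<Omega>2 \<Sigma>2 f2"
  interpret B: bounded_bilinear "proj_form k c" by (rule bounded_bilinear_proj_form)
  obtain b where b: "b > 0" "\<And>x y. norm (proj_form k c x y) \<le> norm x * norm y * b"
    using B.pos_bounded by blast
  obtain M where M: "M > 0" "\<And>x. (norm x)\<^sup>2 \<le> M * proj_form k c x x"
    using proj_form_coercive[of c k] c by auto
  obtain a where a: "a > 0" "\<And>x. norm (A *v x) \<le> a * norm x" using matrix_bound[of A] by blast
  obtain C1 where C1: "C1 \<ge> 0" and est1: "\<And>\<epsilon>. \<epsilon> > 0 \<Longrightarrow> \<exists>\<rho>>0. \<forall>x. norm x < \<rho> \<longrightarrow>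
     (\<forall>w\<in>?G1 x. crossing_velocity A c k \<epsilon> C1 x w)"
    using ce1 unfolding crossing_estimate_def by blast
  obtain C2 where C2: "C2 \<ge> 0" and est2: "\<And>\<epsilon>. \<epsilon> > 0 \<Longrightarrow> \<exists>\<rho>>0. \<forall>x. norm x < \<rho> \<longrightarrow>
     (\<forall>w\<in>?G2 x. crossing_velocity A c k \<epsilon> C2 x w)"
    using ce2 unfolding crossing_estimate_def by blast
  define C where "C = max C1 C2"
  have C: "C \<ge> 0" "C1 \<le> C" "C2 \<le> C" using C1 by (auto simp: C_def)
  obtain R1 r1 where R1: "R1 \<ge> 1" "r1 > 0" and close1:
    "\<And>\<phi> S t. S \<le> T \<Longrightarrow> filippov_solution_compact N \<Omega>1 \<Sigma>1 f1 0 S \<phi> \<Longrightarrow> norm (\<phi> 0) < r1 \<Longrightarrow>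
       0 \<le> t \<Longrightarrow> t \<le> S \<Longrightarrow> norm (\<phi> t) \<le> R1 * norm (\<phi> 0)"
    by (fact solutions_stay_close[OF ce1 c T])
  obtain R2 r2 where R2: "R2 \<ge> 1" "r2 > 0" and close2:
    "\<And>\<phi> S t. S \<le> T \<Longrightarrow> filippov_solution_compact N \<Omega>2 \<Sigma>2 f2 0 S \<phi> \<Longrightarrow> norm (\<phi> 0) < r2 \<Longrightarrow>
       0 \<le> t \<Longrightarrow> t \<le> S \<Longrightarrow> norm (\<phi> t) \<le> R2 * norm (\<phi> 0)"
    by (fact solutions_stay_close[OF ce2 c T])
  define R where "R = max R1 R2"
  have R: "R \<ge> 1" "R1 \<le> R" "R2 \<le> R" using R1 by (auto simp: R_def)
  define \<kappa> where "\<kappa> = - (c $ k)"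
  have \<kappa>: "\<kappa> > 0" using c by (simp add: \<kappa>_def)
  define K where "K = 2 * b * a * M"
  \<comment> \<open>\<open>K\<close> is the growth rate of \<open>V\<close>. The weights contribute \<open>\<beta> X\<^sup>2 \<kappa> (l\<^sub>1 + l\<^sub>2)\<close> to the
    bound for \<open>V'\<close>.\<close>
  define \<beta> where "\<beta> = 4 * b * R\<^sup>2 * C / \<kappa>"
  have K: "K \<ge> 0" and \<beta>: "\<beta> \<ge> 0" using a b M C \<kappa> by (auto simp: K_def \<beta>_def)
  define q where "q = 2 * K * \<beta> * R + 2 * \<beta> * (a + 1 + C) * R"
  have q: "q \<ge> 0" using K \<beta> R a C by (simp add: q_def)
  \<comment> \<open>The final estimate is \<open>(norm d)\<^sup>2 \<le> X\<^sup>2 (P \<epsilon> + Q X)\<close>; \<open>\<epsilon>\<close> and \<open>r\<close> make each summand at most \<open>\<eta>\<^sup>2 / 2\<close>.\<close>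
  define P where "P = M * (exp (K * T) * (T * (8 * b * R\<^sup>2)))"
  define Q where "Q = M * (exp (K * T) * (2 * \<beta> + T * q)) + M * (2 * \<beta> * R)"
  have P: "P \<ge> 0" and Q: "Q \<ge> 0" using M T b q \<beta> R by (auto simp: P_def Q_def)
  define \<epsilon> where "\<epsilon> = min 1 (\<eta>\<^sup>2 / (2 * (P + 1)))"
  have \<epsilon>: "\<epsilon> > 0" "\<epsilon> \<le> 1" "P * \<epsilon> \<le> \<eta>\<^sup>2 / 2"
  proof -
    show "\<epsilon> > 0" "\<epsilon> \<le> 1" using P \<eta> by (auto simp: \<epsilon>_def)
    have "P * \<epsilon> \<le> (P + 1) * (\<eta>\<^sup>2 / (2 * (P + 1)))"
      using P \<open>\<epsilon> > 0\<close> by (intro mult_mono) (auto simp: \<epsilon>_def)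
    also have "\<dots> = \<eta>\<^sup>2 / 2" using P by (simp add: field_simps)
    finally show "P * \<epsilon> \<le> \<eta>\<^sup>2 / 2" .
  qed
  obtain \<rho>1 where \<rho>1: "\<rho>1 > 0"
    and e1: "\<And>x w. norm x < \<rho>1 \<Longrightarrow> w \<in> ?G1 x \<Longrightarrow> crossing_velocity A c k \<epsilon> C1 x w"
    using est1[OF \<epsilon>(1)] by blast
  obtain \<rho>2 where \<rho>2: "\<rho>2 > 0"
    and e2: "\<And>x w. norm x < \<rho>2 \<Longrightarrow> w \<in> ?G2 x \<Longrightarrow> crossing_velocity A c k \<epsilon> C2 x w"
    using est2[OF \<epsilon>(1)] by blast
  define r where "r = min (min r1 r2) (min (min \<rho>1 \<rho>2 / R) (\<eta>\<^sup>2 / (2 * (Q + 1))))"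
  have r: "r > 0" using R1 R2 R \<rho>1 \<rho>2 \<eta> Q by (simp add: r_def)
  show ?thesis
  proof (rule that[OF r])
    fix \<phi> \<psi> S
    assume S: "0 \<le> S" "S \<le> T" and sol1: "filippov_solution_compact N \<Omega>1 \<Sigma>1 f1 0 S \<phi>"
      and sol2: "filippov_solution_compact N \<Omega>2 \<Sigma>2 f2 0 S \<psi>" and init: "\<phi> 0 = \<psi> 0" "norm (\<phi> 0) < r"
    define X where "X = norm (\<phi> 0)"
    have X: "X \<ge> 0" "X < r" using init by (auto simp: X_def)
    have XR: "R * X < \<rho>1" "R * X < \<rho>2"
    proof -
      have "X < min \<rho>1 \<rho>2 / R" using X by (simp add: r_def)
      then have "R * X < min \<rho>1 \<rho>2" using R by (simp add: field_simps)
      then show "R * X < \<rho>1" "R * X < \<rho>2" by auto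
    qed
    have XQ: "Q * X \<le> \<eta>\<^sup>2 / 2"
    proof -
      have "Q * X \<le> (Q + 1) * (\<eta>\<^sup>2 / (2 * (Q + 1)))"
        using Q X by (intro mult_mono) (auto simp: r_def)
      also have "\<dots> = \<eta>\<^sup>2 / 2" using Q by (simp add: field_simps)
      finally show ?thesis .
    qed
    have n1: "norm (\<phi> t) \<le> R * X" if "t \<in> {0..S}" for t
    proof -
      have "norm (\<phi> t) \<le> R1 * X" using close1[OF S(2) sol1, of t] that X by (auto simp: X_def r_def)
      also have "\<dots> \<le> R * X" using R X by (intro mult_right_mono) auto
      finally show ?thesis .
    qed
    have n2: "norm (\<psi> t) \<le> R * X" if "t \<in> {0..S}" for t
    proof -
      have "norm (\<psi> t) \<le> R2 * X" using close2[OF S(2) sol2, of t] that X init(1) by (auto simp: X_def r_def)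
      also have "\<dots> \<le> R * X" using R X by (intro mult_right_mono) auto
      finally show ?thesis .
    qed
    from sol1 obtain E1 where E1: "abs_continuous_on 0 S \<phi>" "negligible E1"
      "\<And>t. t\<in>{0..S} - E1 \<Longrightarrow> \<exists>w. (\<phi> has_vector_derivative w) (at t within {0..S}) \<and> w \<in> ?G1 (\<phi> t)"
      unfolding solution_compact_iff by blast
    from sol2 obtain E2 where E2: "abs_continuous_on 0 S \<psi>" "negligible E2"
      "\<And>t. t\<in>{0..S} - E2 \<Longrightarrow> \<exists>w. (\<psi> has_vector_derivative w) (at t within {0..S}) \<and> w \<in> ?G2 (\<psi> t)"
      unfolding solution_compact_iff by blast
    let ?d = "\<lambda>t. \<phi> t - \<psi> t"
    let ?V = "\<lambda>t. proj_form k c (?d t) (?d t)"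
    \<comment> \<open>The correction turns the terms in \<open>- (\<phi>\<^sub>k' + \<psi>\<^sub>k')\<close> that bound the weights into a derivative.\<close>
    let ?U = "\<lambda>t. ?V t + \<beta> * X\<^sup>2 * (\<phi> t $ k + \<psi> t $ k)"
    have ACd: "abs_continuous_on 0 S ?d"
    proof (rule AC_dominated[OF E1(1) E2(1), of 1])
      fix s t :: real assume "s \<le> t"
      then show "dist (?d s) (?d t) \<le> 1 * (dist (\<phi> s) (\<phi> t) + dist (\<psi> s) (\<psi> t) + (t - s))"
        using norm_triangle_ineq4[of "\<phi> s - \<phi> t" "\<psi> s - \<psi> t"] by (simp add: dist_norm algebra_simps)
    qed simp
    have ACs: "abs_continuous_on 0 S (\<lambda>t. \<phi> t $ k + \<psi> t $ k)"
    proof (rule AC_dominated[OF E1(1) E2(1), of 1])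
      fix s t :: real assume "s \<le> t"
      then show "dist (\<phi> s $ k + \<psi> s $ k) (\<phi> t $ k + \<psi> t $ k) \<le> 1 * (dist (\<phi> s) (\<phi> t) + dist (\<psi> s) (\<psi> t) + (t - s))"
        using component_le_norm_cart[of "\<phi> s - \<phi> t" k] component_le_norm_cart[of "\<psi> s - \<psi> t" k]
        by (simp add: dist_norm)
    qed simp
    have ACU: "abs_continuous_on 0 S ?U"
    proof (rule AC_dominated[OF AC_bilinear[OF bounded_bilinear_proj_form ACd] ACs, where L = "max 1 (\<beta> * X\<^sup>2)"])
      fix s t :: real assume st: "s \<le> t"
      have "\<bar>?U s - ?U t\<bar> \<le> 1 * \<bar>?V s - ?V t\<bar> + \<beta> * X\<^sup>2 * \<bar>(\<phi> s $ k + \<psi> s $ k) - (\<phi> t $ k + \<psi> t $ k)\<bar>"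
      proof -
        have "?U s - ?U t = (?V s - ?V t) + \<beta> * X\<^sup>2 * ((\<phi> s $ k + \<psi> s $ k) - (\<phi> t $ k + \<psi> t $ k))"
          by (simp add: algebra_simps)
        then have "\<bar>?U s - ?U t\<bar> \<le> \<bar>?V s - ?V t\<bar> + \<bar>\<beta> * X\<^sup>2 * ((\<phi> s $ k + \<psi> s $ k) - (\<phi> t $ k + \<psi> t $ k))\<bar>"
          by (metis abs_triangle_ineq)
        then show ?thesis using \<beta> by (simp add: abs_mult)
      qed
      also have "\<dots> \<le> max 1 (\<beta> * X\<^sup>2) * \<bar>?V s - ?V t\<bar> + max 1 (\<beta> * X\<^sup>2) * \<bar>(\<phi> s $ k + \<psi> s $ k) - (\<phi> t $ k + \<psi> t $ k)\<bar>"
        by (intro add_mono mult_right_mono) auto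
      also have "\<dots> \<le> max 1 (\<beta> * X\<^sup>2) * (\<bar>?V s - ?V t\<bar> + \<bar>(\<phi> s $ k + \<psi> s $ k) - (\<phi> t $ k + \<psi> t $ k)\<bar> + (t - s))"
        unfolding distrib_left[symmetric] using st by (intro mult_left_mono) auto
      finally show "dist (?U s) (?U t) \<le> max 1 (\<beta> * X\<^sup>2) * (dist (?V s) (?V t) + dist (\<phi> s $ k + \<psi> s $ k) (\<phi> t $ k + \<psi> t $ k) + (t - s))"
        unfolding dist_real_def .
    qed auto
    define Q' where "Q' = X\<^sup>2 * (8 * b * R\<^sup>2 * \<epsilon> + X * q)"
    have Q': "Q' \<ge> 0" using b \<epsilon> X q by (simp add: Q'_def)
    have VU: "?V t \<le> ?U t + 2 * \<beta> * R * X ^ 3" if "t \<in> {0..S}" for t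
    proof -
      have "\<bar>\<phi> t $ k\<bar> \<le> R * X" "\<bar>\<psi> t $ k\<bar> \<le> R * X"
        using component_le_norm_cart[of "\<phi> t" k] component_le_norm_cart[of "\<psi> t" k] n1[OF that] n2[OF that] by linarith+
      then have "- (2 * (R * X)) \<le> \<phi> t $ k + \<psi> t $ k" by linarith
      then have "\<beta> * X\<^sup>2 * (- (2 * (R * X))) \<le> \<beta> * X\<^sup>2 * (\<phi> t $ k + \<psi> t $ k)"
        using \<beta> by (intro mult_left_mono) auto
      then show ?thesis by (simp add: power2_eq_square power3_eq_cube algebra_simps)
    qed
    have "?U S \<le> exp (K * (S - 0)) * (?U 0 + Q' * (S - 0))"
    proof (rule AC_gronwall[OF S(1) ACU])
      show "negligible (E1 \<union> E2)" using E1(2) E2(2) by simp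
      fix t assume t: "t \<in> {0..S} - (E1 \<union> E2)"
      obtain w1 where w1: "(\<phi> has_vector_derivative w1) (at t within {0..S})" "w1 \<in> ?G1 (\<phi> t)"
        using E1(3)[of t] t by auto
      obtain w2 where w2: "(\<psi> has_vector_derivative w2) (at t within {0..S})" "w2 \<in> ?G2 (\<psi> t)"
        using E2(3)[of t] t by auto
      have small: "norm (\<phi> t) \<le> R * X" "norm (\<psi> t) \<le> R * X" using n1 n2 t by auto
      obtain l1 v1 where l1: "0 \<le> l1" "l1 \<le> 1" "\<phi> t $ k < 0 \<longrightarrow> l1 = 0" "\<phi> t $ k > 0 \<longrightarrow> l1 = 1"
        and w1eq: "w1 = A *v \<phi> t + l1 *\<^sub>R c + v1" and v1: "norm v1 \<le> (\<epsilon> + C1 * l1) * norm (\<phi> t)"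
        using e1[OF le_less_trans[OF small(1) XR(1)] w1(2)] unfolding crossing_velocity_def by blast
      obtain l2 v2 where l2: "0 \<le> l2" "l2 \<le> 1" "\<psi> t $ k < 0 \<longrightarrow> l2 = 0" "\<psi> t $ k > 0 \<longrightarrow> l2 = 1"
        and w2eq: "w2 = A *v \<psi> t + l2 *\<^sub>R c + v2" and v2: "norm v2 \<le> (\<epsilon> + C2 * l2) * norm (\<psi> t)"
        using e2[OF le_less_trans[OF small(2) XR(2)] w2(2)] unfolding crossing_velocity_def by blast
      have v1': "norm v1 \<le> (\<epsilon> + C * l1) * (R * X)"
        using v1 small C l1 \<epsilon> C1 by (elim order_trans) (intro mult_mono add_mono order_refl; simp)
      have v2': "norm v2 \<le> (\<epsilon> + C * l2) * (R * X)"
        using v2 small C l2 \<epsilon> C2 by (elim order_trans) (intro mult_mono add_mono order_refl; simp)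
      have RX: "R * X \<ge> 0" using R X by simp
      \<comment> \<open>A positive weight pushes the \<open>k\<close>-th coordinate down at rate \<open>\<kappa> l\<close>.\<close>
      have lam: "\<kappa> * l \<le> (a + 1 + C) * (R * X) - w $ k"
        if l: "0 \<le> l" "l \<le> 1" and w: "w = A *v x + l *\<^sub>R c + v" and v: "norm v \<le> (\<epsilon> + C * l) * (R * X)"
          and x: "norm x \<le> R * X" for l w x v
      proof -
        have "(A *v x) $ k \<le> a * (R * X)"
          using component_le_norm_cart[of "A *v x" k] a(2)[of x] mult_left_mono[OF x, of a] a(1) by linarith
        moreover have "v $ k \<le> (1 + C) * (R * X)"
        proof -
          have "v $ k \<le> norm v" using component_le_norm_cart[of v k] by linarith
          also have "\<dots> \<le> (\<epsilon> + C * l) * (R * X)" by (rule v)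
          also have "\<dots> \<le> (1 + C * 1) * (R * X)"
            using \<epsilon> l C RX by (intro mult_right_mono add_mono mult_left_mono) auto
          finally show ?thesis by simp
        qed
        moreover have "w $ k = (A *v x) $ k - \<kappa> * l + v $ k" unfolding w \<kappa>_def by (simp add: mult.commute)
        ultimately show ?thesis by (simp add: algebra_simps)
      qed
      have lsum: "l1 + l2 \<le> (2 * ((a + 1 + C) * (R * X)) - (w1 $ k + w2 $ k)) / \<kappa>"
        using lam[OF l1(1,2) w1eq v1' small(1)] lam[OF l2(1,2) w2eq v2' small(2)] \<kappa> by (simp add: field_simps)
      \<comment> \<open>The weights are monotone in the \<open>k\<close>-th coordinate, wherever the two points lie.\<close>
      have mono: "(l1 - l2) * (\<phi> t $ k - \<psi> t $ k) \<ge> 0"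
      proof (cases "\<phi> t $ k" "\<psi> t $ k" rule: linorder_cases)
        case less
        then have "l1 \<le> l2" using l1 l2 by (cases "\<phi> t $ k < 0") auto
        then show ?thesis using less by (intro mult_nonpos_nonpos) auto
      next
        case greater
        then have "l2 \<le> l1" using l1 l2 by (cases "\<psi> t $ k < 0") auto
        then show ?thesis using greater by (intro mult_nonneg_nonneg) auto
      qed simp
      have nd: "norm (?d t) \<le> 2 * (R * X)" using norm_triangle_ineq4[of "\<phi> t" "\<psi> t"] small by linarith
      have "w1 - w2 = A *v ?d t + (l1 - l2) *\<^sub>R c + (v1 - v2)"
        unfolding w1eq w2eq by (simp add: matrix_vector_mult_diff_distrib algebra_simps)
      then have "proj_form k c (?d t) (w1 - w2)
          = proj_form k c (?d t) (A *v ?d t) + (l1 - l2) * (c $ k * (?d t $ k)) + proj_form k c (?d t) (v1 - v2)"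
        using c by (simp add: B.add_right B.scaleR_right proj_form_direction)
      also have "\<dots> \<le> b * a * (M * ?V t) + 0 + b * (2 * (R * X)) * ((2 * \<epsilon> + C * (l1 + l2)) * (R * X))"
      proof (intro add_mono)
        have "proj_form k c (?d t) (A *v ?d t) \<le> norm (?d t) * norm (A *v ?d t) * b"
          using b(2)[of "?d t" "A *v ?d t"] by (simp add: abs_le_iff)
        also have "\<dots> \<le> norm (?d t) * (a * norm (?d t)) * b"
          using b(1) by (intro mult_right_mono mult_left_mono a) auto
        also have "\<dots> = b * a * (norm (?d t))\<^sup>2" by (simp add: power2_eq_square)
        also have "\<dots> \<le> b * a * (M * ?V t)" using a b by (intro mult_left_mono M) auto
        finally show "proj_form k c (?d t) (A *v ?d t) \<le> b * a * (M * ?V t)" .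
        have "c $ k * ((l1 - l2) * (\<phi> t $ k - \<psi> t $ k)) \<le> 0" using c mono by (intro mult_nonpos_nonneg) auto
        then show "(l1 - l2) * (c $ k * (?d t $ k)) \<le> 0" by (simp add: ac_simps)
        have "proj_form k c (?d t) (v1 - v2) \<le> norm (?d t) * norm (v1 - v2) * b"
          using b(2)[of "?d t" "v1 - v2"] by (simp add: abs_le_iff)
        also have "\<dots> \<le> (2 * (R * X)) * ((2 * \<epsilon> + C * (l1 + l2)) * (R * X)) * b"
        proof (intro mult_right_mono mult_mono nd)
          show "norm (v1 - v2) \<le> (2 * \<epsilon> + C * (l1 + l2)) * (R * X)"
            using norm_triangle_ineq4[of v1 v2] v1' v2' by (simp add: algebra_simps)
        qed (use RX b in auto)
        finally show "proj_form k c (?d t) (v1 - v2) \<le> b * (2 * (R * X)) * ((2 * \<epsilon> + C * (l1 + l2)) * (R * X))"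
          by (simp add: ac_simps)
      qed
      finally have main: "2 * proj_form k c (?d t) (w1 - w2)
          \<le> K * ?V t + 8 * b * R\<^sup>2 * X\<^sup>2 * \<epsilon> + 4 * b * R\<^sup>2 * X\<^sup>2 * C * (l1 + l2)"
        by (simp add: K_def power2_eq_square algebra_simps)
      have "4 * b * R\<^sup>2 * X\<^sup>2 * C * (l1 + l2)
          \<le> 4 * b * R\<^sup>2 * X\<^sup>2 * C * ((2 * ((a + 1 + C) * (R * X)) - (w1 $ k + w2 $ k)) / \<kappa>)"
        using b C by (intro mult_left_mono lsum) auto
      also have "\<dots> = \<beta> * X\<^sup>2 * (2 * ((a + 1 + C) * (R * X)) - (w1 $ k + w2 $ k))"
        by (simp add: \<beta>_def)
      also have "\<dots> = X ^ 3 * (2 * \<beta> * (a + 1 + C) * R) - \<beta> * X\<^sup>2 * (w1 $ k + w2 $ k)"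
        by (simp add: power2_eq_square power3_eq_cube algebra_simps)
      finally have main2: "2 * proj_form k c (?d t) (w1 - w2) + \<beta> * X\<^sup>2 * (w1 $ k + w2 $ k)
          \<le> K * ?V t + 8 * b * R\<^sup>2 * X\<^sup>2 * \<epsilon> + X ^ 3 * (2 * \<beta> * (a + 1 + C) * R)"
        using main by linarith
      have "K * ?V t \<le> K * (?U t + 2 * \<beta> * R * X ^ 3)"
        using VU[of t] t K by (intro mult_left_mono) auto
      then have "2 * proj_form k c (?d t) (w1 - w2) + \<beta> * X\<^sup>2 * (w1 $ k + w2 $ k)
         \<le> K * (?U t + 2 * \<beta> * R * X ^ 3) + 8 * b * R\<^sup>2 * X\<^sup>2 * \<epsilon> + X ^ 3 * (2 * \<beta> * (a + 1 + C) * R)"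
        using main2 by linarith
      also have "\<dots> = K * ?U t + Q'"
        by (simp add: Q'_def q_def power2_eq_square power3_eq_cube algebra_simps)
      finally have le: "2 * proj_form k c (?d t) (w1 - w2) + \<beta> * X\<^sup>2 * (w1 $ k + w2 $ k) \<le> K * ?U t + Q'" .
      have "(?d has_vector_derivative (w1 - w2)) (at t within {0..S})"
        using w1(1) w2(1) by (rule has_vector_derivative_diff)
      from proj_form_has_derivative[OF this]
      have dV: "(?V has_real_derivative 2 * proj_form k c (?d t) (w1 - w2)) (at t within {0..S})" .
      have comp: "((\<lambda>t. x t $ k) has_real_derivative w $ k) (at t within {0..S})"
        if "(x has_vector_derivative w) (at t within {0..S})" for x and w :: "real^'a"
        using bounded_linear.has_vector_derivative[OF bounded_linear_vec_nth that]
        by (simp add: has_real_derivative_iff_has_vector_derivative)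
      have "(?U has_real_derivative (2 * proj_form k c (?d t) (w1 - w2) + \<beta> * X\<^sup>2 * (w1 $ k + w2 $ k))) (at t within {0..S})"
        by (intro DERIV_add dV DERIV_cmult comp w1(1) w2(1))
      then show "\<exists>D\<le>K * ?U t + Q'. (?U has_real_derivative D) (at t within {0..S})" using le by blast
    qed (use K Q' in auto)
    also have "\<dots> \<le> exp (K * (S - 0)) * (2 * \<beta> * X ^ 3 + Q' * T)"
    proof (intro mult_left_mono add_mono)
      have "\<phi> 0 $ k \<le> X" using component_le_norm_cart[of "\<phi> 0" k] by (simp add: X_def)
      then have "\<beta> * X\<^sup>2 * (\<phi> 0 $ k + \<psi> 0 $ k) \<le> \<beta> * X\<^sup>2 * (2 * X)"
        using \<beta> init by (intro mult_left_mono) auto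
      then show "?U 0 \<le> 2 * \<beta> * X ^ 3" using init by (simp add: B.zero_left power2_eq_square power3_eq_cube ac_simps)
    qed (use S K Q' in auto)
    also have "\<dots> \<le> exp (K * T) * (2 * \<beta> * X ^ 3 + Q' * T)"
      using S K Q' \<beta> X T by (intro mult_right_mono) (auto intro!: mult_left_mono add_nonneg_nonneg mult_nonneg_nonneg)
    finally have "?U S \<le> exp (K * T) * (2 * \<beta> * X ^ 3 + Q' * T)" .
    then have "?V S \<le> exp (K * T) * (2 * \<beta> * X ^ 3 + Q' * T) + 2 * \<beta> * R * X ^ 3"
      using VU[of S] S by auto
    then have "M * ?V S \<le> M * (exp (K * T) * (2 * \<beta> * X ^ 3 + Q' * T) + 2 * \<beta> * R * X ^ 3)"
      using M by (intro mult_left_mono) auto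
    also have "\<dots> = X\<^sup>2 * (P * \<epsilon> + Q * X)"
      by (simp add: P_def Q_def Q'_def power2_eq_square power3_eq_cube algebra_simps)
    also have "\<dots> \<le> X\<^sup>2 * (\<eta>\<^sup>2 / 2 + \<eta>\<^sup>2 / 2)"
      by (intro mult_left_mono add_mono \<epsilon> XQ) auto
    also have "\<dots> = (\<eta> * X)\<^sup>2" by (simp add: power_mult_distrib)
    finally have "(norm (\<phi> S - \<psi> S))\<^sup>2 \<le> (\<eta> * X)\<^sup>2" using M(2)[of "\<phi> S - \<psi> S"] by linarith
    then show "norm (\<phi> S - \<psi> S) \<le> \<eta> * norm (\<phi> 0)"
      unfolding X_def[symmetric] by (rule power2_le_imp_le) (use \<eta> X in auto)
  qed
qed

section \<open>Closed convex hulls and the Filippov map\<close>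

lemma closed_convex_hull_basics:
  shows "closed (closed_convex_hull U)" "convex (closed_convex_hull U)" "U \<subseteq> closed_convex_hull U"
proof -
  have *: "closed (closed_convex_hull U) \<and> convex (closed_convex_hull U)"
    unfolding closed_convex_hull_def by (rule hull_in) (auto intro: closed_Inter convex_Inter)
  then show "closed (closed_convex_hull U)" "convex (closed_convex_hull U)" by auto
  show "U \<subseteq> closed_convex_hull U" unfolding closed_convex_hull_def by (rule hull_subset)
qed

lemma closed_convex_hull_minimal:
  "U \<subseteq> C \<Longrightarrow> closed C \<Longrightarrow> convex C \<Longrightarrow> closed_convex_hull U \<subseteq> C"
  unfolding closed_convex_hull_def by (rule hull_minimal) auto

lemma is_norm_bounds:
  fixes N :: "'a::euclidean_space \<Rightarrow> real"
  assumes "is_norm N"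
  obtains m M where "m > 0" "M > 0" "\<And>x. m * norm x \<le> N x" "\<And>x. N x \<le> M * norm x"
proof -
  have N0: "\<And>x. 0 \<le> N x" and Nz: "\<And>x. N x = 0 \<longleftrightarrow> x = 0" and Ns: "\<And>r x. N (r *\<^sub>R x) = \<bar>r\<bar> * N x"
    and Nt: "\<And>x y. N (x + y) \<le> N x + N y" using assms unfolding is_norm_def by auto
  have Nsum: "N (sum g B) \<le> (\<Sum>b\<in>B. N (g b))" if "finite B" for g and B :: "'a set"
    using that
  proof induction
    case empty
    then show ?case using Nz[of 0] by simp
  next
    case (insert b B)
    then show ?case using Nt[of "g b" "sum g B"] by simp
  qed
  define M where "M = 1 + (\<Sum>b\<in>Basis. N (b::'a))"
  have M: "M > 0" using N0 by (simp add: M_def sum_nonneg add_pos_nonneg)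
  have up: "N x \<le> M * norm x" for x
  proof -
    have "N x = N (\<Sum>b\<in>Basis. (x \<bullet> b) *\<^sub>R b)" by (simp add: euclidean_representation)
    also have "\<dots> \<le> (\<Sum>b\<in>Basis. N ((x \<bullet> b) *\<^sub>R b))" by (rule Nsum) simp
    also have "\<dots> \<le> (\<Sum>b\<in>Basis. norm x * N b)"
      unfolding Ns by (intro sum_mono mult_right_mono N0 Basis_le_norm)
    also have "\<dots> = norm x * (\<Sum>b\<in>Basis. N (b::'a))" by (rule sum_distrib_left[symmetric])
    also have "\<dots> \<le> M * norm x" by (simp add: M_def algebra_simps)
    finally show ?thesis .
  qed
  have lip: "\<bar>N x - N y\<bar> \<le> M * norm (x - y)" for x y
  proof -
    have "N x \<le> N y + N (x - y)" "N y \<le> N x + N (y - x)" using Nt[of y "x - y"] Nt[of x "y - x"] by auto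
    then show ?thesis using up[of "x - y"] up[of "y - x"] by (simp add: norm_minus_commute abs_le_iff)
  qed
  have "M-lipschitz_on UNIV N"
    by (rule lipschitz_onI) (use lip M in \<open>auto simp: dist_norm\<close>)
  then have cont: "continuous_on (sphere 0 1) N"
    using lipschitz_on_continuous_on continuous_on_subset by blast
  obtain b :: 'a where "b \<in> Basis" using nonempty_Basis by blast
  then have "b \<in> sphere 0 1" by simp
  then obtain y where y: "y \<in> sphere 0 1" "\<And>x. x \<in> sphere 0 1 \<Longrightarrow> N y \<le> N x"
    using continuous_attains_inf[OF compact_sphere _ cont] by blast
  have "y \<noteq> 0" using y(1) by auto
  then have pos: "N y > 0" using N0 Nz by (metis less_eq_real_def)
  have "N y * norm x \<le> N x" for x
  proof (cases "x = 0")
    case False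
    have "N y \<le> N ((1 / norm x) *\<^sub>R x)" by (rule y(2)) (use False in simp)
    then show ?thesis using False by (simp add: Ns field_simps)
  qed (use N0 in simp)
  then show ?thesis using that pos M up by blast
qed

text \<open>Norm equivalence: both families of balls shrink to the point and each refines the other.\<close>

lemma filippov_map_ball:
  assumes "is_norm N"
  shows "filippov_map N \<Omega> \<Sigma> f x = (\<Inter>\<delta>\<in>{0<..}. closed_convex_hull (f ` (ball x \<delta> \<inter> (\<Omega> - \<Sigma>))))"
proof -
  obtain m M where mM: "m > 0" "M > 0" "\<And>x. m * norm x \<le> N x" "\<And>x. N x \<le> M * norm x"
    by (fact is_norm_bounds[OF assms])
  have mono: "closed_convex_hull (f ` (U \<inter> S)) \<subseteq> closed_convex_hull (f ` (V \<inter> S))" if "U \<subseteq> V" for U V S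
    using that by (intro closed_convex_hull_minimal closed_convex_hull_basics)
      (meson Int_mono closed_convex_hull_basics(3) image_mono order_refl order_trans)
  have 1: "norm_ball N x (m * \<delta>) \<subseteq> ball x \<delta>" for \<delta>
  proof
    fix y assume "y \<in> norm_ball N x (m * \<delta>)"
    then have "m * norm (x - y) < m * \<delta>" using mM(3)[of "x - y"] by (simp add: norm_ball_def)
    then show "y \<in> ball x \<delta>" using mM(1) by (simp add: dist_norm)
  qed
  have 2: "ball x (\<delta> / M) \<subseteq> norm_ball N x \<delta>" for \<delta>
  proof
    fix y assume "y \<in> ball x (\<delta> / M)"
    then have "M * norm (x - y) < \<delta>" using mM(2) by (simp add: dist_norm field_simps)
    then show "y \<in> norm_ball N x \<delta>" using mM(4)[of "x - y"] by (simp add: norm_ball_def)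
  qed
  show ?thesis unfolding filippov_map_def
  proof (intro antisym INT_greatest)
    fix \<delta> :: real assume "\<delta> \<in> {0<..}"
    then have "m * \<delta> \<in> {0<..}" using mM by simp
    then show "(\<Inter>\<delta>\<in>{0<..}. closed_convex_hull (f ` (norm_ball N x \<delta> \<inter> (\<Omega> - \<Sigma>)))) \<subseteq> closed_convex_hull (f ` (ball x \<delta> \<inter> (\<Omega> - \<Sigma>)))"
      using mono[OF 1[of \<delta>]] by blast
  next
    fix \<delta> :: real assume "\<delta> \<in> {0<..}"
    then have "\<delta> / M \<in> {0<..}" using mM by simp
    then show "(\<Inter>\<delta>\<in>{0<..}. closed_convex_hull (f ` (ball x \<delta> \<inter> (\<Omega> - \<Sigma>)))) \<subseteq> closed_convex_hull (f ` (norm_ball N x \<delta> \<inter> (\<Omega> - \<Sigma>)))"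
      using mono[OF 2[of \<delta>]] by blast
  qed
qed

section \<open>Limits of Euler polygons\<close>

text \<open>The function that has the value \<open>X j\<close> at time \<open>j h\<close> and then moves with velocity \<open>V j\<close>. It is continuous if
\<open>X (Suc j) = X j + h V j\<close>.\<close>

definition polygon :: "real \<Rightarrow> (nat \<Rightarrow> 'a::real_vector) \<Rightarrow> (nat \<Rightarrow> 'a) \<Rightarrow> real \<Rightarrow> 'a" where
  "polygon h X V t = X (nat \<lfloor>t / h\<rfloor>) + (t - real (nat \<lfloor>t / h\<rfloor>) * h) *\<^sub>R V (nat \<lfloor>t / h\<rfloor>)"

lemma polygon_node: "h > 0 \<Longrightarrow> polygon h X V (real j * h) = X j"
  unfolding polygon_def by simp

lemma floor_step:
  fixes s h :: real
  assumes "h > 0" "s \<ge> 0"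
  shows "real (nat \<lfloor>s / h\<rfloor>) * h \<le> s" "s < (real (nat \<lfloor>s / h\<rfloor>) + 1) * h"
proof -
  have eq: "real (nat \<lfloor>s / h\<rfloor>) = real_of_int \<lfloor>s / h\<rfloor>" using assms by simp
  show "real (nat \<lfloor>s / h\<rfloor>) * h \<le> s"
    unfolding eq by (rule pos_le_divide_eq[THEN iffD1, OF assms(1) of_int_floor_le])
  have "s / h < real_of_int \<lfloor>s / h\<rfloor> + 1" by linarith
  then show "s < (real (nat \<lfloor>s / h\<rfloor>) + 1) * h"
    unfolding eq by (rule pos_divide_less_eq[THEN iffD1, OF assms(1)])
qed

text \<open>The mean velocity over an interval is a convex combination of the velocities in use there. The
interval of admitted nodes begins at \<open>s - h\<close> because the step in progress at time \<open>s\<close> may have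
started earlier.\<close>

lemma polygon_increment:
  assumes h: "h > 0" and X: "\<And>j. X (Suc j) = X j + h *\<^sub>R V j" and C: "convex C"
    and st: "0 \<le> s" "s < t"
    and V: "\<And>j. s - h < real j * h \<Longrightarrow> real j * h \<le> t \<Longrightarrow> V j \<in> C"
  shows "\<exists>v\<in>C. polygon h X V t - polygon h X V s = (t - s) *\<^sub>R v"
  using st V
proof (induction "nat \<lfloor>t / h\<rfloor> - nat \<lfloor>s / h\<rfloor>" arbitrary: s rule: less_induct)
  case less
  define m where "m = nat \<lfloor>s / h\<rfloor>"
  have m: "real m * h \<le> s" "s < (real m + 1) * h" unfolding m_def using floor_step[OF h less.prems(1)] by auto
  have nt: "real (nat \<lfloor>t / h\<rfloor>) * h \<le> t" "t < (real (nat \<lfloor>t / h\<rfloor>) + 1) * h"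
    using floor_step[OF h, of t] less.prems by auto
  have Vm: "V m \<in> C" using less.prems(2,3) m by (intro less.prems(3)) (auto simp: algebra_simps)
  show ?case
  proof (cases "t < (real m + 1) * h")
    case True
    have "nat \<lfloor>t / h\<rfloor> = m"
    proof -
      have "real m \<le> t / h" "t / h < real m + 1" using True m less.prems h by (auto simp: field_simps)
      then show ?thesis by (simp add: floor_eq_iff nat_eq_iff)
    qed
    then have "polygon h X V t - polygon h X V s = (t - s) *\<^sub>R V m"
      unfolding polygon_def m_def[symmetric] by (simp add: algebra_simps)
    then show ?thesis using Vm by blast
  next
    case False
    define u where "u = real (Suc m) * h"
    have u: "s < u" "u \<le> t" "u - s \<le> h" using m False by (auto simp: u_def algebra_simps)
    have pu: "polygon h X V u - polygon h X V s = (u - s) *\<^sub>R V m"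
    proof -
      have 1: "polygon h X V u = X m + h *\<^sub>R V m" unfolding u_def polygon_node[OF h] by (rule X)
      have 2: "polygon h X V s = X m + (s - real m * h) *\<^sub>R V m" unfolding polygon_def m_def[symmetric] by (rule refl)
      have "u = real m * h + h" by (simp add: u_def algebra_simps)
      then show ?thesis unfolding 1 2 by (simp add: algebra_simps)
    qed
    show ?thesis
    proof (cases "u = t")
      case True
      then show ?thesis using pu Vm by blast
    next
      case False
      have "nat \<lfloor>u / h\<rfloor> = Suc m" unfolding u_def using h by simp
      moreover have "Suc m \<le> nat \<lfloor>t / h\<rfloor>"
        using u(2) h unfolding u_def by (simp add: le_nat_floor field_simps)
      ultimately have "nat \<lfloor>t / h\<rfloor> - nat \<lfloor>u / h\<rfloor> < nat \<lfloor>t / h\<rfloor> - nat \<lfloor>s / h\<rfloor>"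
        unfolding m_def[symmetric] by (metis Suc_le_lessD diff_less_mono2 lessI)
      moreover have "0 \<le> u" "u < t" using u False less.prems by auto
      ultimately have "\<exists>v\<in>C. polygon h X V t - polygon h X V u = (t - u) *\<^sub>R v"
        using u less.prems(3) by (intro less.hyps) auto
      then obtain v where v: "v \<in> C" "polygon h X V t - polygon h X V u = (t - u) *\<^sub>R v" by blast
      define \<theta> where "\<theta> = (u - s) / (t - s)"
      have "0 \<le> \<theta>" "\<theta> \<le> 1" using u less.prems(2) by (auto simp: \<theta>_def)
      then have "\<theta> *\<^sub>R V m + (1 - \<theta>) *\<^sub>R v \<in> C"
        using C Vm v(1) by (intro convexD) auto
      moreover have "(t - s) *\<^sub>R (\<theta> *\<^sub>R V m + (1 - \<theta>) *\<^sub>R v) = (u - s) *\<^sub>R V m + (t - u) *\<^sub>R v"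
      proof -
        have "(t - s) * \<theta> = u - s" "(t - s) * (1 - \<theta>) = t - u" using less.prems(2) by (auto simp: \<theta>_def field_simps)
        then show ?thesis by (simp add: scaleR_add_right)
      qed
      moreover have "polygon h X V t - polygon h X V s = (u - s) *\<^sub>R V m + (t - u) *\<^sub>R v"
        using pu v(2) by (metis add_diff_eq diff_add_cancel add.commute)
      ultimately show ?thesis by metis
    qed
  qed
qed

text \<open>Arzela-Ascoli for the polygons with steps \<open>1/(m+1)\<close>, whose slopes are values of \<open>f\<close> at points of
\<open>S\<close> within one step size of the nodes. Over a short time interval around \<open>t\<close> all slopes come from
points close to \<open>x t\<close>, hence lie in the hull, and so do the mean velocities; closedness passes
this on to the limit. The conclusion is about increments and leaves open whether the limit is
differentiable.\<close>

lemma euler_limit: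
  fixes f :: "'a::euclidean_space \<Rightarrow> 'a"
  assumes r: "r > 0" and bound: "\<forall>x\<in>S. dist x0 x < 2 * r \<longrightarrow> norm (f x) \<le> M"
    and dense: "cball x0 r \<subseteq> closure S" and M: "M > 0" and \<tau>: "\<tau> > 0" "M * \<tau> \<le> r"
  obtains x where "M-lipschitz_on {0..\<tau>} x" "x 0 = x0" "x ` {0..\<tau>} \<subseteq> cball x0 r"
    "\<And>t \<delta>. t \<in> {0..\<tau>} \<Longrightarrow> \<delta> > 0 \<Longrightarrow> \<exists>\<eta>>0. \<forall>s s'. 0 \<le> s \<and> s < s' \<and> s' \<le> \<tau> \<and> \<bar>s - t\<bar> < \<eta> \<and> \<bar>s' - t\<bar> < \<eta>
       \<longrightarrow> (\<exists>v\<in>closed_convex_hull (f ` (ball (x t) \<delta> \<inter> S)). x s' - x s = (s' - s) *\<^sub>R v)"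
proof -
  define Y where "Y e x = (SOME y. y \<in> S \<and> dist y x < e)" for e x
  have Y: "Y e x \<in> S \<and> dist (Y e x) x < e" if "x \<in> cball x0 r" "e > 0" for x e
    unfolding Y_def using dense that closure_approachable[of x S] by (intro someI_ex[of "\<lambda>y. y \<in> S \<and> dist y x < e"]) blast
  define h where "h m = 1 / real (Suc m)" for m
  have h: "h m > 0" for m by (simp add: h_def)
  \<comment> \<open>The value \<open>0\<close> outside the ball only serves to make the velocities bounded everywhere; the
    polygons never leave the ball before time \<open>\<tau>\<close>.\<close>
  define vel where "vel m x = (if x \<in> cball x0 r then f (Y (min r (h m)) x) else 0)" for m x
  have velM: "norm (vel m x) \<le> M" for m x
  proof (cases "x \<in> cball x0 r")
    case True
    have "Y (min r (h m)) x \<in> S" "dist (Y (min r (h m)) x) x < r" using Y[OF True, of "min r (h m)"] r h[of m] by auto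
    moreover have "dist x0 x \<le> r" using True by simp
    ultimately show ?thesis using bound[rule_format, of "Y (min r (h m)) x"] True dist_triangle[of x0 "Y (min r (h m)) x" x]
      by (simp add: vel_def dist_commute)
  qed (use M in \<open>simp add: vel_def\<close>)
  define X where "X m = rec_nat x0 (\<lambda>_ x. x + h m *\<^sub>R vel m x)" for m
  define V where "V m j = vel m (X m j)" for m j
  have X0: "X m 0 = x0" and XS: "X m (Suc j) = X m j + h m *\<^sub>R V m j" for m j by (auto simp: X_def V_def)
  define p where "p m = polygon (h m) (X m) (V m)" for m
  have p0: "p m 0 = x0" for m using polygon_node[OF h, of m "X m" "V m" 0] X0 by (simp add: p_def)
  have plip: "norm (p m t - p m s) \<le> M * (t - s)" if st: "0 \<le> s" "s \<le> t" for m s t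
  proof (cases "s = t")
    case False
    have "V m j \<in> cball 0 M" for j using velM by (simp add: V_def)
    then obtain v where "v \<in> cball 0 M" "p m t - p m s = (t - s) *\<^sub>R v"
      using polygon_increment[where h = "h m" and X = "X m" and V = "V m", OF h XS, of "cball 0 M" s t] False st
      unfolding p_def by auto
    then show ?thesis using st mult_left_mono[of "norm v" M "t - s"] by (simp add: mult.commute)
  qed simp
  have plip': "norm (p m t - p m s) \<le> M * \<bar>t - s\<bar>" if "0 \<le> s" "0 \<le> t" for m s t
    using plip[of s t m] plip[of t s m] that by (cases "s \<le> t") (auto simp: norm_minus_commute)
  have pball: "p m t \<in> cball x0 r" if "t \<in> {0..\<tau>}" for m t
  proof -
    have "norm (p m t - p m 0) \<le> M * t" using plip[of 0 t m] that by simp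
    also have "\<dots> \<le> M * \<tau>" using that M by simp
    finally show ?thesis using \<tau> p0 by (simp add: dist_norm norm_minus_commute)
  qed
  have "\<exists>g k. continuous_on {0..\<tau>} g \<and> strict_mono (k :: nat \<Rightarrow> nat) \<and>
          (\<forall>e>0. \<exists>N. \<forall>n t. n \<ge> N \<and> t \<in> {0..\<tau>} \<longrightarrow> norm (p (k n) t - g t) < e)"
  proof (rule Arzela_Ascoli[of "{0..\<tau>}" p "norm x0 + r"])
    show "norm (p m t) \<le> norm x0 + r" if "t \<in> {0..\<tau>}" for m t
      using pball[OF that, of m] norm_triangle_sub[of "p m t" x0] by (simp add: dist_norm norm_minus_commute)
    show "\<exists>d>0. \<forall>n s. s \<in> {0..\<tau>} \<and> norm (t - s) < d \<longrightarrow> norm (p n t - p n s) < e" if t: "t \<in> {0..\<tau>}" "0 < e" for t e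
    proof (intro exI[of _ "e / M"] conjI allI impI)
      fix n s assume s: "s \<in> {0..\<tau>} \<and> norm (t - s) < e / M"
      have "norm (p n t - p n s) \<le> M * \<bar>t - s\<bar>" using plip' s t by auto
      also have "\<dots> < e" using s M by (simp add: field_simps)
      finally show "norm (p n t - p n s) < e" .
    qed (use t M in auto)
  next
    fix g k assume "continuous_on {0..\<tau>} g" "strict_mono (k :: nat \<Rightarrow> nat)"
      "\<And>e. 0 < e \<Longrightarrow> \<exists>N. \<forall>n x. N \<le> n \<and> x \<in> {0..\<tau>} \<longrightarrow> norm (p (k n) x - g x) < e"
    then show ?thesis by blast
  qed auto
  then obtain g k where k: "strict_mono (k :: nat \<Rightarrow> nat)"
    and unif: "\<And>e. e > 0 \<Longrightarrow> \<exists>N. \<forall>n t. n \<ge> N \<and> t \<in> {0..\<tau>} \<longrightarrow> norm (p (k n) t - g t) < e"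
    by blast
  have lim: "(\<lambda>n. p (k n) t) \<longlonglongrightarrow> g t" if "t \<in> {0..\<tau>}" for t
    unfolding LIMSEQ_iff using unif that by blast
  have hlim: "\<exists>N. \<forall>n\<ge>N. h (k n) < e" if "e > 0" for e
  proof -
    have "h \<longlonglongrightarrow> 0" unfolding h_def using LIMSEQ_Suc[OF lim_1_over_n] by simp
    then have "(h \<circ> k) \<longlonglongrightarrow> 0" using k by (rule LIMSEQ_subseq_LIMSEQ)
    then have "eventually (\<lambda>n. h (k n) < e) sequentially"
      using order_tendstoD(2)[of "h \<circ> k" 0 sequentially e] that by simp
    then show ?thesis by (simp add: eventually_sequentially)
  qed
  show ?thesis
  proof (rule that[of g])
    show "M-lipschitz_on {0..\<tau>} g"
    proof (rule lipschitz_onI)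
      fix s t assume st: "s \<in> {0..\<tau>}" "t \<in> {0..\<tau>}"
      have "(\<lambda>n. dist (p (k n) s) (p (k n) t)) \<longlonglongrightarrow> dist (g s) (g t)"
        by (intro tendsto_dist lim st)
      then show "dist (g s) (g t) \<le> M * dist s t"
        by (rule LIMSEQ_le_const2) (use plip' st in \<open>auto simp: dist_norm\<close>)
    qed (use M in simp)
    show "g 0 = x0"
      using LIMSEQ_unique[OF lim[of 0], of x0] \<tau> by (simp add: p0)
    show "g ` {0..\<tau>} \<subseteq> cball x0 r"
      using Lim_in_closed_set[OF closed_cball _ _ lim] pball by fastforce
    fix t \<delta> assume t: "t \<in> {0..\<tau>}" and \<delta>: "\<delta> > (0::real)"
    let ?C = "closed_convex_hull (f ` (ball (g t) \<delta> \<inter> S))"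
    \<comment> \<open>A relevant node is within time \<open>2 \<eta>\<close> of \<open>t\<close>, hence within \<open>\<delta> / 4\<close> in space; the distances from polygon
      to limit and from node to evaluation point add less than \<open>\<delta> / 4\<close> each.\<close>
    define \<eta> where "\<eta> = \<delta> / (8 * M)"
    have \<eta>: "\<eta> > 0" using \<delta> M by (simp add: \<eta>_def)
    show "\<exists>\<eta>>0. \<forall>s s'. 0 \<le> s \<and> s < s' \<and> s' \<le> \<tau> \<and> \<bar>s - t\<bar> < \<eta> \<and> \<bar>s' - t\<bar> < \<eta>
       \<longrightarrow> (\<exists>v\<in>?C. g s' - g s = (s' - s) *\<^sub>R v)"
    proof (intro exI[of _ \<eta>] conjI \<eta> allI impI)
      fix s s' assume s: "0 \<le> s \<and> s < s' \<and> s' \<le> \<tau> \<and> \<bar>s - t\<bar> < \<eta> \<and> \<bar>s' - t\<bar> < \<eta>"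
      obtain N1 where N1: "\<And>n. n \<ge> N1 \<Longrightarrow> h (k n) < min \<eta> (\<delta> / 4)" using hlim[of "min \<eta> (\<delta> / 4)"] \<eta> \<delta> by auto
      obtain N2 where N2: "\<And>n t. n \<ge> N2 \<Longrightarrow> t \<in> {0..\<tau>} \<Longrightarrow> norm (p (k n) t - g t) < \<delta> / 4" using unif[of "\<delta> / 4"] \<delta> by auto
      have step: "(p (k n) s' - p (k n) s) /\<^sub>R (s' - s) \<in> ?C" if n: "n \<ge> max N1 N2" for n
      proof -
        have V: "V (k n) j \<in> ?C" if j: "s - h (k n) < real j * h (k n)" "real j * h (k n) \<le> s'" for j
        proof -
          let ?u = "real j * h (k n)"
          have u: "?u \<in> {0..\<tau>}" using j s h[of "k n"] by auto
          have ut: "\<bar>?u - t\<bar> < 2 * \<eta>" using j s N1[of n] n by auto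
          have "X (k n) j = p (k n) ?u" unfolding p_def using polygon_node[OF h] by metis
          then have Xb: "X (k n) j \<in> cball x0 r" using pball[OF u] by metis
          let ?y = "Y (min r (h (k n))) (X (k n) j)"
          have y: "?y \<in> S" "dist ?y (X (k n) j) < \<delta> / 4" using Y[OF Xb, of "min r (h (k n))"] r h[of "k n"] N1[of n] n by auto
          have "norm (p (k n) ?u - p (k n) t) \<le> M * \<bar>?u - t\<bar>" using plip' u t by auto
          also have "\<dots> \<le> M * (2 * \<eta>)" using ut M by (intro mult_left_mono) auto
          also have "\<dots> = \<delta> / 4" using M by (simp add: \<eta>_def)
          finally have "dist (X (k n) j) (p (k n) t) \<le> \<delta> / 4" using \<open>X (k n) j = p (k n) ?u\<close> by (simp add: dist_norm)
          moreover have "dist (p (k n) t) (g t) < \<delta> / 4" using N2[of n t] n t by (simp add: dist_norm)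
          ultimately have "dist ?y (g t) < \<delta>"
            using y(2) dist_triangle[of ?y "g t" "X (k n) j"] dist_triangle[of "X (k n) j" "g t" "p (k n) t"] \<delta> by linarith
          then have "f ?y \<in> f ` (ball (g t) \<delta> \<inter> S)" using y(1) by (auto simp: dist_commute)
          moreover have "V (k n) j = f ?y" using Xb by (simp add: V_def vel_def)
          ultimately show ?thesis by (metis closed_convex_hull_basics(3) subsetD)
        qed
        obtain v where "v \<in> ?C" "p (k n) s' - p (k n) s = (s' - s) *\<^sub>R v"
          using polygon_increment[where h = "h (k n)" and X = "X (k n)" and V = "V (k n)", OF h XS closed_convex_hull_basics(2), of s s' "f ` (ball (g t) \<delta> \<inter> S)"] V s unfolding p_def by blast
        then show ?thesis using s by simp
      qed
      have "(\<lambda>n. (p (k n) s' - p (k n) s) /\<^sub>R (s' - s)) \<longlonglongrightarrow> (g s' - g s) /\<^sub>R (s' - s)"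
        by (intro tendsto_intros lim) (use s in auto)
      then have "(g s' - g s) /\<^sub>R (s' - s) \<in> ?C"
      proof (rule Lim_in_closed_set[OF closed_convex_hull_basics(1), rotated 2])
        show "eventually (\<lambda>n. (p (k n) s' - p (k n) s) /\<^sub>R (s' - s) \<in> ?C) sequentially"
          unfolding eventually_sequentially using step by blast
      qed simp
      then show "\<exists>v\<in>?C. g s' - g s = (s' - s) *\<^sub>R v"
        using s by (intro bexI[of _ "(g s' - g s) /\<^sub>R (s' - s)"]) auto
    qed
  qed
qed

section \<open>Zero sets of Lipschitz functions\<close>

text \<open>Lebesgue density of a closed set, seen from the right: with \<open>z\<close> the last point of \<open>Z\<close> up to \<open>t + h\<close>, the gap
between \<open>z\<close> and \<open>t + h\<close> belongs to the complement of \<open>Z\<close>, which has density \<open>0\<close> at almost every \<open>t \<in> Z\<close>.\<close>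

lemma density_right:
  fixes Z :: "real set"
  assumes "closed Z"
  obtains E where "negligible E"
    "\<And>t e. t \<in> Z - E \<Longrightarrow> e > 0 \<Longrightarrow> \<exists>d>0. \<forall>h. 0 < h \<and> h < d \<longrightarrow> (\<exists>z\<in>Z. t \<le> z \<and> z \<le> t + h \<and> t + h - z \<le> e * h)"
proof -
  define f :: "real \<Rightarrow> real" where "f = indicator Z"
  have int: "f integrable_on cbox a b" for a b
  proof -
    have "Z \<inter> cbox a b \<in> lmeasurable" by (intro bounded_set_imp_lmeasurable) (use assms in auto)
    then have "(indicator (Z \<inter> cbox a b) :: real \<Rightarrow> real) integrable_on UNIV"
      by (simp add: integrable_on_indicator)
    moreover have "(\<lambda>x. if x \<in> cbox a b then f x else 0) = indicator (Z \<inter> cbox a b)"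
      by (auto simp: f_def indicator_def fun_eq_iff)
    ultimately show ?thesis using integrable_restrict_UNIV by metis
  qed
  obtain E where E: "negligible E" "\<And>x e. \<lbrakk>x \<notin> E; 0 < e\<rbrakk> \<Longrightarrow>
       \<exists>d>0. \<forall>h. 0 < h \<and> h < d \<longrightarrow> norm (integral (cbox x (x + h *\<^sub>R One)) f /\<^sub>R h ^ DIM(real) - f x) < e"
    using integrable_ccontinuous_explicit[of f, OF int] by blast
  show ?thesis
  proof (rule that[OF E(1)])
    fix t e :: real assume t: "t \<in> Z - E" and e: "e > 0"
    then obtain d where d: "d > 0" "\<And>h. 0 < h \<Longrightarrow> h < d \<Longrightarrow> \<bar>integral {t..t + h} f / h - 1\<bar> < e"
      using E(2)[of t e] by (auto simp: f_def divide_inverse mult.commute)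
    show "\<exists>d>0. \<forall>h. 0 < h \<and> h < d \<longrightarrow> (\<exists>z\<in>Z. t \<le> z \<and> z \<le> t + h \<and> t + h - z \<le> e * h)"
    proof (intro exI conjI allI impI)
      fix h assume h: "0 < h \<and> h < d"
      have "compact (Z \<inter> {t..t + h})" using assms by (simp add: closed_Int_compact)
      moreover have "t \<in> Z \<inter> {t..t + h}" using t h by auto
      ultimately obtain z where z: "z \<in> Z \<inter> {t..t + h}" "\<And>y. y \<in> Z \<inter> {t..t + h} \<Longrightarrow> y \<le> z"
        using compact_attains_sup[of "Z \<inter> {t..t + h}"] by blast
      have "integral {t..t + h} f \<le> integral {t..t + h} (indicator {t..z})"
      proof (rule integral_le)
        show "f integrable_on {t..t + h}" using int[of t "t + h"] by simp
        show "(indicator {t..z} :: real \<Rightarrow> real) integrable_on {t..t + h}"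
          using integrable_on_indicator[of "{t..z}" "{t..t + h}"] by simp
        fix x assume "x \<in> {t..t + h}"
        then show "f x \<le> indicator {t..z} x" using z(2)[of x] by (auto simp: f_def indicator_def)
      qed
      also have "\<dots> = z - t"
      proof -
        have "{t..z} \<inter> {t..t + h} = {t..z}" using z(1) by auto
        then show ?thesis using integral_indicator[of "{t..z}" "{t..t + h}"] z(1) by simp
      qed
      finally have "integral {t..t + h} f \<le> z - t" .
      moreover have "1 - e < integral {t..t + h} f / h" using d(2)[of h] h by linarith
      then have "(1 - e) * h < integral {t..t + h} f" using h by (simp add: pos_less_divide_eq)
      ultimately have "t + h - z \<le> e * h" by (simp add: algebra_simps)
      then show "\<exists>z\<in>Z. t \<le> z \<and> z \<le> t + h \<and> t + h - z \<le> e * h" using z(1) by auto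
    qed (use d in auto)
  qed
qed

text \<open>At a density point \<open>t\<close> of its zero set, \<open>u\<close> has a zero within \<open>o(\<bar>s - t\<bar>)\<close> of \<open>s\<close>, and \<open>u s\<close> is at most \<open>L\<close> times
the distance to that zero. The left side follows by reflecting time.\<close>

lemma lipschitz_zero_set_derivative:
  fixes u :: "real \<Rightarrow> real"
  assumes lip: "L-lipschitz_on {a..b} u"
  obtains E where "negligible E"
    "\<And>t e. t \<in> {a..b} - E \<Longrightarrow> u t = 0 \<Longrightarrow> e > 0 \<Longrightarrow> \<exists>d>0. \<forall>s\<in>{a..b}. \<bar>s - t\<bar> < d \<longrightarrow> \<bar>u s\<bar> \<le> e * \<bar>s - t\<bar>"
proof -
  define Z where "Z = {t \<in> {a..b}. u t = 0}"
  have cont: "continuous_on {a..b} u" using lip by (rule lipschitz_on_continuous_on)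
  have Z: "closed Z" unfolding Z_def
    by (intro continuous_closed_preimage_constant cont) auto
  have Z': "closed (uminus ` Z)" using Z by (rule closed_negations)
  obtain E1 where E1: "negligible E1"
    "\<And>t e. t \<in> Z - E1 \<Longrightarrow> e > 0 \<Longrightarrow> \<exists>d>0. \<forall>h. 0 < h \<and> h < d \<longrightarrow> (\<exists>z\<in>Z. t \<le> z \<and> z \<le> t + h \<and> t + h - z \<le> e * h)"
    using density_right[OF Z] by blast
  obtain E2 where E2: "negligible E2"
    "\<And>t e. t \<in> uminus ` Z - E2 \<Longrightarrow> e > 0 \<Longrightarrow> \<exists>d>0. \<forall>h. 0 < h \<and> h < d \<longrightarrow>
       (\<exists>z\<in>uminus ` Z. t \<le> z \<and> z \<le> t + h \<and> t + h - z \<le> e * h)"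
    using density_right[OF Z'] by blast
  have L: "L \<ge> 0" using lip by (rule lipschitz_on_nonneg)
  show ?thesis
  proof (rule that[of "E1 \<union> uminus ` E2"])
    show "negligible (E1 \<union> uminus ` E2)"
      using E1(1) negligible_differentiable_image_negligible[OF order_refl E2(1), of uminus]
      by (simp add: linear_imp_differentiable_on linear_uminus)
    fix t e :: real assume t: "t \<in> {a..b} - (E1 \<union> uminus ` E2)" "u t = 0" and e: "e > 0"
    \<comment> \<open>Adding \<open>1\<close> keeps the denominator positive when \<open>L = 0\<close>.\<close>
    define e' where "e' = e / (L + 1)"
    have e': "e' > 0" "L * e' \<le> e" using e L by (auto simp: e'_def field_simps)
    have tZ: "t \<in> Z - E1" "- t \<in> uminus ` Z - E2"
    proof -
      show "t \<in> Z - E1" using t by (auto simp: Z_def)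
      have "- t \<notin> E2"
      proof
        assume "- t \<in> E2"
        then have "- (- t) \<in> uminus ` E2" by (rule imageI)
        then show False using t by simp
      qed
      then show "- t \<in> uminus ` Z - E2" using \<open>t \<in> Z - E1\<close> by auto
    qed
    obtain d1 where d1: "d1 > 0" "\<And>h. 0 < h \<Longrightarrow> h < d1 \<Longrightarrow> \<exists>z\<in>Z. t \<le> z \<and> z \<le> t + h \<and> t + h - z \<le> e' * h"
      using E1(2)[OF tZ(1) e'(1)] by blast
    obtain d2 where d2: "d2 > 0" "\<And>h. 0 < h \<Longrightarrow> h < d2 \<Longrightarrow> \<exists>z\<in>uminus ` Z. - t \<le> z \<and> z \<le> - t + h \<and> - t + h - z \<le> e' * h"
      using E2(2)[OF tZ(2) e'(1)] by blast
    have near: "\<bar>u s\<bar> \<le> e * \<bar>s - t\<bar>" if "s \<in> {a..b}" "z \<in> Z" "\<bar>s - z\<bar> \<le> e' * \<bar>s - t\<bar>" for s z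
    proof -
      have "\<bar>u s\<bar> = dist (u s) (u z)" using that by (simp add: Z_def dist_real_def)
      also have "\<dots> \<le> L * \<bar>s - z\<bar>" using lipschitz_onD[OF lip, of s z] that by (simp add: Z_def dist_real_def)
      also have "\<dots> \<le> L * (e' * \<bar>s - t\<bar>)" using that L by (intro mult_left_mono) auto
      also have "\<dots> \<le> e * \<bar>s - t\<bar>" using e'(2) by (simp add: mult.assoc[symmetric] mult_right_mono)
      finally show ?thesis .
    qed
    show "\<exists>d>0. \<forall>s\<in>{a..b}. \<bar>s - t\<bar> < d \<longrightarrow> \<bar>u s\<bar> \<le> e * \<bar>s - t\<bar>"
    proof (intro exI[of _ "min d1 d2"] conjI ballI impI)
      fix s assume s: "s \<in> {a..b}" "\<bar>s - t\<bar> < min d1 d2"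
      consider "s = t" | "t < s" | "s < t" by linarith
      then show "\<bar>u s\<bar> \<le> e * \<bar>s - t\<bar>"
      proof cases
        case 2
        then obtain z where "z \<in> Z" "t \<le> z" "z \<le> s" "s - z \<le> e' * (s - t)" using d1(2)[of "s - t"] s by auto
        then show ?thesis using near[OF s(1)] 2 by auto
      next
        case 3
        then have "\<exists>y\<in>uminus ` Z. - t \<le> y \<and> y \<le> - t + (t - s) \<and> - t + (t - s) - y \<le> e' * (t - s)"
          using s by (intro d2(2)) auto
        then obtain z where "z \<in> Z" "s \<le> z" "z - s \<le> e' * (t - s)" by auto
        then show ?thesis using near[OF s(1)] 3 by auto
      qed (use t in simp)
    qed (use d1 d2 in auto)
  qed
qed

section \<open>Two-piece systems with a one-sided equilibrium\<close>

text \<open>Both systems of the theorem are instances: the given one, and the model with \<open>gL x = A x\<close> and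
\<open>gR x = c\<close> on the whole space.\<close>

locale two_piece_boundary_equilibrium =
  fixes N :: "real^'n \<Rightarrow> real" and k :: 'n and \<Omega> :: "(real^'n) set"
    and gL gR :: "real^'n \<Rightarrow> real^'n" and A :: "real^'n^'n" and c :: "real^'n"
  assumes is_norm: "is_norm N"
    and open_domain: "open \<Omega>" and zero_domain: "0 \<in> \<Omega>"
    and cont_left: "continuous_on {x\<in>\<Omega>. x $ k \<le> 0} gL"
    and cont_right: "continuous_on {x\<in>\<Omega>. 0 \<le> x $ k} gR"
    and left_zero: "gL 0 = 0"
    and left_derivative: "(gL has_derivative (\<lambda>v. A *v v)) (at 0 within {x\<in>\<Omega>. x $ k \<le> 0})"
    and right_zero: "gR 0 = c"
    and right_derivative: "\<exists>D. (gR has_derivative D) (at 0 within {x\<in>\<Omega>. 0 \<le> x $ k})"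
    and inward: "c $ k < 0"
begin

abbreviation "switching \<equiv> {x\<in>\<Omega>. x $ k = 0}"
abbreviation "velocity \<equiv> two_piece k gL gR"
abbreviation "velocities \<equiv> filippov_map N \<Omega> switching velocity"

definition pieces :: "real^'n \<Rightarrow> (real^'n) set" where
  "pieces x = (if x $ k < 0 then {gL x} else if x $ k > 0 then {gR x} else closed_segment (gL x) (gR x))"

lemma compact_pieces: "compact (pieces x)" and convex_pieces: "convex (pieces x)"
  unfolding pieces_def by auto

text \<open>By continuity of the two fields up to the switching set, all velocities at points near \<open>x\<close> are close
to \<open>pieces x\<close>; the closed \<open>\<eta>\<close>-neighbourhood of this compact convex set is closed and convex, so it
also contains the hull.\<close>

lemma hull_near_pieces:
  assumes x: "x \<in> \<Omega>" and \<eta>: "\<eta> > 0"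
  obtains \<delta> where "\<delta> > 0"
    "closed_convex_hull (velocity ` (ball x \<delta> \<inter> (\<Omega> - switching))) \<subseteq> (\<Union>y\<in>pieces x. \<Union>z\<in>cball 0 \<eta>. {y + z})"
proof -
  have comp: "\<bar>y $ k - x $ k\<bar> \<le> dist y x" for y
    using component_le_norm_cart[of "y - x" k] by (simp add: dist_norm)
  have "\<exists>\<delta>>0. \<forall>y\<in>\<Omega>. y $ k \<le> 0 \<longrightarrow> dist y x < \<delta> \<longrightarrow> x $ k \<le> 0 \<and> dist (gL y) (gL x) \<le> \<eta>"
  proof (cases "x $ k \<le> 0")
    case True
    then show ?thesis
      using cont_left x \<eta> unfolding continuous_on_iff by (metis (mono_tags, lifting) less_imp_le mem_Collect_eq)
  next
    case False
    then show ?thesis using comp by (intro exI[of _ "x $ k"]) (smt (verit))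
  qed
  then obtain \<delta>1 where \<delta>1: "\<delta>1 > 0"
    "\<And>y. y \<in> \<Omega> \<Longrightarrow> y $ k \<le> 0 \<Longrightarrow> dist y x < \<delta>1 \<Longrightarrow> x $ k \<le> 0 \<and> dist (gL y) (gL x) \<le> \<eta>" by auto
  have "\<exists>\<delta>>0. \<forall>y\<in>\<Omega>. 0 \<le> y $ k \<longrightarrow> dist y x < \<delta> \<longrightarrow> 0 \<le> x $ k \<and> dist (gR y) (gR x) \<le> \<eta>"
  proof (cases "0 \<le> x $ k")
    case True
    then show ?thesis
      using cont_right x \<eta> unfolding continuous_on_iff by (metis (mono_tags, lifting) less_imp_le mem_Collect_eq)
  next
    case False
    then show ?thesis using comp by (intro exI[of _ "- (x $ k)"]) (smt (verit))
  qed
  then obtain \<delta>2 where \<delta>2: "\<delta>2 > 0"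
    "\<And>y. y \<in> \<Omega> \<Longrightarrow> 0 \<le> y $ k \<Longrightarrow> dist y x < \<delta>2 \<Longrightarrow> 0 \<le> x $ k \<and> dist (gR y) (gR x) \<le> \<eta>" by auto
  have in_sum: "u \<in> (\<Union>y\<in>pieces x. \<Union>z\<in>cball 0 \<eta>. {y + z})" if "y \<in> pieces x" "dist u y \<le> \<eta>" for u y
  proof -
    have "u = y + (u - y)" "u - y \<in> cball 0 \<eta>" using that by (auto simp: dist_norm norm_minus_commute)
    then show ?thesis using that(1) by blast
  qed
  have "velocity ` (ball x (min \<delta>1 \<delta>2) \<inter> (\<Omega> - switching)) \<subseteq> (\<Union>y\<in>pieces x. \<Union>z\<in>cball 0 \<eta>. {y + z})"
  proof (rule image_subsetI)
    fix y assume y: "y \<in> ball x (min \<delta>1 \<delta>2) \<inter> (\<Omega> - switching)"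
    show "velocity y \<in> (\<Union>y\<in>pieces x. \<Union>z\<in>cball 0 \<eta>. {y + z})"
    proof (cases "y $ k < 0")
      case True
      then show ?thesis
        using y \<delta>1(2)[of y] by (intro in_sum[of "gL x"]) (auto simp: pieces_def two_piece_def dist_commute)
    next
      case False
      then show ?thesis
        using y \<delta>2(2)[of y] by (intro in_sum[of "gR x"]) (auto simp: pieces_def two_piece_def dist_commute)
    qed
  qed
  then have "\<exists>\<delta>>0. velocity ` (ball x \<delta> \<inter> (\<Omega> - switching)) \<subseteq> (\<Union>y\<in>pieces x. \<Union>z\<in>cball 0 \<eta>. {y + z})"
    using \<delta>1(1) \<delta>2(1) by (intro exI[of _ "min \<delta>1 \<delta>2"]) simp
  then obtain \<delta> where \<delta>: "\<delta> > 0" and "velocity ` (ball x \<delta> \<inter> (\<Omega> - switching)) \<subseteq> (\<Union>y\<in>pieces x. \<Union>z\<in>cball 0 \<eta>. {y + z})"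
    by blast
  then have "closed_convex_hull (velocity ` (ball x \<delta> \<inter> (\<Omega> - switching))) \<subseteq> (\<Union>y\<in>pieces x. \<Union>z\<in>cball 0 \<eta>. {y + z})"
    by (intro closed_convex_hull_minimal compact_closed_sums compact_pieces convex_sums convex_pieces) auto
  then show ?thesis using that \<delta> by blast
qed

lemma velocities_subset_pieces:
  assumes x: "x \<in> \<Omega>" and w: "w \<in> velocities x"
  shows "w \<in> pieces x"
proof -
  have "\<exists>y\<in>pieces x. dist y w < e" if e: "e > 0" for e
  proof -
    obtain \<delta> where \<delta>: "\<delta> > 0"
      "closed_convex_hull (velocity ` (ball x \<delta> \<inter> (\<Omega> - switching))) \<subseteq> (\<Union>y\<in>pieces x. \<Union>z\<in>cball 0 (e / 2). {y + z})"
      using hull_near_pieces[OF x, of "e / 2"] e by auto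
    have "w \<in> closed_convex_hull (velocity ` (ball x \<delta> \<inter> (\<Omega> - switching)))"
      using w \<delta>(1) unfolding filippov_map_ball[OF is_norm] by blast
    then obtain y z where "y \<in> pieces x" "z \<in> cball 0 (e / 2)" "w = y + z" using \<delta>(2) by blast
    then show ?thesis using e by (intro bexI[of _ y]) (auto simp: dist_norm)
  qed
  then have "w \<in> closure (pieces x)" by (simp add: closure_approachable)
  then show ?thesis using compact_pieces compact_imp_closed closure_closed by metis
qed

lemma open_radius: obtains \<rho> where "\<rho> > 0" "ball 0 \<rho> \<subseteq> \<Omega>"
  using open_domain zero_domain open_contains_ball by metis

text \<open>The zero vector is the limit of the left-hand velocities along the negative \<open>k\<close>-th axis.\<close>

lemma equilibrium: "filippov_equilibrium N \<Omega> switching velocity 0"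
proof (rule constant_solution[OF zero_domain])
  have "0 \<in> closed_convex_hull (velocity ` (ball 0 \<delta> \<inter> (\<Omega> - switching)))" if \<delta>: "\<delta> > 0" for \<delta>
  proof -
    let ?U = "velocity ` (ball 0 \<delta> \<inter> (\<Omega> - switching))"
    have "\<exists>y\<in>?U. dist y 0 < e" if e: "e > 0" for e
    proof -
      obtain \<rho> where \<rho>: "\<rho> > 0" "ball 0 \<rho> \<subseteq> \<Omega>" by (rule open_radius)
      obtain d where d: "d > 0" "\<And>y. y \<in> \<Omega> \<Longrightarrow> y $ k \<le> 0 \<Longrightarrow> dist y 0 < d \<Longrightarrow> dist (gL y) (gL 0) < e"
        using cont_left zero_domain e unfolding continuous_on_iff by (metis (mono_tags, lifting) mem_Collect_eq order_refl zero_index)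
      define s where "s = min \<rho> (min d \<delta>) / 2"
      have s: "s > 0" "s < \<rho>" "s < d" "s < \<delta>" using \<rho> d \<delta> by (auto simp: s_def)
      define y :: "real^'n" where "y = (- s) *\<^sub>R axis k 1"
      have y: "norm y = s" "y $ k = - s" using s by (auto simp: y_def norm_axis_1)
      then have "y \<in> \<Omega>" using s \<rho>(2) by auto
      then have "velocity y \<in> ?U" using y s by auto
      moreover have "dist (velocity y) 0 < e"
        using d(2)[OF \<open>y \<in> \<Omega>\<close>] y s left_zero by (simp add: two_piece_def)
      ultimately show ?thesis by blast
    qed
    then have "0 \<in> closure ?U" by (simp add: closure_approachable)
    also have "closure ?U \<subseteq> closed_convex_hull ?U"
      by (intro closure_minimal closed_convex_hull_basics)
    finally show ?thesis .
  qed
  then show "0 \<in> velocities 0" unfolding filippov_map_ball[OF is_norm] by blast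
qed

lemma left_expansion:
  assumes "\<epsilon> > 0"
  obtains \<rho> where "\<rho> > 0" "\<And>x. x \<in> \<Omega> \<Longrightarrow> x $ k \<le> 0 \<Longrightarrow> norm x < \<rho> \<Longrightarrow> norm (gL x - A *v x) \<le> \<epsilon> * norm x"
proof -
  have "\<exists>d>0. \<forall>y\<in>{x\<in>\<Omega>. x $ k \<le> 0}. norm (y - 0) < d \<longrightarrow> norm (gL y - gL 0 - A *v (y - 0)) \<le> \<epsilon> * norm (y - 0)"
    using left_derivative assms unfolding has_derivative_within_alt by blast
  then show ?thesis using that left_zero by auto
qed

lemma right_expansion:
  obtains \<rho> D where "\<rho> > 0" "D \<ge> 0" "\<And>x. x \<in> \<Omega> \<Longrightarrow> 0 \<le> x $ k \<Longrightarrow> norm x < \<rho> \<Longrightarrow> norm (gR x - c) \<le> D * norm x"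
proof -
  obtain g' where g': "(gR has_derivative g') (at 0 within {x\<in>\<Omega>. 0 \<le> x $ k})" using right_derivative by blast
  then have bl: "bounded_linear g'" by (rule has_derivative_bounded_linear)
  obtain B where B: "B > 0" "\<And>x. norm (g' x) \<le> norm x * B" using bounded_linear.pos_bounded[OF bl] by blast
  obtain \<rho> where \<rho>: "\<rho> > 0" "\<And>y. y \<in> {x\<in>\<Omega>. 0 \<le> x $ k} \<Longrightarrow> norm (y - 0) < \<rho> \<Longrightarrow> norm (gR y - gR 0 - g' (y - 0)) \<le> 1 * norm (y - 0)"
    using g' zero_less_one unfolding has_derivative_within_alt by blast
  show ?thesis
  proof (rule that[of \<rho> "1 + B"])
    fix x assume "x \<in> \<Omega>" "0 \<le> x $ k" "norm x < \<rho>"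
    then have "norm (gR x - c - g' x) \<le> norm x" using \<rho>(2)[of x] right_zero by simp
    then show "norm (gR x - c) \<le> (1 + B) * norm x"
      using B(2)[of x] norm_triangle_sub[of "gR x - c" "g' x"] by (simp add: algebra_simps)
  qed (use \<rho> B in auto)
qed

text \<open>On the switching set a velocity is \<open>(1 - l) gL x + l gR x\<close>. Expanding both fields at \<open>0\<close>, the
left one contributes an error \<open>\<epsilon> norm x\<close>, the right one \<open>l (D + a) norm x\<close>; the part \<open>a norm x\<close> is
the price for writing \<open>A x\<close> also on the right.\<close>

lemma crossing: "crossing_estimate A c k velocities"
proof -
  obtain \<rho>0 where \<rho>0: "\<rho>0 > 0" "ball 0 \<rho>0 \<subseteq> \<Omega>" by (rule open_radius)
  obtain \<rho>1 D where D: "\<rho>1 > 0" "D \<ge> 0" "\<And>x. x \<in> \<Omega> \<Longrightarrow> 0 \<le> x $ k \<Longrightarrow> norm x < \<rho>1 \<Longrightarrow> norm (gR x - c) \<le> D * norm x"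
    by (rule right_expansion) blast
  obtain a where a: "a > 0" "\<And>x. norm (A *v x) \<le> a * norm x" using matrix_bound[of A] by blast
  have "\<exists>\<rho>>0. \<forall>x. norm x < \<rho> \<longrightarrow> (\<forall>w\<in>velocities x. crossing_velocity A c k \<epsilon> (D + a) x w)" if \<epsilon>: "\<epsilon> > 0" for \<epsilon>
  proof -
    obtain \<rho>2 where \<rho>2: "\<rho>2 > 0" "\<And>x. x \<in> \<Omega> \<Longrightarrow> x $ k \<le> 0 \<Longrightarrow> norm x < \<rho>2 \<Longrightarrow> norm (gL x - A *v x) \<le> \<epsilon> * norm x"
      by (rule left_expansion[OF \<epsilon>]) blast
    show ?thesis
    proof (intro exI[of _ "min \<rho>0 (min \<rho>1 \<rho>2)"] conjI allI impI ballI)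
      fix x w assume nx: "norm x < min \<rho>0 (min \<rho>1 \<rho>2)" and w: "w \<in> velocities x"
      have x: "x \<in> \<Omega>" using nx \<rho>0(2) by auto
      have wp: "w \<in> pieces x" using velocities_subset_pieces[OF x w] .
      have eR: "norm (gR x - c - A *v x) \<le> (D + a) * norm x" if "0 \<le> x $ k"
        using D(3)[OF x that] nx a(2)[of x] norm_triangle_ineq4[of "gR x - c" "A *v x"] by (simp add: algebra_simps)
      have eL: "norm (gL x - A *v x) \<le> \<epsilon> * norm x" if "x $ k \<le> 0" using \<rho>2(2)[OF x that] nx by simp
      consider "x $ k < 0" | "x $ k > 0" | "x $ k = 0" by linarith
      then show "crossing_velocity A c k \<epsilon> (D + a) x w"
      proof cases
        case 1
        then show ?thesis unfolding crossing_velocity_def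
          using wp eL by (intro exI[of _ 0] exI[of _ "w - A *v x"]) (auto simp: pieces_def)
      next
        case 2
        have "norm (w - c - A *v x) \<le> (\<epsilon> + (D + a) * 1) * norm x"
        proof -
          have "0 \<le> \<epsilon> * norm x" using \<epsilon> by simp
          then show ?thesis using wp eR 2 by (auto simp: pieces_def algebra_simps)
        qed
        then show ?thesis unfolding crossing_velocity_def
          using 2 by (intro exI[of _ 1] exI[of _ "w - c - A *v x"]) auto
      next
        case 3
        then obtain l where l: "0 \<le> l" "l \<le> 1" "w = (1 - l) *\<^sub>R gL x + l *\<^sub>R gR x"
          using wp by (auto simp: pieces_def in_segment)
        define e where "e = (1 - l) *\<^sub>R (gL x - A *v x) + l *\<^sub>R (gR x - c - A *v x)"
        have "norm e \<le> (1 - l) * norm (gL x - A *v x) + l * norm (gR x - c - A *v x)"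
          unfolding e_def using l norm_triangle_ineq[of "(1 - l) *\<^sub>R (gL x - A *v x)" "l *\<^sub>R (gR x - c - A *v x)"] by simp
        also have "\<dots> \<le> 1 * (\<epsilon> * norm x) + l * ((D + a) * norm x)"
          using l 3 \<epsilon> eL eR by (intro add_mono mult_mono) auto
        finally have "norm e \<le> (\<epsilon> + (D + a) * l) * norm x" by (simp add: algebra_simps)
        moreover have "w = A *v x + l *\<^sub>R c + e" unfolding l(3) e_def by (simp add: algebra_simps)
        ultimately show ?thesis unfolding crossing_velocity_def
          using l 3 by (intro exI[of _ l] exI[of _ e]) auto
      qed
    qed (use \<rho>0 D \<rho>2 in auto)
  qed
  then show ?thesis unfolding crossing_estimate_def using D a by (intro exI[of _ "D + a"]) auto
qed

text \<open>The limit of Euler polygons is a solution. Where \<open>x\<^sub>k \<noteq> 0\<close> the velocity field is continuous and the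
increments of the limit determine its derivative. At almost every time with \<open>x\<^sub>k = 0\<close> the component \<open>x\<^sub>k\<close> has
derivative zero. Near the origin \<open>gR\<close> points out of the right half-space and \<open>gL\<close> is small, so
\<open>gR x $ k < gL x $ k\<close>, and the segment of velocities contains at most one point with vanishing \<open>k\<close>-th component:
difference quotients can accumulate only there. The derivative lies in the Filippov set
because the hulls are closed.\<close>

lemma local_existence:
  obtains \<rho> where "\<rho> > 0" "\<forall>x0. norm x0 < \<rho> \<longrightarrow>
    (\<exists>\<tau> \<phi>. \<tau> > 0 \<and> filippov_solution_compact N \<Omega> switching velocity 0 \<tau> \<phi> \<and> \<phi> 0 = x0)"
proof -
  obtain \<rho>0 where \<rho>0: "\<rho>0 > 0" "ball 0 \<rho>0 \<subseteq> \<Omega>" by (rule open_radius)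
  obtain \<rho>1 D where D: "\<rho>1 > 0" "D \<ge> 0" "\<And>x. x \<in> \<Omega> \<Longrightarrow> 0 \<le> x $ k \<Longrightarrow> norm x < \<rho>1 \<Longrightarrow> norm (gR x - c) \<le> D * norm x"
    by (rule right_expansion) blast
  obtain \<rho>2 where \<rho>2: "\<rho>2 > 0" "\<And>x. x \<in> \<Omega> \<Longrightarrow> x $ k \<le> 0 \<Longrightarrow> norm x < \<rho>2 \<Longrightarrow> norm (gL x - A *v x) \<le> 1 * norm x"
    by (rule left_expansion[OF zero_less_one]) blast
  obtain a where a: "a > 0" "\<And>x. norm (A *v x) \<le> a * norm x" using matrix_bound[of A] by blast
  \<comment> \<open>On this ball the expansions of the two fields at \<open>0\<close> cost less than \<open>- c $ k\<close>.\<close>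
  define \<rho>3 where "\<rho>3 = - (c $ k) / (D + a + 1)"
  have \<rho>3: "\<rho>3 > 0" unfolding \<rho>3_def using inward D a by (intro divide_pos_pos) auto
  define \<rho> where "\<rho> = min (min \<rho>0 \<rho>1) (min \<rho>2 \<rho>3)"
  have \<rho>: "\<rho> > 0" using \<rho>0 D \<rho>2 \<rho>3 by (simp add: \<rho>_def)
  have transversal: "gR x $ k < gL x $ k" if x: "norm x < \<rho>" "x $ k = 0" for x
  proof -
    have x\<Omega>: "x \<in> \<Omega>" using x \<rho>0(2) by (auto simp: \<rho>_def)
    have "norm (gR x - c) \<le> D * norm x" "norm (gL x - A *v x) \<le> norm x"
      using D(3)[OF x\<Omega>] \<rho>2(2)[OF x\<Omega>] x by (auto simp: \<rho>_def)
    then have comp: "\<bar>gR x $ k - c $ k\<bar> \<le> D * norm x" "\<bar>gL x $ k - (A *v x) $ k\<bar> \<le> norm x" "\<bar>(A *v x) $ k\<bar> \<le> a * norm x"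
      using component_le_norm_cart[of "gR x - c" k] component_le_norm_cart[of "gL x - A *v x" k]
        component_le_norm_cart[of "A *v x" k] a(2)[of x] by auto
    have "(D + a + 1) * norm x < (D + a + 1) * \<rho>3"
      using x D a by (intro mult_strict_left_mono) (auto simp: \<rho>_def)
    moreover have "(D + a + 1) * \<rho>3 = - (c $ k)" using D(2) a(1) by (simp add: \<rho>3_def)
    ultimately have "D * norm x + a * norm x + norm x < - (c $ k)" by (simp only: distrib_right mult_1)
    then show ?thesis using comp by linarith
  qed
  show ?thesis
  proof (rule that[of "\<rho> / 2"], use \<rho> in simp, intro allI impI)
    fix x0 :: "real^'n" assume x0: "norm x0 < \<rho> / 2"
    have x0\<Omega>: "x0 \<in> \<Omega>" using x0 \<rho>0(2) \<rho> by (auto simp: \<rho>_def)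
    obtain \<delta> where \<delta>: "\<delta> > 0"
      "closed_convex_hull (velocity ` (ball x0 \<delta> \<inter> (\<Omega> - switching))) \<subseteq> (\<Union>y\<in>pieces x0. \<Union>z\<in>cball 0 1. {y + z})"
      by (rule hull_near_pieces[OF x0\<Omega> zero_less_one])
    have "bounded (\<Union>y\<in>pieces x0. \<Union>z\<in>cball 0 1. {y + z})"
    proof -
      have "bounded ((\<lambda>(y, z). y + z) ` (pieces x0 \<times> cball (0::real^'n) 1))"
        by (intro compact_imp_bounded compact_continuous_image compact_Times compact_pieces)
           (auto simp: split_beta intro!: continuous_intros)
      then show ?thesis by (rule bounded_subset) auto
    qed
    then obtain M where M: "M > 0" "\<And>u. u \<in> (\<Union>y\<in>pieces x0. \<Union>z\<in>cball 0 1. {y + z}) \<Longrightarrow> norm u \<le> M"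
      unfolding bounded_pos by blast
    define r where "r = min \<delta> (\<rho> / 2) / 2"
    have r: "r > 0" "2 * r \<le> \<delta>" "r < \<rho> / 2" using \<delta> \<rho> by (auto simp: r_def)
    have cb: "norm x < \<rho>" if "x \<in> cball x0 r" for x
      using that r x0 norm_triangle_sub[of x x0] by (simp add: dist_norm norm_minus_commute)
    have dense: "cball x0 r \<subseteq> closure (\<Omega> - switching)"
    proof
      fix x assume "x \<in> cball x0 r"
      then have x: "norm x < \<rho>0" using cb by (auto simp: \<rho>_def)
      have "\<exists>y\<in>\<Omega> - switching. dist y x < e" if e: "e > 0" for e
      proof -
        define h where "h = min e (\<rho>0 - norm x) / 2"
        have h: "h > 0" "h < e" "h < \<rho>0 - norm x" using e x by (auto simp: h_def)
        define s where "s = (if 0 \<le> x $ k then h else - h)"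
        have s: "\<bar>s\<bar> = h" using h by (simp add: s_def)
        define y where "y = x + s *\<^sub>R axis k 1"
        have "y $ k = x $ k + s" by (simp add: y_def)
        moreover have "x $ k + s \<noteq> 0" using h(1) by (simp add: s_def)
        ultimately have "y $ k \<noteq> 0" by simp
        moreover have "norm y < \<rho>0"
          using norm_triangle_ineq[of x "s *\<^sub>R axis k 1"] s h by (simp add: y_def norm_axis_1)
        then have "y \<in> \<Omega>" using \<rho>0(2) by auto
        moreover have "dist y x < e" using s h by (simp add: y_def dist_norm norm_axis_1)
        ultimately show ?thesis by blast
      qed
      then show "x \<in> closure (\<Omega> - switching)" by (simp add: closure_approachable)
    qed
    have bound: "\<forall>x\<in>\<Omega> - switching. dist x0 x < 2 * r \<longrightarrow> norm (velocity x) \<le> M"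
    proof (intro ballI impI M(2))
      fix x assume "x \<in> \<Omega> - switching" "dist x0 x < 2 * r"
      then have "velocity x \<in> closed_convex_hull (velocity ` (ball x0 \<delta> \<inter> (\<Omega> - switching)))"
        by (intro subsetD[OF closed_convex_hull_basics(3)] imageI) (use r in auto)
      then show "velocity x \<in> (\<Union>y\<in>pieces x0. \<Union>z\<in>cball 0 1. {y + z})" using \<delta>(2) by blast
    qed
    define \<tau> where "\<tau> = r / M"
    have \<tau>: "\<tau> > 0" "M * \<tau> \<le> r" using r M by (auto simp: \<tau>_def)
    obtain x where x: "M-lipschitz_on {0..\<tau>} x" "x 0 = x0" "x ` {0..\<tau>} \<subseteq> cball x0 r"
      and incr: "\<And>t \<delta>. t \<in> {0..\<tau>} \<Longrightarrow> \<delta> > 0 \<Longrightarrow> \<exists>\<eta>>0. \<forall>s s'. 0 \<le> s \<and> s < s' \<and> s' \<le> \<tau> \<and> \<bar>s - t\<bar> < \<eta> \<and> \<bar>s' - t\<bar> < \<eta>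
       \<longrightarrow> (\<exists>v\<in>closed_convex_hull (velocity ` (ball (x t) \<delta> \<inter> (\<Omega> - switching))). x s' - x s = (s' - s) *\<^sub>R v)"
      by (fact euler_limit[OF r(1) bound dense M(1) \<tau>])
    have small: "norm (x t) < \<rho>" "x t \<in> \<Omega>" if "t \<in> {0..\<tau>}" for t
    proof -
      show "norm (x t) < \<rho>" using x(3) that cb by blast
      then show "x t \<in> \<Omega>" using \<rho>0(2) by (auto simp: \<rho>_def)
    qed
    have incr': "\<exists>\<eta>>0. \<forall>s\<in>{0..\<tau>}. \<bar>s - t\<bar> < \<eta> \<longrightarrow>
        (\<exists>v\<in>closed_convex_hull (velocity ` (ball (x t) \<delta> \<inter> (\<Omega> - switching))). x s - x t = (s - t) *\<^sub>R v)"
      if t: "t \<in> {0..\<tau>}" "\<delta> > 0" for t \<delta>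
    proof -
      let ?C = "closed_convex_hull (velocity ` (ball (x t) \<delta> \<inter> (\<Omega> - switching)))"
      obtain \<eta> where \<eta>: "\<eta> > 0" "\<And>s s'. 0 \<le> s \<Longrightarrow> s < s' \<Longrightarrow> s' \<le> \<tau> \<Longrightarrow> \<bar>s - t\<bar> < \<eta> \<Longrightarrow> \<bar>s' - t\<bar> < \<eta> \<Longrightarrow>
         (\<exists>v\<in>?C. x s' - x s = (s' - s) *\<^sub>R v)" using incr[OF t] by blast
      have inc: "\<exists>v\<in>?C. x s - x t = (s - t) *\<^sub>R v" if s: "s \<in> {0..\<tau>}" "\<bar>s - t\<bar> < \<eta>" "s \<noteq> t" for s
      proof (cases "s < t")
        case True
        then obtain v where v: "v \<in> ?C" "x t - x s = (t - s) *\<^sub>R v" using \<eta>(2)[of s t] s t \<eta>(1) by auto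
        have "x s - x t = - ((t - s) *\<^sub>R v)" unfolding v(2)[symmetric] by simp
        also have "\<dots> = (s - t) *\<^sub>R v" by (simp add: algebra_simps)
        finally show ?thesis using v(1) by blast
      next
        case False
        then show ?thesis using \<eta>(2)[of t s] s t \<eta>(1) by auto
      qed
      \<comment> \<open>At \<open>s = t\<close> the increment is zero, so it suffices that the hull is nonempty.\<close>
      have "\<exists>v. v \<in> ?C"
      proof -
        define s where "s = (if t + \<eta> / 2 \<le> \<tau> then t + \<eta> / 2 else max 0 (t - \<eta> / 2))"
        have "s \<noteq> t \<and> s \<in> {0..\<tau>} \<and> \<bar>s - t\<bar> < \<eta> \<or> \<tau> < \<eta>"
          using t \<eta>(1) \<tau>(1) by (auto simp: s_def max_def split: if_splits)
        then show ?thesis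
        proof
          assume "s \<noteq> t \<and> s \<in> {0..\<tau>} \<and> \<bar>s - t\<bar> < \<eta>"
          then show ?thesis using inc by blast
        next
          assume "\<tau> < \<eta>"
          then show ?thesis using inc[of 0] inc[of \<tau>] t \<tau>(1) by (cases "t = 0") auto
        qed
      qed
      then show ?thesis using \<eta>(1) inc by (intro exI[of _ \<eta>]) (metis (no_types) diff_self scaleR_zero_left)
    qed
    have lipu: "M-lipschitz_on {0..\<tau>} (\<lambda>t. x t $ k)"
    proof (rule lipschitz_onI)
      fix s t assume "s \<in> {0..\<tau>}" "t \<in> {0..\<tau>}"
      then show "dist (x s $ k) (x t $ k) \<le> M * dist s t"
        using lipschitz_onD[OF x(1), of s t] component_le_norm_cart[of "x s - x t" k] by (simp add: dist_norm)
    qed (use M in simp)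
    obtain E where E: "negligible E"
      "\<And>t e. t \<in> {0..\<tau>} - E \<Longrightarrow> x t $ k = 0 \<Longrightarrow> e > 0 \<Longrightarrow> \<exists>d>0. \<forall>s\<in>{0..\<tau>}. \<bar>s - t\<bar> < d \<longrightarrow> \<bar>x s $ k\<bar> \<le> e * \<bar>s - t\<bar>"
      using lipschitz_zero_set_derivative[OF lipu] by blast
    have derivI: "(x has_vector_derivative w) (at t within {0..\<tau>})"
      if "\<And>e. e > 0 \<Longrightarrow> \<exists>d>0. \<forall>s\<in>{0..\<tau>}. \<bar>s - t\<bar> < d \<longrightarrow> norm (x s - x t - (s - t) *\<^sub>R w) \<le> e * \<bar>s - t\<bar>" for t w
      unfolding has_vector_derivative_def has_derivative_within_alt
      using that by (auto intro: bounded_linear_scaleR_left)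
    have exists: "\<exists>w. (x has_vector_derivative w) (at t within {0..\<tau>})" if t: "t \<in> {0..\<tau>} - E" for t
    proof -
      have t0: "t \<in> {0..\<tau>}" using t by simp
      have near: "\<exists>d>0. \<forall>s\<in>{0..\<tau>}. \<bar>s - t\<bar> < d \<longrightarrow> (\<exists>y\<in>pieces (x t). \<exists>z\<in>cball 0 \<eta>. x s - x t = (s - t) *\<^sub>R (y + z))"
        if \<eta>: "\<eta> > 0" for \<eta>
      proof -
        obtain \<delta> where \<delta>: "\<delta> > 0"
          "closed_convex_hull (velocity ` (ball (x t) \<delta> \<inter> (\<Omega> - switching))) \<subseteq> (\<Union>y\<in>pieces (x t). \<Union>z\<in>cball 0 \<eta>. {y + z})"
          by (rule hull_near_pieces[OF small(2)[OF t0] \<eta>])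
        obtain d where d: "d > 0" "\<And>s. s \<in> {0..\<tau>} \<Longrightarrow> \<bar>s - t\<bar> < d \<Longrightarrow>
          (\<exists>v\<in>closed_convex_hull (velocity ` (ball (x t) \<delta> \<inter> (\<Omega> - switching))). x s - x t = (s - t) *\<^sub>R v)"
          using incr'[OF t0 \<delta>(1)] by blast
        have "\<exists>y\<in>pieces (x t). \<exists>z\<in>cball 0 \<eta>. x s - x t = (s - t) *\<^sub>R (y + z)" if "s \<in> {0..\<tau>}" "\<bar>s - t\<bar> < d" for s
          using d(2)[OF that] \<delta>(2) by blast
        then show ?thesis using d(1) by blast
      qed
      show ?thesis
      proof (cases "x t $ k = 0")
        case False
        then have "\<exists>w. pieces (x t) = {w}" by (cases "x t $ k < 0") (auto simp: pieces_def)
        then obtain w where w: "pieces (x t) = {w}" by blast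
        have "\<exists>d>0. \<forall>s\<in>{0..\<tau>}. \<bar>s - t\<bar> < d \<longrightarrow> norm (x s - x t - (s - t) *\<^sub>R w) \<le> e * \<bar>s - t\<bar>" if e: "e > 0" for e
        proof -
          obtain d where d: "d > 0" "\<forall>s\<in>{0..\<tau>}. \<bar>s - t\<bar> < d \<longrightarrow> (\<exists>y\<in>{w}. \<exists>z\<in>cball 0 e. x s - x t = (s - t) *\<^sub>R (y + z))"
            using near[OF e] unfolding w by (elim exE conjE)
          have "norm (x s - x t - (s - t) *\<^sub>R w) \<le> e * \<bar>s - t\<bar>" if s: "s \<in> {0..\<tau>}" "\<bar>s - t\<bar> < d" for s
          proof -
            obtain z where z: "norm z \<le> e" "x s - x t = (s - t) *\<^sub>R (w + z)" using d(2) s by auto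
            then have "x s - x t - (s - t) *\<^sub>R w = (s - t) *\<^sub>R z" by (simp add: algebra_simps)
            then show ?thesis using mult_left_mono[OF z(1), of "\<bar>s - t\<bar>"] by (simp add: mult.commute)
          qed
          then show ?thesis using d(1) by blast
        qed
        then show ?thesis using derivI by blast
      next
        case True
        define p where "p = gL (x t)"
        define q where "q = gR (x t)"
        have pq: "q $ k < p $ k" using transversal[OF small(1)[OF t0] True] by (simp add: p_def q_def)
        \<comment> \<open>\<open>\<theta>\<close> is the weight at which the \<open>k\<close>-th component of \<open>(1 - \<theta>) p + \<theta> q\<close> vanishes; \<open>w\<close> is the sliding
          velocity.\<close>
        define \<theta> where "\<theta> = p $ k / (p $ k - q $ k)"
        define w where "w = p + \<theta> *\<^sub>R (q - p)"
        have \<theta>: "\<theta> * (p $ k - q $ k) = p $ k" using pq by (simp add: \<theta>_def)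
        have "\<exists>d>0. \<forall>s\<in>{0..\<tau>}. \<bar>s - t\<bar> < d \<longrightarrow> norm (x s - x t - (s - t) *\<^sub>R w) \<le> e * \<bar>s - t\<bar>" if e: "e > 0" for e
        proof -
          \<comment> \<open>An error \<open>2 e'\<close> in the \<open>k\<close>-th component moves the point on the segment by at most
            \<open>2 e' norm (q - p) / (p $ k - q $ k)\<close>.\<close>
          define e' where "e' = e / (1 + 2 * norm (q - p) / (p $ k - q $ k))"
          have den: "1 + 2 * norm (q - p) / (p $ k - q $ k) > 0" using pq by (intro add_pos_nonneg) auto
          have e': "e' > 0" "e' * (1 + 2 * norm (q - p) / (p $ k - q $ k)) = e"
            using e den by (simp_all add: e'_def)
          obtain d1 where d1: "d1 > 0" "\<And>s. s \<in> {0..\<tau>} \<Longrightarrow> \<bar>s - t\<bar> < d1 \<Longrightarrow>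
              \<exists>y\<in>pieces (x t). \<exists>z\<in>cball 0 e'. x s - x t = (s - t) *\<^sub>R (y + z)"
            using near[OF e'(1)] by blast
          obtain d2 where d2: "d2 > 0" "\<And>s. s \<in> {0..\<tau>} \<Longrightarrow> \<bar>s - t\<bar> < d2 \<Longrightarrow> \<bar>x s $ k\<bar> \<le> e' * \<bar>s - t\<bar>"
            using E(2)[OF t True e'(1)] by blast
          have "norm (x s - x t - (s - t) *\<^sub>R w) \<le> e * \<bar>s - t\<bar>" if s: "s \<in> {0..\<tau>}" "\<bar>s - t\<bar> < min d1 d2" for s
          proof (cases "s = t")
            case False
            obtain y z where yz: "y \<in> pieces (x t)" "z \<in> cball 0 e'" "x s - x t = (s - t) *\<^sub>R (y + z)"
              using d1(2)[OF s(1)] s(2) by auto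
            then obtain l where l: "y = p + l *\<^sub>R (q - p)"
              using True by (auto simp: pieces_def in_segment p_def q_def algebra_simps)
            have "x s $ k - x t $ k = (s - t) * (y $ k + z $ k)"
              using arg_cong[OF yz(3), of "\<lambda>v. v $ k"] by simp
            then have "\<bar>s - t\<bar> * \<bar>y $ k + z $ k\<bar> \<le> \<bar>s - t\<bar> * e'"
              using d2(2)[OF s(1)] s(2) True by (simp add: abs_mult[symmetric] mult.commute)
            then have "\<bar>y $ k + z $ k\<bar> \<le> e'" using False by simp
            moreover have "\<bar>z $ k\<bar> \<le> e'" using yz(2) component_le_norm_cart[of z k] by simp
            ultimately have "\<bar>y $ k\<bar> \<le> 2 * e'" by linarith
            moreover have "y $ k = - ((l - \<theta>) * (p $ k - q $ k))"
              using \<theta> unfolding l by (simp add: algebra_simps)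
            ultimately have "\<bar>l - \<theta>\<bar> * (p $ k - q $ k) \<le> 2 * e'"
              using pq by (simp add: abs_mult)
            then have l\<theta>: "\<bar>l - \<theta>\<bar> \<le> 2 * e' / (p $ k - q $ k)"
              using pq by (simp add: pos_le_divide_eq)
            have eq: "y + z - w = (l - \<theta>) *\<^sub>R (q - p) + z" unfolding l w_def by (simp add: algebra_simps)
            have "norm (y + z - w) \<le> \<bar>l - \<theta>\<bar> * norm (q - p) + norm z"
              unfolding eq norm_scaleR[symmetric] by (rule norm_triangle_ineq)
            also have "\<dots> \<le> 2 * e' / (p $ k - q $ k) * norm (q - p) + e'"
              using l\<theta> yz(2) by (intro add_mono mult_right_mono) auto
            also have "\<dots> = e" using e'(2) by (simp add: algebra_simps)
            finally have "norm (y + z - w) \<le> e" .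
            moreover have "x s - x t - (s - t) *\<^sub>R w = (s - t) *\<^sub>R (y + z - w)" unfolding yz(3) by (simp add: algebra_simps)
            ultimately show ?thesis using mult_left_mono[of "norm (y + z - w)" e "\<bar>s - t\<bar>"] by (simp add: mult.commute)
          qed simp
          then show ?thesis using d1(1) d2(1) by (intro exI[of _ "min d1 d2"]) auto
        qed
        then show ?thesis using derivI by blast
      qed
    qed
    have member: "w \<in> velocities (x t)" if t: "t \<in> {0..\<tau>}" and w: "(x has_vector_derivative w) (at t within {0..\<tau>})" for t w
    proof -
      have "w \<in> closed_convex_hull (velocity ` (ball (x t) \<delta> \<inter> (\<Omega> - switching)))" if \<delta>: "\<delta> > 0" for \<delta>
      proof -
        let ?C = "closed_convex_hull (velocity ` (ball (x t) \<delta> \<inter> (\<Omega> - switching)))"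
        obtain d where d: "d > 0" "\<And>s. s \<in> {0..\<tau>} \<Longrightarrow> \<bar>s - t\<bar> < d \<Longrightarrow> \<exists>v\<in>?C. x s - x t = (s - t) *\<^sub>R v"
          using incr'[OF t \<delta>] by blast
        have "\<exists>v\<in>?C. dist v w < e" if e: "e > 0" for e
        proof -
          obtain d' where d': "d' > 0" "\<And>s. s \<in> {0..\<tau>} \<Longrightarrow> \<bar>s - t\<bar> < d' \<Longrightarrow> norm (x s - x t - (s - t) *\<^sub>R w) \<le> (e / 2) * \<bar>s - t\<bar>"
            using w half_gt_zero[OF e] unfolding has_vector_derivative_def has_derivative_within_alt by (metis real_norm_def)
          define h where "h = min (min d d') \<tau> / 2"
          have h: "h > 0" "h < d" "h < d'" "h \<le> \<tau> / 2" using d d' \<tau> by (auto simp: h_def)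
          define s where "s = (if t + h \<le> \<tau> then t + h else t - h)"
          have s: "s \<in> {0..\<tau>}" "\<bar>s - t\<bar> = h" using t h by (auto simp: s_def)
          obtain v where v: "v \<in> ?C" "x s - x t = (s - t) *\<^sub>R v" using d(2)[OF s(1)] s h by auto
          have "norm ((s - t) *\<^sub>R (v - w)) \<le> (e / 2) * h"
            using d'(2)[OF s(1)] s h v(2) by (simp add: scaleR_diff_right)
          then have "norm (v - w) \<le> e / 2" using s h by simp
          then show ?thesis using v(1) e by (intro bexI[of _ v]) (auto simp: dist_norm)
        qed
        then have "w \<in> closure ?C" by (simp add: closure_approachable)
        then show ?thesis by (simp only: closure_closed[OF closed_convex_hull_basics(1)])
      qed
      then show ?thesis unfolding filippov_map_ball[OF is_norm] by blast
    qed
    have "filippov_solution_compact N \<Omega> switching velocity 0 \<tau> x"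
      unfolding solution_compact_iff
    proof (intro conjI exI[of _ E] ballI E(1) lipschitz_imp_AC[OF x(1)])
      show "x ` {0..\<tau>} \<subseteq> \<Omega>" using small(2) by (rule image_subsetI)
      fix t assume t: "t \<in> {0..\<tau>} - E"
      obtain w where w: "(x has_vector_derivative w) (at t within {0..\<tau>})" using exists[OF t] by (elim exE)
      show "\<exists>w. (x has_vector_derivative w) (at t within {0..\<tau>}) \<and> w \<in> velocities (x t)"
        by (intro exI[of _ w] conjI w member[OF _ w]) (use t in simp)
    qed
    then show "\<exists>\<tau> \<phi>. \<tau> > 0 \<and> filippov_solution_compact N \<Omega> switching velocity 0 \<tau> \<phi> \<and> \<phi> 0 = x0"
      using \<tau>(1) x(2) by blast
  qed
qed

end

section \<open>Transfer of exponential stability\<close>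

text \<open>Velocities near \<open>0\<close> are bounded, so a small solution on a bounded half-open interval extends to the
end point, and a small solution on a compact interval is continued by local existence.
Either way it would not be maximal.\<close>

lemma small_maximal_solution_global:
  fixes \<Omega> :: "(real^'n) set"
  assumes N: "is_norm N" and \<Omega>: "open \<Omega>" "0 \<in> \<Omega>"
    and ce: "crossing_estimate A c k (filippov_map N \<Omega> \<Sigma> f)"
    and \<rho>': "\<rho>' > 0" and local_ex: "\<forall>x0. norm x0 < \<rho>' \<longrightarrow>
      (\<exists>\<tau> \<phi>. \<tau> > 0 \<and> filippov_solution_compact N \<Omega> \<Sigma> f 0 \<tau> \<phi> \<and> \<phi> 0 = x0)"
  obtains \<rho> where "\<rho> > 0"
    "\<forall>I \<phi>. maximal_forward_solution N \<Omega> \<Sigma> f I \<phi> \<and> (\<forall>t\<in>I. norm (\<phi> t) \<le> \<rho>) \<longrightarrow> I = {0..}"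
proof -
  obtain \<rho>0 where \<rho>0: "\<rho>0 > 0" "ball 0 \<rho>0 \<subseteq> \<Omega>" using \<Omega> open_contains_ball by metis
  obtain C \<rho>1 where C: "C \<ge> 0" and \<rho>1: "\<rho>1 > 0"
    and est: "\<And>x w. norm x < \<rho>1 \<Longrightarrow> w \<in> filippov_map N \<Omega> \<Sigma> f x \<Longrightarrow> crossing_velocity A c k 1 C x w"
    using ce zero_less_one unfolding crossing_estimate_def by blast
  obtain a where a: "a > 0" "\<And>x. norm (A *v x) \<le> a * norm x" using matrix_bound[of A] by blast
  define \<rho> where "\<rho> = min \<rho>0 (min \<rho>1 \<rho>') / 2"
  have \<rho>: "\<rho> > 0" "\<rho> < \<rho>0" "\<rho> < \<rho>1" "\<rho> < \<rho>'" using \<rho>0 \<rho>1 \<rho>' by (auto simp: \<rho>_def)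
  define M where "M = a * \<rho> + norm c + (1 + C) * \<rho>"
  have M: "M \<ge> 0" using a \<rho> C by (simp add: M_def)
  have speed: "norm w \<le> M" if x: "norm x \<le> \<rho>" and w: "w \<in> filippov_map N \<Omega> \<Sigma> f x" for x w
  proof -
    obtain l e where l: "0 \<le> l" "l \<le> 1" "w = A *v x + l *\<^sub>R c + e" "norm e \<le> (1 + C * l) * norm x"
      using est[OF le_less_trans[OF x \<rho>(3)] w] unfolding crossing_velocity_def by blast
    have "norm w \<le> norm (A *v x) + norm (l *\<^sub>R c) + norm e"
      unfolding l(3) by (intro norm_triangle_le add_right_mono norm_triangle_ineq)
    also have "\<dots> \<le> a * \<rho> + 1 * norm c + (1 + C * 1) * \<rho>"
    proof (intro add_mono)
      show "norm (A *v x) \<le> a * \<rho>" using a(2)[of x] mult_left_mono[OF x, of a] a(1) by linarith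
      show "norm (l *\<^sub>R c) \<le> 1 * norm c" using l by (simp add: mult_left_le_one_le)
      show "norm e \<le> (1 + C * 1) * \<rho>"
        using l(4) by (rule order_trans) (intro mult_mono add_mono mult_left_mono order_refl; use l C x \<rho> in simp)
    qed
    finally show ?thesis by (simp add: M_def)
  qed
  show ?thesis
  proof (rule that[OF \<rho>(1)], intro allI impI)
    fix I \<phi> assume *: "maximal_forward_solution N \<Omega> \<Sigma> f I \<phi> \<and> (\<forall>t\<in>I. norm (\<phi> t) \<le> \<rho>)"
    then have max: "maximal_forward_solution N \<Omega> \<Sigma> f I \<phi>" and small: "\<And>t. t \<in> I \<Longrightarrow> norm (\<phi> t) \<le> \<rho>" by auto
    have fwd: "forward_solution N \<Omega> \<Sigma> f I \<phi>" using max by (simp add: maximal_forward_solution_def)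
    have maxD: "J = I" if "forward_solution N \<Omega> \<Sigma> f J \<psi>" "I \<subseteq> J" "\<And>t. t \<in> I \<Longrightarrow> \<psi> t = \<phi> t" for J \<psi>
      using max that unfolding maximal_forward_solution_def by blast
    have I: "is_interval I" "0 \<in> I" "I \<subseteq> {0..}" using fwd by (auto simp: forward_solution_def filippov_solution_def)
    show "I = {0..}"
    proof (rule ccontr)
      assume "I \<noteq> {0..}"
      then obtain b where b: "b \<ge> 0" "b \<notin> I" using I(3) by auto
      have less_b: "t \<le> b" if "t \<in> I" for t
      proof (rule ccontr)
        assume "\<not> t \<le> b"
        then show False using mem_is_interval_1_I[OF I(1,2) that, of b] b by simp
      qed
      then have bdd: "bdd_above I" by (rule bdd_aboveI)
      define s where "s = Sup I"
      have le_s: "t \<le> s" if "t \<in> I" for t unfolding s_def using cSup_upper[OF that bdd] .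
      have s0: "s \<ge> 0" using le_s I(2) .
      show False
      proof (cases "s \<in> I")
        case True
        have "norm (\<phi> s) < \<rho>'" using small[OF True] \<rho> by linarith
        then obtain \<tau> \<psi> where \<psi>: "\<tau> > 0" "filippov_solution_compact N \<Omega> \<Sigma> f 0 \<tau> \<psi>" "\<psi> 0 = \<phi> s"
          using local_ex by blast
        have "filippov_solution_compact N \<Omega> \<Sigma> f s (s + \<tau>) (\<lambda>t. \<psi> (t + (- s)))"
          by (rule solution_compact_shift) (use \<psi>(2) in simp)
        then have "filippov_solution_compact N \<Omega> \<Sigma> f 0 (s + \<tau>) (\<lambda>t. if t \<le> s then \<phi> t else \<psi> (t + (- s)))"
          using forward_solution_compactD[OF fwd True order_refl] \<psi> s0 by (intro solution_compact_concat) auto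
        then have "forward_solution N \<Omega> \<Sigma> f {0..s + \<tau>} (\<lambda>t. if t \<le> s then \<phi> t else \<psi> (t + (- s)))"
          by (rule forward_solution_Icc) (use s0 \<psi> in simp)
        moreover have "I \<subseteq> {0..s + \<tau>}" using le_s I(3) \<psi>(1) by fastforce
        ultimately have "{0..s + \<tau>} = I" by (rule maxD) (use le_s in simp)
        then have "s + \<tau> \<in> I" using s0 \<psi>(1) by auto
        then show False using le_s \<psi>(1) by fastforce
      next
        case False
        have spos: "s > 0" using s0 I(2) False by (metis less_eq_real_def)
        have sub: "{0..<s} \<subseteq> I"
        proof
          fix t assume t: "t \<in> {0..<s}"
          then obtain u where "u \<in> I" "t < u" unfolding s_def using less_cSup_iff[OF _ bdd] I(2) by auto
          then show "t \<in> I" using mem_is_interval_1_I[OF I(1,2), of u t] t by simp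
        qed
        have Ieq: "I \<subseteq> {0..<s}" using le_s False I(3) by (metis atLeastLessThan_iff atLeast_iff less_eq_real_def subset_iff)
        have lip: "M-lipschitz_on {0..<s} \<phi>"
        proof (rule lipschitz_on_leI)
          fix p q assume pq: "p \<in> {0..<s}" "q \<in> {0..<s}" "p \<le> q"
          have "filippov_solution_compact N \<Omega> \<Sigma> f p q \<phi>"
            using pq sub by (intro forward_solution_compactD[OF fwd]) auto
          then obtain E where E: "abs_continuous_on p q \<phi>" "negligible E"
            "\<And>t. t\<in>{p..q} - E \<Longrightarrow> \<exists>w. (\<phi> has_vector_derivative w) (at t within {p..q}) \<and> w \<in> filippov_map N \<Omega> \<Sigma> f (\<phi> t)"
            unfolding solution_compact_iff by blast
          have "norm (\<phi> q - \<phi> p) \<le> M * (q - p)"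
          proof (rule AC_velocity_bound[OF pq(3) E(1,2)])
            fix t assume t: "t \<in> {p..q} - E"
            then have "t \<in> I" using pq sub by auto
            then show "\<exists>w. (\<phi> has_vector_derivative w) (at t within {p..q}) \<and> norm w \<le> M"
              using E(3)[OF t] speed small by blast
          qed
          then show "dist (\<phi> p) (\<phi> q) \<le> M * dist p q"
            using pq by (simp add: dist_norm norm_minus_commute)
        qed (use M in simp)
        have im: "\<phi> ` {0..<s} \<subseteq> cball 0 \<rho>" using small sub by auto
        have "cball 0 \<rho> \<subseteq> \<Omega>" using \<rho> \<rho>0(2) by fastforce
        then obtain \<psi> where \<psi>: "filippov_solution_compact N \<Omega> \<Sigma> f 0 s \<psi>" "\<And>t. t \<in> {0..<s} \<Longrightarrow> \<psi> t = \<phi> t"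
          using solution_half_open_closure[OF _ spos lip im closed_cball] forward_solution_compactD[OF fwd _ order_refl] sub
          by (metis atLeastLessThan_iff subsetD)
        have "{0..s} = I"
          by (rule maxD[OF forward_solution_Icc[OF \<psi>(1) s0]]) (use Ieq \<psi>(2) in auto)
        then show False using False s0 by auto
      qed
    qed
  qed
qed

text \<open>The system is autonomous, so the solution restarted at time \<open>n T\<close> is again a solution and the halving
property can be iterated; between multiples of \<open>T\<close> it can grow at most by the factor \<open>R\<close>.\<close>

lemma halving_imp_exponential_decay:
  fixes \<Omega> :: "(real^'n) set"
  assumes T: "T > 0" and R: "R \<ge> 1"
    and close: "\<And>\<phi> S t. S \<le> T \<Longrightarrow> filippov_solution_compact N \<Omega> \<Sigma> f 0 S \<phi> \<Longrightarrow> norm (\<phi> 0) < r \<Longrightarrow>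
       0 \<le> t \<Longrightarrow> t \<le> S \<Longrightarrow> norm (\<phi> t) \<le> R * norm (\<phi> 0)"
    and half: "\<And>\<phi>. filippov_solution_compact N \<Omega> \<Sigma> f 0 T \<phi> \<Longrightarrow> norm (\<phi> 0) < r \<Longrightarrow> norm (\<phi> T) \<le> norm (\<phi> 0) / 2"
    and fwd: "forward_solution N \<Omega> \<Sigma> f I \<phi>" and init: "norm (\<phi> 0) < r" and t: "t \<in> I"
  shows "norm (\<phi> t) \<le> 2 * R * exp (- (ln 2 / T) * t) * norm (\<phi> 0)"
proof -
  have I: "is_interval I" "0 \<in> I" "I \<subseteq> {0..}" using fwd by (auto simp: forward_solution_def filippov_solution_def)
  have shifted: "filippov_solution_compact N \<Omega> \<Sigma> f 0 S (\<lambda>u. \<phi> (u + s))" if "0 \<le> s" "S + s \<in> I" for s S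
    by (rule solution_compact_shift) (use that forward_solution_compactD[OF fwd] in simp)
  have nodes: "real n * T \<in> I \<Longrightarrow> norm (\<phi> (real n * T)) \<le> (1 / 2) ^ n * norm (\<phi> 0)" for n
  proof (induction n)
    case (Suc n)
    have mem: "T + real n * T \<in> I" using Suc.prems by (simp add: algebra_simps)
    have "real n * T \<in> I"
      using mem_is_interval_1_I[OF I(1,2) mem, of "real n * T"] T by simp
    then have IH: "norm (\<phi> (real n * T)) \<le> (1 / 2) ^ n * norm (\<phi> 0)" by (rule Suc.IH)
    also have "\<dots> \<le> 1 * norm (\<phi> 0)" by (intro mult_right_mono power_le_one) auto
    finally have "norm (\<phi> (0 + real n * T)) < r" using init by simp
    then have "norm (\<phi> (T + real n * T)) \<le> norm (\<phi> (0 + real n * T)) / 2"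
      using half[OF shifted[OF _ mem]] T by simp
    then show ?case using IH by (simp add: algebra_simps)
  qed simp
  \<comment> \<open>Rounding \<open>t\<close> down to a multiple of \<open>T\<close> costs the factor \<open>2\<close>.\<close>
  define n where "n = nat \<lfloor>t / T\<rfloor>"
  have t0: "t \<ge> 0" using t I by auto
  have n: "real n * T \<le> t" "t < (real n + 1) * T" unfolding n_def using floor_step[OF T t0] by auto
  have mem: "real n * T \<in> I" using mem_is_interval_1_I[OF I(1,2) t, of "real n * T"] n T by simp
  have nT: "norm (\<phi> (real n * T)) \<le> (1 / 2) ^ n * norm (\<phi> 0)" using nodes[OF mem] .
  also have "\<dots> \<le> 1 * norm (\<phi> 0)" by (intro mult_right_mono power_le_one) auto
  finally have "norm (\<phi> (0 + real n * T)) < r" using init by simp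
  then have "norm (\<phi> ((t - real n * T) + real n * T)) \<le> R * norm (\<phi> (0 + real n * T))"
    using n t T by (intro close[OF _ shifted[of "real n * T" "t - real n * T"]]) (auto simp: algebra_simps)
  then have "norm (\<phi> t) \<le> R * norm (\<phi> (real n * T))" by simp
  also have "\<dots> \<le> R * ((1 / 2) ^ n * norm (\<phi> 0))" using R by (intro mult_left_mono nT) auto
  also have "\<dots> \<le> R * ((2 * exp (- (ln 2 / T) * t)) * norm (\<phi> 0))"
  proof (intro mult_left_mono mult_right_mono)
    have "(1 / 2 :: real) ^ n = exp (- (real n * ln 2))"
      by (simp add: exp_minus exp_of_nat_mult power_one_over inverse_eq_divide)
    also have "\<dots> \<le> exp (ln 2 + - (ln 2 / T) * t)"
    proof -
      have "t / T \<le> real n + 1" using n(2) T by (simp add: divide_le_eq)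
      then have "ln 2 * (t / T) \<le> ln 2 * (real n + 1)" by (intro mult_left_mono) auto
      then show ?thesis by (simp add: algebra_simps)
    qed
    also have "\<dots> = 2 * exp (- (ln 2 / T) * t)" unfolding exp_add by simp
    finally show "(1 / 2 :: real) ^ n \<le> 2 * exp (- (ln 2 / T) * t)" .
  qed (use R in auto)
  finally show ?thesis by (simp add: ac_simps)
qed

text \<open>A maximal solution of the first system through the initial point is global by stability; at time \<open>T\<close> it has
shrunk to a quarter and is within a quarter of the solution of the second system.\<close>

lemma exp_stable_transfer:
  fixes \<Omega>1 \<Omega>2 :: "(real^'n) set"
  assumes N: "is_norm N" and c: "c $ k < 0"
    and \<Omega>1: "open \<Omega>1" "0 \<in> \<Omega>1"
    and ce1: "crossing_estimate A c k (filippov_map N \<Omega>1 \<Sigma>1 f1)"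
    and ce2: "crossing_estimate A c k (filippov_map N \<Omega>2 \<Sigma>2 f2)"
    and eq2: "filippov_equilibrium N \<Omega>2 \<Sigma>2 f2 0"
    and \<rho>: "\<rho> > 0" and global2: "\<forall>I \<phi>. maximal_forward_solution N \<Omega>2 \<Sigma>2 f2 I \<phi> \<and> (\<forall>t\<in>I. norm (\<phi> t) \<le> \<rho>) \<longrightarrow> I = {0..}"
    and es: "exp_stable_equilibrium N \<Omega>1 \<Sigma>1 f1 0"
  shows "exp_stable_equilibrium N \<Omega>2 \<Sigma>2 f2 0"
proof -
  obtain m M where mM: "m > 0" "M > 0" "\<And>x. m * norm x \<le> N x" "\<And>x. N x \<le> M * norm x"
    by (fact is_norm_bounds[OF N])
  obtain \<alpha> \<beta> \<delta> where \<alpha>: "\<alpha> \<ge> 1" and \<beta>: "\<beta> > 0" and \<delta>: "\<delta> > 0"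
    and es1: "\<And>I \<phi>. maximal_forward_solution N \<Omega>1 \<Sigma>1 f1 I \<phi> \<Longrightarrow> \<phi> 0 \<in> norm_ball N 0 \<delta> \<Longrightarrow>
        I = {0..} \<and> (\<forall>t\<ge>0. N (\<phi> t - 0) \<le> \<alpha> * exp (- \<beta> * t) * N (\<phi> 0 - 0))"
    using es unfolding exp_stable_equilibrium_def by blast
  \<comment> \<open>After time \<open>T\<close> the decay of the stable system beats the constant \<open>\<alpha> M / m\<close> that arises from
    passing between \<open>N\<close> and the Euclidean norm, by a factor \<open>4\<close>.\<close>
  define T where "T = max 1 (ln (4 * \<alpha> * M / m) / \<beta>)"
  have T: "T > 0" by (simp add: T_def)
  have quarter: "\<alpha> * exp (- \<beta> * T) * M \<le> m / 4"
  proof -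
    have pos: "4 * \<alpha> * M / m > 0" using \<alpha> mM by auto
    have "ln (4 * \<alpha> * M / m) \<le> \<beta> * T" using \<beta> by (simp add: T_def max_def field_simps)
    then have "4 * \<alpha> * M / m \<le> exp (\<beta> * T)" using pos by (metis exp_le_cancel_iff exp_ln)
    then have "4 * \<alpha> * M \<le> m * exp (\<beta> * T)" using mM by (simp add: field_simps)
    then show ?thesis by (simp add: exp_minus field_simps)
  qed
  obtain r1 where r1: "r1 > 0"
    "\<And>\<phi> \<psi> S. 0 \<le> S \<Longrightarrow> S \<le> T \<Longrightarrow> filippov_solution_compact N \<Omega>1 \<Sigma>1 f1 0 S \<phi> \<Longrightarrow>
       filippov_solution_compact N \<Omega>2 \<Sigma>2 f2 0 S \<psi> \<Longrightarrow> \<phi> 0 = \<psi> 0 \<Longrightarrow> norm (\<phi> 0) < r1 \<Longrightarrow>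
       norm (\<phi> S - \<psi> S) \<le> 1 / 4 * norm (\<phi> 0)"
    using solutions_compare[OF ce1 ce2 c, of T "1 / 4"] T by auto
  obtain R r2 where R: "R \<ge> 1" "r2 > 0"
    and close: "\<And>\<phi> S t. S \<le> T \<Longrightarrow> filippov_solution_compact N \<Omega>2 \<Sigma>2 f2 0 S \<phi> \<Longrightarrow> norm (\<phi> 0) < r2 \<Longrightarrow>
       0 \<le> t \<Longrightarrow> t \<le> S \<Longrightarrow> norm (\<phi> t) \<le> R * norm (\<phi> 0)"
    using solutions_stay_close[OF ce2 c, of T] T by (metis less_imp_le)
  obtain \<rho>0 where \<rho>0: "\<rho>0 > 0" "ball 0 \<rho>0 \<subseteq> \<Omega>1" using \<Omega>1 open_contains_ball by metis
  define r where "r = min (min r1 r2) (min \<rho>0 (\<delta> / M))"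
  have r: "r > 0" using r1 R \<rho>0 \<delta> mM by (simp add: r_def)
  have half: "norm (\<phi> T) \<le> norm (\<phi> 0) / 2"
    if sol: "filippov_solution_compact N \<Omega>2 \<Sigma>2 f2 0 T \<phi>" and init: "norm (\<phi> 0) < r" for \<phi>
  proof -
    have "\<phi> 0 \<in> \<Omega>1" using init \<rho>0 by (auto simp: r_def)
    then obtain I \<psi> where max: "maximal_forward_solution N \<Omega>1 \<Sigma>1 f1 I \<psi>" and \<psi>0: "\<psi> 0 = \<phi> 0"
      by (rule maximal_forward_solution_exists)
    have "N (0 - \<phi> 0) \<le> M * norm (\<phi> 0)" using mM(4)[of "0 - \<phi> 0"] by simp
    also have "\<dots> < \<delta>" using init mM by (simp add: r_def field_simps)
    finally have "\<psi> 0 \<in> norm_ball N 0 \<delta>" by (simp add: norm_ball_def \<psi>0)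
    then have I: "I = {0..}" and decay: "\<And>t. t \<ge> 0 \<Longrightarrow> N (\<psi> t - 0) \<le> \<alpha> * exp (- \<beta> * t) * N (\<psi> 0 - 0)"
      using es1[OF max] by auto
    have fwd: "forward_solution N \<Omega>1 \<Sigma>1 f1 I \<psi>" using max by (simp add: maximal_forward_solution_def)
    have sol1: "filippov_solution_compact N \<Omega>1 \<Sigma>1 f1 0 T \<psi>"
      using forward_solution_compactD[OF fwd] I T by simp
    have "norm (\<psi> T - \<phi> T) \<le> 1 / 4 * norm (\<phi> 0)"
      using r1(2)[OF _ order_refl sol1 sol \<psi>0] T init \<psi>0 by (simp add: r_def)
    moreover have "norm (\<psi> T) \<le> norm (\<phi> 0) / 4"
    proof -
      have "m * norm (\<psi> T) \<le> N (\<psi> T)" by (rule mM)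
      also have "\<dots> \<le> \<alpha> * exp (- \<beta> * T) * N (\<phi> 0)" using decay[of T] T \<psi>0 by simp
      also have "\<dots> \<le> \<alpha> * exp (- \<beta> * T) * (M * norm (\<phi> 0))" using \<alpha> by (intro mult_left_mono mM) auto
      also have "\<dots> = (\<alpha> * exp (- \<beta> * T) * M) * norm (\<phi> 0)" by simp
      also have "\<dots> \<le> m / 4 * norm (\<phi> 0)" by (intro mult_right_mono quarter) auto
      finally show ?thesis using mM(1) by (simp add: field_simps)
    qed
    ultimately show ?thesis using norm_triangle_sub[of "\<phi> T" "\<psi> T"] by (simp add: norm_minus_commute)
  qed
  have decay2: "norm (\<phi> t) \<le> 2 * R * exp (- (ln 2 / T) * t) * norm (\<phi> 0)"
    if "forward_solution N \<Omega>2 \<Sigma>2 f2 I \<phi>" "norm (\<phi> 0) < r" "t \<in> I" for I \<phi> t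
  proof (rule halving_imp_exponential_decay[OF T R(1) _ half that])
    fix \<phi> S t assume "S \<le> T" "filippov_solution_compact N \<Omega>2 \<Sigma>2 f2 0 S \<phi>" "norm (\<phi> 0) < r" "0 \<le> t" "t \<le> S"
    then show "norm (\<phi> t) \<le> R * norm (\<phi> 0)" by (intro close) (auto simp: r_def)
  qed
  \<comment> \<open>Before it decays, a solution may grow by the factor \<open>2 R\<close>; it must not reach the radius \<open>\<rho>\<close>.\<close>
  define \<delta>2 where "\<delta>2 = m * min r (\<rho> / (2 * R))"
  define \<alpha>2 where "\<alpha>2 = max 1 (2 * R * M / m)"
  have "I = {0..} \<and> (\<forall>t\<ge>0. N (\<phi> t - 0) \<le> \<alpha>2 * exp (- (ln 2 / T) * t) * N (\<phi> 0 - 0))"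
    if max: "maximal_forward_solution N \<Omega>2 \<Sigma>2 f2 I \<phi>" and init: "\<phi> 0 \<in> norm_ball N 0 \<delta>2" for I \<phi>
  proof -
    have fwd: "forward_solution N \<Omega>2 \<Sigma>2 f2 I \<phi>" using max by (simp add: maximal_forward_solution_def)
    have I0: "I \<subseteq> {0..}" using fwd by (simp add: forward_solution_def)
    have "m * norm (\<phi> 0) < m * min r (\<rho> / (2 * R))"
      using init mM(3)[of "0 - \<phi> 0"] by (simp add: norm_ball_def \<delta>2_def)
    then have small: "norm (\<phi> 0) < r" "norm (\<phi> 0) < \<rho> / (2 * R)" using mM(1) by auto
    have bound: "norm (\<phi> t) \<le> \<rho>" if t: "t \<in> I" for t
    proof -
      have "norm (\<phi> t) \<le> 2 * R * exp (- (ln 2 / T) * t) * norm (\<phi> 0)" by (rule decay2[OF fwd small(1) t])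
      also have "\<dots> \<le> 2 * R * 1 * norm (\<phi> 0)"
        using R I0 t T by (intro mult_right_mono mult_left_mono) auto
      also have "\<dots> \<le> \<rho>" using small(2) R by (simp add: field_simps)
      finally show ?thesis .
    qed
    have I: "I = {0..}" using global2 max bound by blast
    have "N (\<phi> t - 0) \<le> \<alpha>2 * exp (- (ln 2 / T) * t) * N (\<phi> 0 - 0)" if t: "t \<ge> 0" for t
    proof -
      have "N (\<phi> t) \<le> M * norm (\<phi> t)" by (rule mM)
      also have "\<dots> \<le> M * (2 * R * exp (- (ln 2 / T) * t) * norm (\<phi> 0))"
        using mM(2) t I by (intro mult_left_mono decay2[OF fwd small(1)]) auto
      also have "\<dots> = (2 * R * M / m) * exp (- (ln 2 / T) * t) * (m * norm (\<phi> 0))" using mM(1) by simp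
      also have "\<dots> \<le> \<alpha>2 * exp (- (ln 2 / T) * t) * N (\<phi> 0)"
        using mM(1) R by (intro mult_mono mM(3)) (auto simp: \<alpha>2_def)
      finally show ?thesis by simp
    qed
    then show ?thesis using I by blast
  qed
  moreover have "\<alpha>2 \<ge> 1" "ln 2 / T > 0" "\<delta>2 > 0" using T mM r \<rho> R by (auto simp: \<alpha>2_def \<delta>2_def)
  ultimately show ?thesis using eq2 unfolding exp_stable_equilibrium_def by blast
qed

lemma (in two_piece_boundary_equilibrium) exp_stable_transfer_from:
  assumes "open \<Omega>'" "0 \<in> \<Omega>'" "crossing_estimate A c k (filippov_map N \<Omega>' \<Sigma>' f')"
    and "exp_stable_equilibrium N \<Omega>' \<Sigma>' f' 0"
  shows "exp_stable_equilibrium N \<Omega> switching velocity 0"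
proof -
  obtain \<rho>' where \<rho>': "\<rho>' > 0" "\<forall>x0. norm x0 < \<rho>' \<longrightarrow>
      (\<exists>\<tau> \<phi>. \<tau> > 0 \<and> filippov_solution_compact N \<Omega> switching velocity 0 \<tau> \<phi> \<and> \<phi> 0 = x0)"
    by (fact local_existence)
  obtain \<rho> where \<rho>: "\<rho> > 0"
    "\<forall>I \<phi>. maximal_forward_solution N \<Omega> switching velocity I \<phi> \<and> (\<forall>t\<in>I. norm (\<phi> t) \<le> \<rho>) \<longrightarrow> I = {0..}"
    by (fact small_maximal_solution_global[OF is_norm open_domain zero_domain crossing \<rho>'])
  show ?thesis
    by (rule exp_stable_transfer[OF is_norm inward assms(1-3) crossing equilibrium \<rho> assms(4)])
qed

lemma C1_on_imp_continuous_on: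
  assumes "C1_on S g"
  shows "continuous_on S g"
proof -
  obtain g' where "\<forall>x\<in>S. (g has_derivative blinfun_apply (g' x)) (at x within S)"
    using assms unfolding C1_on_def by (elim exE conjE)
  then show ?thesis
    by (intro has_derivative_continuous_on[of S g "\<lambda>x. blinfun_apply (g' x)"]) simp
qed

theorem theorem2p1:
  fixes N :: "real^'n \<Rightarrow> real"
    and k :: 'n
    and \<Omega> \<Sigma> \<Omega>L \<Omega>R :: "(real^'n) set"
    and fL fR :: "real^'n \<Rightarrow> real^'n"
    and A :: "real^'n^'n"
    and c :: "real^'n"
  assumes "is_norm N"
    and "open \<Omega>" and "connected \<Omega>" and "0 \<in> \<Omega>"
    and "\<Sigma> = {x \<in> \<Omega>. x $ k = 0}"
    and "\<Omega>L = {x \<in> \<Omega>. x $ k < 0}"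
    and "\<Omega>R = {x \<in> \<Omega>. x $ k > 0}"
    and "C1_on (\<Omega>L \<union> \<Sigma>) fL" and "C1_on (\<Omega>R \<union> \<Sigma>) fR"
    and "filippov_system \<Omega> \<Sigma> (two_piece k fL fR)"
    and "fL 0 = 0"
    and "(fL has_derivative (\<lambda>v. A *v v)) (at 0 within (\<Omega>L \<union> \<Sigma>))"
    and "c = fR 0"
    and "c $ k < 0"
  shows "exp_stable_equilibrium N \<Omega> \<Sigma> (two_piece k fL fR) 0 \<longleftrightarrow>
         exp_stable_equilibrium N UNIV {x. x $ k = 0} (two_piece k (\<lambda>x. A *v x) (\<lambda>x. c)) 0"
proof -
  have left: "\<Omega>L \<union> \<Sigma> = {x\<in>\<Omega>. x $ k \<le> 0}" and right: "\<Omega>R \<union> \<Sigma> = {x\<in>\<Omega>. 0 \<le> x $ k}"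
    using assms(5-7) by auto
  have "0 \<in> \<Omega>R \<union> \<Sigma>" using assms(4) right by simp
  then have right_der: "\<exists>D. (fR has_derivative D) (at 0 within {x\<in>\<Omega>. 0 \<le> x $ k})"
    using assms(9) unfolding C1_on_def right by blast
  interpret f: two_piece_boundary_equilibrium N k \<Omega> fL fR A c
    using assms(1,2,4,11-14) C1_on_imp_continuous_on[OF assms(8)] C1_on_imp_continuous_on[OF assms(9)] right_der
    unfolding left right by unfold_locales auto
  have linear: "((*v) A has_derivative (*v) A) (at 0 within S)" for S
    by (intro bounded_linear_imp_has_derivative) (simp add: linear_linear)
  interpret F: two_piece_boundary_equilibrium N k UNIV "\<lambda>x. A *v x" "\<lambda>x. c" A c
    using assms(1,14) linear
    by unfold_locales (auto intro!: linear_continuous_on has_derivative_const simp: linear_linear)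
  have sets: "\<Sigma> = f.switching" "{x. x $ k = 0} = F.switching" using assms(5) by auto
  show ?thesis
    unfolding sets
    using f.exp_stable_transfer_from[OF F.open_domain F.zero_domain F.crossing]
      F.exp_stable_transfer_from[OF f.open_domain f.zero_domain f.crossing] by blast
qed

end
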